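(* Assume that $A(x)=b(x)\,\mathrm{Id}$ for some scalar-valued random field $b$, and that for all rotations $R\in SO(d)$ the fields $b(R\,\cdot)$ and $b$ have the same (joint) distribution. Then there exists $C>0$ such that for all $\xi_1,\xi_2\in\mathbb R^d$ $$(\bar a(\xi_1)-\bar a(\xi_2))\cdot(\xi_1-\xi_2)\ge\tfrac1C\big(|\xi_1-\xi_2|^2+|\xi_1-\xi_2|^p\big)$$ and $$(\bar a(\xi_1)-\bar a(\xi_2))\cdot(\xi_1-\xi_2)\ge\tfrac1C\big(|\xi_1|^{p-2}+|\xi_2|^{p-2}\big)|\xi_1-\xi_2|^2.$$
   Context: Let $d\ge1$, $p\ge2$, $0<\lambda\le1$. $A$ is a stationary and ergodic random matrix field on $\mathbb R^d$, smooth uniformly with respect to the randomness, with $\xi\cdot A(x)\xi\ge\lambda|\xi|^2$ and $|A(x)\xi|\le|\xi|$ for all $x,\xi\in\mathbb R^d$. $\mathbb P$ denotes its law and $\mathbb E$ the expectation. Ergodic means that a random variable $Y=Y(A)$ with $Y(A(\cdot+z))=Y(A)$ for all $z\in\mathbb R^d$ equals $\mathbb E[Y]$ almost surely; a random field $X(x,A)$ is stationary if $X(x+z,A)=X(x,A(\cdot+z))$ for all $z$ and a.e. $x$. Set $a(x,\xi):=A(x)(1+|\xi|^{p-2})\xi$. For $\xi\in\mathbb R^d$, the corrector $\phi_\xi$ is the unique random field which almost surely lies in $W^{1,p}_{\rm loc}(\mathbb R^d)$, solves $-\nabla\cdot a(x,\xi+\nabla\phi_\xi(x))=0$ in the distributional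 sense in $\mathbb R^d$, has vanishing integral on the unit ball centered at the origin, and whose gradient is stationary with $\mathbb E[\nabla\phi_\xi]=0$ and $\mathbb E[|\nabla\phi_\xi|^2+|\nabla\phi_\xi|^p]\lesssim|\xi|^2+|\xi|^p$. The homogenized map is $\bar a(\xi):=\mathbb E[a(0,\xi+\nabla\phi_\xi(0))]$. *)

theory Defs
  imports "HOL-Probability.Probability"
begin

definition dir_deriv :: "'a::real_normed_vector \<Rightarrow> ('a \<Rightarrow> 'b::real_normed_vector) \<Rightarrow> 'a \<Rightarrow> 'b" where
  "dir_deriv v f x = frechet_derivative f (at x) v"

text \<open>The partial derivative along the basis vectors in the list \<open>vs\<close>; its order is \<open>length vs\<close>.\<close>

definition iter_deriv :: "'a::real_normed_vector list \<Rightarrow> ('a \<Rightarrow> 'b::real_normed_vector) \<Rightarrow> 'a \<Rightarrow> 'b" where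
  "iter_deriv vs f = foldr dir_deriv vs f"

definition smooth :: "('a::euclidean_space \<Rightarrow> 'b::real_normed_vector) \<Rightarrow> bool" where
  "smooth f \<longleftrightarrow> (\<forall>vs\<in>lists Basis. \<forall>x. iter_deriv vs f differentiable (at x))"

definition grad :: "(real^'d \<Rightarrow> real) \<Rightarrow> real^'d \<Rightarrow> real^'d" where
  "grad f x = (\<chi> i. dir_deriv (axis i 1) f x)"

definition test_fun :: "('a::euclidean_space \<Rightarrow> real) \<Rightarrow> bool" where
  "test_fun \<eta> \<longleftrightarrow> smooth \<eta> \<and> compact (closure {x. \<eta> x \<noteq> 0})"

definition loc_integrable :: "('a::euclidean_space \<Rightarrow> 'b::{banach, second_countable_topology}) \<Rightarrow> bool" where
  "loc_integrable f \<longleftrightarrow> (\<forall>K. compact K \<longrightarrow> set_integrable lborel K f)"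

definition weak_gradient :: "(real^'d \<Rightarrow> real) \<Rightarrow> (real^'d \<Rightarrow> real^'d) \<Rightarrow> bool" where
  "weak_gradient f G \<longleftrightarrow> loc_integrable f \<and> loc_integrable G \<and>
     (\<forall>\<eta>. test_fun \<eta> \<longrightarrow>
        (LINT x|lborel. f x *\<^sub>R grad \<eta> x) = - (LINT x|lborel. \<eta> x *\<^sub>R G x))"

text \<open>Exponents of norms are real numbers and may vanish: the convention is \<open>0\<^sup>0 = 1\<close>,
  whereas \<open>0 powr 0 = 0\<close>.\<close>

definition rpow :: "real \<Rightarrow> real \<Rightarrow> real" where
  "rpow t s = (if s = 0 then 1 else t powr s)"

definition W1p_loc :: "real \<Rightarrow> (real^'d \<Rightarrow> real) \<Rightarrow> bool" where
  "W1p_loc p f \<longleftrightarrow> (\<exists>G. weak_gradient f G \<and>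
     loc_integrable (\<lambda>x. rpow \<bar>f x\<bar> p) \<and> loc_integrable (\<lambda>x. rpow (norm (G x)) p))"

text \<open>A weak gradient is only determined up to null sets, but the homogenized map evaluates it at
  the origin. Point values are therefore those of the precise representative, i.e. the limits of the
  averages over small balls. They agree with the function almost everywhere by Lebesgue
  differentiation, and everywhere if it is continuous.\<close>

definition ball_avg :: "('a::euclidean_space \<Rightarrow> 'b::{banach, second_countable_topology}) \<Rightarrow> 'a \<Rightarrow> real \<Rightarrow> 'b" where
  "ball_avg f x r = (1 / measure lborel (ball x r)) *\<^sub>R (LINT y:ball x r|lborel. f y)"

definition precise_rep :: "('a::euclidean_space \<Rightarrow> 'b::{banach, second_countable_topology}) \<Rightarrow> 'a \<Rightarrow> 'b" where
  "precise_rep f x =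
     (if \<exists>l. (ball_avg f x \<longlongrightarrow> l) (at_right 0) then Lim (at_right 0) (ball_avg f x) else 0)"

definition wgrad :: "(real^'d \<Rightarrow> real) \<Rightarrow> real^'d \<Rightarrow> real^'d" where
  "wgrad f = precise_rep (SOME G. weak_gradient f G)"

text \<open>The randomness is given by the law \<open>P\<close> of \<open>A\<close>: a probability measure on the smooth matrix
  fields with the \<open>\<sigma>\<close>-algebra generated by the point evaluations. Random variables and random
  fields are functions of \<open>A\<close>.\<close>

type_synonym 'd coeff = "real^'d \<Rightarrow> real^'d^'d"

definition coeff_space :: "('d::finite) coeff measure" where
  "coeff_space = restrict_space (\<Pi>\<^sub>M x\<in>UNIV. borel) {A. smooth A}"

definition shift :: "real^'d \<Rightarrow> (real^'d \<Rightarrow> 'b) \<Rightarrow> real^'d \<Rightarrow> 'b" where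
  "shift z A x = A (x + z)"

definition coeff_law :: "('d::finite) coeff measure \<Rightarrow> bool" where
  "coeff_law P \<longleftrightarrow> prob_space P \<and> sets P = sets coeff_space"

definition stationary_law :: "('d::finite) coeff measure \<Rightarrow> bool" where
  "stationary_law P \<longleftrightarrow> (\<forall>z. distr P P (shift z) = P)"

definition ergodic_law :: "('d::finite) coeff measure \<Rightarrow> bool" where
  "ergodic_law P \<longleftrightarrow> (\<forall>Y::'d coeff \<Rightarrow> real. integrable P Y \<longrightarrow>
     (\<forall>A\<in>space P. \<forall>z. Y (shift z A) = Y A) \<longrightarrow> (AE A in P. Y A = (LINT A'|P. Y A')))"

definition uniformly_smooth_law :: "('d::finite) coeff measure \<Rightarrow> bool" where
  "uniformly_smooth_law P \<longleftrightarrow> (\<forall>k. \<exists>C. AE A in P. \<forall>vs\<in>lists Basis. length vs = k \<longrightarrow>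
     (\<forall>x. norm (iter_deriv vs A x) \<le> C))"

definition elliptic_law :: "real \<Rightarrow> ('d::finite) coeff measure \<Rightarrow> bool" where
  "elliptic_law lam P \<longleftrightarrow> (AE A in P. \<forall>x \<xi>.
     \<xi> \<bullet> (A x *v \<xi>) \<ge> lam * (norm \<xi>)\<^sup>2 \<and> norm (A x *v \<xi>) \<le> norm \<xi>)"

definition random_field ::
  "('d::finite) coeff measure \<Rightarrow> ('d coeff \<Rightarrow> real^'d \<Rightarrow> 'b::topological_space) \<Rightarrow> bool" where
  "random_field P X \<longleftrightarrow> (\<lambda>(A, x). X A x) \<in> borel_measurable (P \<Otimes>\<^sub>M lborel)"

definition stationary_field ::
  "('d::finite) coeff measure \<Rightarrow> ('d coeff \<Rightarrow> real^'d \<Rightarrow> 'b::topological_space) \<Rightarrow> bool" where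
  "stationary_field P X \<longleftrightarrow> random_field P X \<and>
     (\<forall>z. AE A in P. AE x in lborel. X A (x + z) = X (shift z A) x)"

definition flux :: "real \<Rightarrow> ('d::finite) coeff \<Rightarrow> real^'d \<Rightarrow> real^'d \<Rightarrow> real^'d" where
  "flux p A x \<zeta> = A x *v ((1 + rpow (norm \<zeta>) (p - 2)) *\<^sub>R \<zeta>)"

text \<open>\<open>K\<close> is the constant hidden in the moment bound, to be chosen independently of \<open>\<xi>\<close>. By
  stationarity the expectations do not depend on the point, which is taken to be the origin.\<close>

definition corrector ::
  "('d::finite) coeff measure \<Rightarrow> real \<Rightarrow> real \<Rightarrow> real^'d \<Rightarrow> ('d coeff \<Rightarrow> real^'d \<Rightarrow> real) \<Rightarrow> bool" where
  "corrector P p K \<xi> \<phi> \<longleftrightarrow>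
     random_field P \<phi> \<and>
     (AE A in P. W1p_loc p (\<phi> A)) \<and>
     (AE A in P. \<forall>\<eta>. test_fun \<eta> \<longrightarrow>
        (LINT x|lborel. flux p A x (\<xi> + wgrad (\<phi> A) x) \<bullet> grad \<eta> x) = 0) \<and>
     (AE A in P. (LINT x:ball 0 1|lborel. \<phi> A x) = 0) \<and>
     stationary_field P (\<lambda>A. wgrad (\<phi> A)) \<and>
     (LINT A|P. wgrad (\<phi> A) 0) = 0 \<and>
     (\<integral>\<^sup>+A. ennreal ((norm (wgrad (\<phi> A) 0))\<^sup>2 + rpow (norm (wgrad (\<phi> A) 0)) p) \<partial>P)
        \<le> ennreal (K * ((norm \<xi>)\<^sup>2 + rpow (norm \<xi>) p))"

text \<open>\<open>\<Phi> \<xi>\<close> is the corrector in direction \<open>\<xi>\<close>.\<close>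

definition homogenized_map ::
  "('d::finite) coeff measure \<Rightarrow> real \<Rightarrow> (real^'d \<Rightarrow> 'd coeff \<Rightarrow> real^'d \<Rightarrow> real) \<Rightarrow> real^'d \<Rightarrow> real^'d" where
  "homogenized_map P p \<Phi> \<xi> = (LINT A|P. flux p A 0 (\<xi> + wgrad (\<Phi> \<xi> A) 0))"

definition joint_law ::
  "('d::finite) coeff measure \<Rightarrow> ('d coeff \<Rightarrow> real^'d \<Rightarrow> real) \<Rightarrow> (real^'d \<Rightarrow> real) measure" where
  "joint_law P X = distr P (\<Pi>\<^sub>M x\<in>UNIV. borel) X"

end

theory Submission
  imports Defs
begin

text \<open>
  Let \<open>f \<xi> A\<close> be the value at the origin of the gradient of the corrector in direction \<open>\<xi>\<close>, and let
  \<open>T x\<close> be the shift of coefficient fields by \<open>x\<close>. Then the gradient at \<open>x\<close> is \<open>f \<xi> (T x A)\<close> for almost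
  every \<open>x\<close>, so that the corrector problem becomes a problem about random variables under a measure
  preserving ergodic flow.

  The analytic input is the orthogonality \<open>div_curl_orthogonal\<close>: the mean of \<open>q \<bullet> g\<close> vanishes for every
  stationary divergence-free field \<open>q\<close> and every stationary gradient field \<open>g\<close> with zero mean, of dual
  integrability. The reason is that the correlation \<open>c(x)\<close>, the mean of \<open>q(0) \<bullet> g(x)\<close>, has zero
  distributional gradient: differentiating \<open>g\<close> turns the trace of the matrix of correlations into its
  divergence because \<open>g\<close> is curl-free, and this divergence vanishes because \<open>q\<close> is divergence-free. A
  constant correlation does not change when \<open>g\<close> is replaced by averages of its translates, and these
  tend to zero by the mean ergodic theorem.

  The rest is convex analysis. Since the matrix field is scalar, \<open>A = \<beta> Id\<close>, the flux is the gradient of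
  \<open>\<beta> (|\<zeta>|\<^sup>2 / 2 + |\<zeta>|\<^sup>p / p)\<close>, and by orthogonality \<open>\<xi> + f \<xi>\<close> minimizes the mean of this energy among all
  stationary gradient fields with mean \<open>\<xi>\<close>. Let \<open>W \<xi>\<close> be the minimum. The homogenized map is a subgradient of
  \<open>W\<close> (\<open>energy_above_tangent\<close>). Moreover the density is convex as a function of \<open>|\<zeta>|\<^sup>2\<close>, and this property
  survives the minimization: \<open>W\<close> satisfies a tangent inequality in \<open>|\<xi>|\<^sup>2\<close> along every ray
  (\<open>min_energy_along_ray\<close>).

  Isotropy makes \<open>W\<close> radial, because a rotated gradient field is an admissible competitor for the rotated
  direction (\<open>rotated_competitor\<close>). Hence the homogenized map has the form \<open>\<psi>(\<xi>) \<xi>\<close>, where \<open>\<psi>\<close> increases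
  with \<open>|\<xi>|\<close> by convexity in \<open>|\<xi>|\<^sup>2\<close> and \<open>\<psi>(\<xi>) \<ge> lam (1 + |\<xi>|\<^sup>p\<^sup>-\<^sup>2)\<close> by ellipticity and Jensen's inequality.
  For such maps
  \<open>(\<psi>\<^sub>1 \<xi>\<^sub>1 - \<psi>\<^sub>2 \<xi>\<^sub>2) \<bullet> (\<xi>\<^sub>1 - \<xi>\<^sub>2) \<ge> (\<psi>\<^sub>1 + \<psi>\<^sub>2) |\<xi>\<^sub>1 - \<xi>\<^sub>2|\<^sup>2 / 2\<close>
  (\<open>monotone_of_radial_energy\<close>), which contains both inequalities.
\<close>

section \<open>Powers of real numbers\<close>

text \<open>The tangent of the convex function \<open>t\<^sup>\<alpha>\<close>, written with the convention \<open>0\<^sup>0 = 1\<close> so that it also holds at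
  \<open>s = 0\<close> when \<open>\<alpha> = 1\<close>. All convexity arguments for powers below, including Jensen's inequality, come from
  this inequality.\<close>

lemma powr_tangent:
  fixes s t \<alpha> :: real
  assumes "\<alpha> \<ge> 1" "s \<ge> 0" "t \<ge> 0"
  shows "t powr \<alpha> \<ge> s powr \<alpha> + \<alpha> * rpow s (\<alpha> - 1) * (t - s)"
proof (cases "s = 0 \<or> \<alpha> = 1")
  case True
  then show ?thesis using assms by (auto simp: rpow_def)
next
  case False
  then have s: "s > 0" and a: "\<alpha> > 1" using assms by auto
  show ?thesis
  proof (cases "t = 0")
    case True
    have "s powr \<alpha> = s powr (\<alpha> - 1) * s"
      using s by (metis add.commute diff_add_cancel powr_add powr_one less_imp_le)
    then have "s powr \<alpha> + \<alpha> * (s powr (\<alpha> - 1)) * (t - s) = (1 - \<alpha>) * s powr \<alpha>"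
      using True by (simp add: algebra_simps)
    then show ?thesis using a s True by (simp add: rpow_def mult_nonpos_nonneg)
  next
    case False
    then have t: "t > 0" using assms by auto
    have der: "((\<lambda>x. x powr \<alpha>) has_real_derivative \<alpha> * x powr (\<alpha> - 1)) (at x within {0<..})"
      if "x \<in> {0<..}" for x
      using that by (auto intro!: derivative_eq_intros)
    have conv: "convex_on {0<..} (\<lambda>x::real. x powr \<alpha>)"
    proof (rule convex_on_realI[where f' = "\<lambda>x. \<alpha> * x powr (\<alpha> - 1)"])
      show "((\<lambda>x. x powr \<alpha>) has_real_derivative \<alpha> * x powr (\<alpha> - 1)) (at x)" if "x \<in> {0<..}" for x
        using that by (auto intro!: derivative_eq_intros)
      show "\<alpha> * x powr (\<alpha> - 1) \<le> \<alpha> * y powr (\<alpha> - 1)" if "x \<in> {0<..}" "y \<in> {0<..}" "x \<le> y" for x y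
        using that a by (auto intro!: powr_mono2)
    qed auto
    have "\<alpha> * s powr (\<alpha> - 1) * (t - s) \<le> t powr \<alpha> - s powr \<alpha>"
      by (rule convex_on_imp_above_tangent[OF conv _ _ _ der]) (use s t in \<open>auto simp: interior_open\<close>)
    then show ?thesis using a by (simp add: rpow_def)
  qed
qed

section \<open>Radial bump functions\<close>

text \<open>The family \<open>e\<^sup>-\<^sup>1\<^sup>/\<^sup>t / t\<^sup>k\<close>, extended by zero to \<open>t \<le> 0\<close>, is closed under differentiation up to linear
  combinations. This gives all derivatives of the classical bump function at once.\<close>

definition flat_exp :: "nat \<Rightarrow> real \<Rightarrow> real" where
  "flat_exp k t = (if t \<le> 0 then 0 else exp (- 1 / t) / t ^ k)"

lemma flat_exp_has_derivative:
  "(flat_exp k has_real_derivative flat_exp (k + 2) t - real k * flat_exp (k + 1) t) (at t)"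
proof -
  consider "t > 0" | "t < 0" | "t = 0" by linarith
  then show ?thesis
  proof cases
    case 1
    have d1: "((\<lambda>t. exp (- inverse t)) has_real_derivative exp (- inverse t) * (inverse t * inverse t)) (at t)"
      using 1 by (auto intro!: derivative_eq_intros simp: power2_eq_square)
    have d2: "((\<lambda>t. inverse t ^ k) has_real_derivative - (real k * (inverse t * inverse t ^ k))) (at t)"
      using DERIV_power[OF DERIV_inverse, of t k] 1 by (cases k) (auto simp: mult_ac)
    have "((\<lambda>t. exp (- inverse t) * inverse t ^ k) has_real_derivative
        flat_exp (k + 2) t - real k * flat_exp (k + 1) t) (at t)"
      by (rule DERIV_cong[OF DERIV_mult[OF d1 d2]])
        (use 1 in \<open>simp add: flat_exp_def divide_inverse power_inverse algebra_simps\<close>)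
    then show ?thesis
      by (rule has_field_derivative_transform_within_open[of _ _ _ "{0<..}"])
        (use 1 in \<open>auto simp: flat_exp_def divide_inverse power_inverse\<close>)
  next
    case 2
    have "((\<lambda>t. 0) has_real_derivative flat_exp (k + 2) t - real k * flat_exp (k + 1) t) (at t)"
      using 2 by (auto simp: flat_exp_def)
    then show ?thesis
      by (rule has_field_derivative_transform_within_open[of _ _ _ "{..<0}"])
        (use 2 in \<open>auto simp: flat_exp_def\<close>)
  next
    case 3
    have "((\<lambda>h. (flat_exp k (0 + h) - flat_exp k 0) / h) \<longlongrightarrow> 0) (at 0)"
    proof (rule filterlim_split_at)
      show "((\<lambda>h. (flat_exp k (0 + h) - flat_exp k 0) / h) \<longlongrightarrow> 0) (at_left 0)"
        by (rule tendsto_eventually)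
          (auto simp: flat_exp_def eventually_at_left_field intro!: exI[of _ "-1"])
      have lim: "((\<lambda>h. exp (- 1 / h) / h ^ Suc k) \<longlongrightarrow> (0::real)) (at_right 0)"
      proof -
        have "((\<lambda>x. x ^ Suc k / exp x) \<longlongrightarrow> (0::real)) at_top"
          by (rule tendsto_power_div_exp_0)
        then have "((\<lambda>h. (inverse h) ^ Suc k / exp (inverse h)) \<longlongrightarrow> (0::real)) (at_right 0)"
          by (rule filterlim_compose) (rule filterlim_inverse_at_top_right)
        then show ?thesis
          by (rule Lim_transform_eventually)
            (simp add: exp_minus divide_inverse power_inverse mult.commute)
      qed
      show "((\<lambda>h. (flat_exp k (0 + h) - flat_exp k 0) / h) \<longlongrightarrow> 0) (at_right 0)"
        by (rule Lim_transform_eventually[OF lim])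
          (auto simp: flat_exp_def eventually_at_right_field intro!: exI[of _ 1])
    qed
    then show ?thesis unfolding DERIV_def 3 by (simp add: flat_exp_def)
  qed
qed

lemma flat_exp_0_bounds: "0 \<le> flat_exp 0 t" "flat_exp 0 t \<le> 1"
  by (auto simp: flat_exp_def)

lemma flat_exp_continuous: "isCont (flat_exp k) t"
  by (rule DERIV_isCont[OF flat_exp_has_derivative])

text \<open>An algebra of functions that contains the radial bumps and is closed under directional
  derivatives; hence all its elements are smooth.\<close>

inductive_set bump_algebra :: "('a::euclidean_space \<Rightarrow> real) set" where
  const: "(\<lambda>x. c) \<in> bump_algebra"
| coord: "(\<lambda>x. x \<bullet> v) \<in> bump_algebra"
| bump: "(\<lambda>x. flat_exp k (s * (r\<^sup>2 - x \<bullet> x))) \<in> bump_algebra"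
| add: "f \<in> bump_algebra \<Longrightarrow> g \<in> bump_algebra \<Longrightarrow> (\<lambda>x. f x + g x) \<in> bump_algebra"
| mult: "f \<in> bump_algebra \<Longrightarrow> g \<in> bump_algebra \<Longrightarrow> (\<lambda>x. f x * g x) \<in> bump_algebra"

lemma bump_has_derivative:
  "((\<lambda>x::'a::euclidean_space. flat_exp k (s * (r\<^sup>2 - x \<bullet> x))) has_derivative
    (\<lambda>v. (flat_exp (k + 2) (s * (r\<^sup>2 - x \<bullet> x)) - real k * flat_exp (k + 1) (s * (r\<^sup>2 - x \<bullet> x))) *
      (- 2 * s * (x \<bullet> v)))) (at x)"
proof -
  have "((\<lambda>x. s * (r\<^sup>2 - x \<bullet> x)) has_derivative (\<lambda>v. - 2 * s * (x \<bullet> v))) (at x)"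
    by (auto intro!: derivative_eq_intros simp: inner_commute fun_eq_iff)
  from DERIV_compose_FDERIV[OF flat_exp_has_derivative this] show ?thesis
    by (simp add: mult.commute)
qed

lemma bump_algebra_derivative:
  fixes f :: "'a::euclidean_space \<Rightarrow> real"
  shows "f \<in> bump_algebra \<Longrightarrow> \<exists>D. (\<forall>v. D v \<in> bump_algebra) \<and> (\<forall>x. (f has_derivative (\<lambda>v. D v x)) (at x))"
proof (induction rule: bump_algebra.induct)
  case (const c)
  show ?case by (rule exI[of _ "\<lambda>v x. 0"]) (auto intro: bump_algebra.intros)
next
  case (coord v)
  show ?case
    by (rule exI[of _ "\<lambda>w x. w \<bullet> v"]) (auto intro!: bump_algebra.intros derivative_eq_intros)
next
  case (bump k s r)
  let ?D = "\<lambda>(v::'a) (x::'a). (flat_exp (k + 2) (s * (r\<^sup>2 - x \<bullet> x)) + (- real k) * flat_exp (k + 1) (s * (r\<^sup>2 - x \<bullet> x))) *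
      ((- 2 * s) * (x \<bullet> v))"
  show ?case
  proof (intro exI[of _ ?D] conjI allI)
    show "?D v \<in> bump_algebra" for v
      by (intro bump_algebra.intros)
    show "((\<lambda>x. flat_exp k (s * (r\<^sup>2 - x \<bullet> x))) has_derivative (\<lambda>v. ?D v x)) (at x)" for x
      using bump_has_derivative[of k s r x] by (simp add: mult.assoc)
  qed
next
  case (add f g)
  then obtain D E where "\<forall>v. D v \<in> bump_algebra" "\<forall>x. (f has_derivative (\<lambda>v. D v x)) (at x)"
    "\<forall>v. E v \<in> bump_algebra" "\<forall>x. (g has_derivative (\<lambda>v. E v x)) (at x)" by blast
  then show ?case
    by (intro exI[of _ "\<lambda>v x. D v x + E v x"]) (auto intro!: bump_algebra.intros has_derivative_add)
next
  case (mult f g)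
  then obtain D E where *: "\<forall>v. D v \<in> bump_algebra" "\<forall>x. (f has_derivative (\<lambda>v. D v x)) (at x)"
    "\<forall>v. E v \<in> bump_algebra" "\<forall>x. (g has_derivative (\<lambda>v. E v x)) (at x)" by blast
  show ?case
    by (intro exI[of _ "\<lambda>v x. f x * E v x + D v x * g x"])
      (use * mult in \<open>auto intro!: bump_algebra.intros has_derivative_mult\<close>)
qed

lemma dir_deriv_eqI: "(f has_derivative D) (at x) \<Longrightarrow> dir_deriv v f x = D v"
  by (simp add: dir_deriv_def frechet_derivative_at[symmetric])

lemma bump_algebra_dir_deriv:
  assumes "f \<in> bump_algebra"
  shows "dir_deriv v f \<in> bump_algebra"
proof -
  obtain D where D: "\<forall>v. D v \<in> bump_algebra" "\<forall>x. (f has_derivative (\<lambda>v. D v x)) (at x)"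
    using bump_algebra_derivative[OF assms] by blast
  then have "dir_deriv v f x = D v x" for x
    using dir_deriv_eqI[of f "\<lambda>v. D v x" x v] by blast
  then have "dir_deriv v f = D v" by (rule ext)
  with D show ?thesis by simp
qed

lemma bump_algebra_differentiable: "f \<in> bump_algebra \<Longrightarrow> f differentiable (at x)"
  using bump_algebra_derivative[of f] unfolding differentiable_def by blast

lemma bump_algebra_smooth:
  assumes "f \<in> bump_algebra"
  shows "smooth f"
proof -
  have "iter_deriv vs f \<in> bump_algebra" for vs
    by (induction vs) (auto simp: iter_deriv_def assms bump_algebra_dir_deriv)
  then show ?thesis by (auto simp: smooth_def bump_algebra_differentiable)
qed

text \<open>A radial bump supported in the ball of radius \<open>r\<close> about the origin. For \<open>s \<rightarrow> \<infinity>\<close> the bumps converge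
  to the indicator function of that ball. Two features of radial bumps are used below: they are even
  and invariant under rotations.\<close>

definition bump :: "real \<Rightarrow> real \<Rightarrow> 'a::euclidean_space \<Rightarrow> real" where
  "bump s r x = flat_exp 0 (s * (r\<^sup>2 - x \<bullet> x))"

definition bump_grad :: "real \<Rightarrow> real \<Rightarrow> 'a::euclidean_space \<Rightarrow> 'a" where
  "bump_grad s r x = (- 2 * s * flat_exp 2 (s * (r\<^sup>2 - x \<bullet> x))) *\<^sub>R x"

lemma bump_has_bump_grad: "(bump s r has_derivative (\<lambda>v. bump_grad s r x \<bullet> v)) (at x)"
  using bump_has_derivative[of 0 s r x]
  by (simp add: bump_def[abs_def] bump_grad_def mult_ac numeral_2_eq_2)

lemma grad_bump: "grad (bump s r) x = bump_grad s r x"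
  unfolding grad_def
  by (simp add: dir_deriv_eqI[OF bump_has_bump_grad] inner_axis vec_eq_iff)

lemma bump_bounds: "0 \<le> bump s r x" "bump s r x \<le> 1"
  by (auto simp: bump_def flat_exp_0_bounds)

lemma flat_exp_outside:
  assumes "s > 0" "r > 0" "norm x \<ge> r"
  shows "flat_exp k (s * (r\<^sup>2 - x \<bullet> x)) = 0"
proof -
  have "r\<^sup>2 \<le> (norm x)\<^sup>2" using assms by (intro power_mono) auto
  then have "s * (r\<^sup>2 - x \<bullet> x) \<le> 0"
    using assms by (intro mult_nonneg_nonpos) (auto simp: dot_square_norm)
  then show ?thesis by (simp add: flat_exp_def)
qed

lemma test_fun_bump_algebra:
  assumes "f \<in> bump_algebra" and z: "\<And>x. norm x \<ge> r \<Longrightarrow> f x = 0"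
  shows "test_fun f"
proof -
  have "{x. f x \<noteq> 0} \<subseteq> cball 0 r"
    using z by force
  then have "bounded {x. f x \<noteq> 0}" by (rule bounded_subset[OF bounded_cball])
  then show ?thesis
    using bump_algebra_smooth[OF assms(1)] by (simp add: test_fun_def)
qed

lemma bump_in_algebra: "bump s r \<in> bump_algebra"
  using bump_algebra.bump[of 0 s r] by (simp add: bump_def[abs_def])

lemma bump_grad_in_algebra: "(\<lambda>x. bump_grad s r x \<bullet> v) \<in> bump_algebra"
  unfolding bump_grad_def inner_scaleR_left by (intro bump_algebra.intros)

lemma test_fun_bump: "s > 0 \<Longrightarrow> r > 0 \<Longrightarrow> test_fun (bump s r)"
  by (rule test_fun_bump_algebra[OF bump_in_algebra, of r]) (simp add: bump_def flat_exp_outside)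

lemma test_fun_bump_grad: "s > 0 \<Longrightarrow> r > 0 \<Longrightarrow> test_fun (\<lambda>x. bump_grad s r x \<bullet> v)"
  by (rule test_fun_bump_algebra[OF bump_grad_in_algebra, of r]) (simp add: bump_grad_def flat_exp_outside)

lemma bump_continuous: "continuous_on S (bump s r)"
  by (intro continuous_at_imp_continuous_on ballI has_derivative_continuous[OF bump_has_bump_grad])

lemma bump_grad_continuous: "continuous_on S (bump_grad s r)"
proof -
  have "continuous_on S (\<lambda>x. flat_exp 2 (s * (r\<^sup>2 - x \<bullet> x)))"
    by (rule continuous_on_compose2[of UNIV "flat_exp 2"])
      (auto intro!: continuous_intros continuous_at_imp_continuous_on flat_exp_continuous)
  then show ?thesis
    unfolding bump_grad_def by (intro continuous_intros)
qed

lemma bump_outside: "s > 0 \<Longrightarrow> r > 0 \<Longrightarrow> norm x \<ge> r \<Longrightarrow> bump s r x = 0"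
  by (simp add: bump_def flat_exp_outside)

lemma bump_grad_outside: "s > 0 \<Longrightarrow> r > 0 \<Longrightarrow> norm x \<ge> r \<Longrightarrow> bump_grad s r x = 0"
  by (simp add: bump_grad_def flat_exp_outside)

lemma bump_grad_uminus: "bump_grad s r (- x) = - bump_grad s r x"
  by (simp add: bump_grad_def)

lemma bump_measurable [measurable]: "bump s r \<in> borel_measurable borel"
  by (intro borel_measurable_continuous_onI bump_continuous)

lemma bump_grad_measurable [measurable]: "bump_grad s r \<in> borel_measurable borel"
  by (intro borel_measurable_continuous_onI bump_grad_continuous)

lemma bump_grad_bounded:
  assumes "s > 0" "r > 0"
  obtains B where "B > 0" "\<And>x::'a::euclidean_space. norm (bump_grad s r x) \<le> B * indicator (cball 0 r) x"
proof -
  have "compact (bump_grad s r ` cball (0::'a) r)"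
    by (intro compact_continuous_image bump_grad_continuous compact_cball)
  then obtain B where "B > 0" "\<forall>y \<in> bump_grad s r ` cball (0::'a) r. norm y \<le> B"
    by (metis compact_imp_bounded bounded_pos)
  then show ?thesis
    using assms by (intro that[of B]) (auto simp: indicator_def bump_grad_outside)
qed

lemma bump_tendsto_indicator:
  assumes "r > 0"
  shows "(\<lambda>n. bump (real (Suc n)) r x) \<longlonglongrightarrow> indicator (ball 0 r) x"
proof (cases "norm x < r")
  case True
  then have pos: "r\<^sup>2 - x \<bullet> x > 0"
    using power_strict_mono[of "norm x" r 2] by (simp add: dot_square_norm)
  have "(\<lambda>n. exp (- 1 / (real (Suc n) * (r\<^sup>2 - x \<bullet> x)))) \<longlonglongrightarrow> exp 0"
  proof (intro tendsto_exp)
    have "(\<lambda>n. (- 1 / (r\<^sup>2 - x \<bullet> x)) * inverse (real (Suc n))) \<longlonglongrightarrow> (- 1 / (r\<^sup>2 - x \<bullet> x)) * 0"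
      by (intro tendsto_intros LIMSEQ_inverse_real_of_nat)
    then show "(\<lambda>n. - 1 / (real (Suc n) * (r\<^sup>2 - x \<bullet> x))) \<longlonglongrightarrow> 0"
      by (simp add: field_simps)
  qed
  moreover have "bump (real (Suc n)) r x = exp (- 1 / (real (Suc n) * (r\<^sup>2 - x \<bullet> x)))" for n
    using mult_pos_pos[OF _ pos, of "real (Suc n)"] by (simp add: bump_def flat_exp_def del: of_nat_Suc)
  ultimately show ?thesis using True by simp
next
  case False
  then show ?thesis using assms by (simp add: bump_outside)
qed

section \<open>Lebesgue differentiation\<close>

text \<open>Outer regularity of the finite measure with density \<open>h\<close>.\<close>

lemma absolutely_continuous_open_superset:
  fixes h :: "'a::euclidean_space \<Rightarrow> real"
  assumes h: "integrable lborel h" and nonneg: "\<And>x. h x \<ge> 0"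
    and M: "M \<in> sets borel" and e: "e > 0"
  obtains U where "open U" "M \<subseteq> U" "(LINT x:U - M|lborel. h x) < e"
proof -
  define \<nu> where "\<nu> = density lborel (\<lambda>x. ennreal (h x))"
  have [measurable]: "h \<in> borel_measurable borel" using h by auto
  have em: "emeasure \<nu> A = ennreal (LINT x:A|lborel. h x)" if A: "A \<in> sets borel" for A
  proof -
    have int: "integrable lborel (\<lambda>x. indicator A x *\<^sub>R h x)"
      by (rule integrable_mult_indicator) (use A h in auto)
    have "emeasure \<nu> A = (\<integral>\<^sup>+x. ennreal (h x) * indicator A x \<partial>lborel)"
      unfolding \<nu>_def using A by (subst emeasure_density) auto
    also have "\<dots> = (\<integral>\<^sup>+x. ennreal (indicator A x *\<^sub>R h x) \<partial>lborel)"
      by (intro nn_integral_cong) (auto simp: indicator_def)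
    also have "\<dots> = ennreal (LINT x:A|lborel. h x)"
      unfolding set_lebesgue_integral_def
      by (rule nn_integral_eq_integral) (use int nonneg in auto)
    finally show ?thesis .
  qed
  have si: "set_integrable lborel A h" if "A \<in> sets borel" for A
    using that h unfolding set_integrable_def by (intro integrable_mult_indicator) auto
  have nn: "(LINT x:A|lborel. h x) \<ge> 0" for A
    unfolding set_lebesgue_integral_def by (intro integral_nonneg_AE AE_I2) (simp add: nonneg)
  have "emeasure \<nu> (space \<nu>) \<noteq> \<infinity>"
    using em[of UNIV] by (simp add: \<nu>_def)
  then have "emeasure \<nu> M = (INF U \<in> {U. M \<subseteq> U \<and> open U}. emeasure \<nu> U)"
    by (intro outer_regular) (auto simp: \<nu>_def M)
  moreover have "emeasure \<nu> M < ennreal ((LINT x:M|lborel. h x) + e)"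
    using em[OF M] nn[of M] e by (simp add: ennreal_less_iff)
  ultimately obtain U where U: "M \<subseteq> U" "open U" "emeasure \<nu> U < ennreal ((LINT x:M|lborel. h x) + e)"
    by (auto simp: INF_less_iff)
  then have "(LINT x:U|lborel. h x) < (LINT x:M|lborel. h x) + e"
    using em[of U] nn[of M] nn[of U] e by (simp add: ennreal_less_iff del: ennreal_plus)
  moreover have "(LINT x:(U - M) \<union> M|lborel. h x) = (LINT x:U - M|lborel. h x) + (LINT x:M|lborel. h x)"
    using U M by (intro set_integral_Un si) auto
  moreover have "(U - M) \<union> M = U" using U by auto
  ultimately show ?thesis using U by (intro that) auto
qed

text \<open>Points at which \<open>f \<le> a\<close> although arbitrarily small balls have averages above \<open>b > a\<close> form a null set.
  By Vitali's theorem such points are covered, up to a null set, by disjoint balls with average above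
  \<open>b\<close>, all inside an open set that exceeds \<open>M = {f \<le> a}\<close> only by a set on which \<open>|f - b|\<close> has a small
  integral. On the union \<open>V\<close> of finitely
  many of these balls \<open>f - b\<close> has a nonnegative integral, but on \<open>V \<inter> M\<close> it is at most \<open>a - b\<close> and
  on the rest its integral is small; so \<open>V \<inter> M\<close> has small measure.\<close>

lemma negligible_large_ball_averages:
  fixes f :: "'a::euclidean_space \<Rightarrow> real"
  assumes f: "integrable lborel f" and ab: "a < b"
  shows "negligible {x \<in> ball 0 N. f x \<le> a \<and>
    (\<forall>d>0. \<exists>r. 0 < r \<and> r < d \<and> b * measure lborel (ball x r) < (LINT y:ball x r|lborel. f y))}"
    (is "negligible ?S")
  unfolding negligible_outer_le
proof (intro allI impI)
  fix e :: real assume e: "e > 0"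
  have [measurable]: "f \<in> borel_measurable borel" using f by auto
  have ball_fm: "ball x r \<in> fmeasurable lborel" for x :: 'a and r
    using emeasure_lborel_ball_finite[of x r] by (intro fmeasurableI) auto
  define B where "B = ball (0::'a) N"
  define M where "M = {x \<in> B. f x \<le> a}"
  define h where "h x = indicator B x * \<bar>f x - b\<bar>" for x
  have [measurable]: "B \<in> sets borel" "M \<in> sets borel" by (auto simp: B_def M_def)
  have int_fb: "set_integrable lborel A (\<lambda>x. f x - b)" if "A \<in> sets borel" "A \<subseteq> B" for A
  proof -
    have "A \<in> fmeasurable lborel"
      by (rule fmeasurableI2[of B]) (use that ball_fm in \<open>auto simp: B_def\<close>)
    then have "set_integrable lborel A (\<lambda>x. b)"
      unfolding set_integrable_def by (auto simp: fmeasurable_def top.not_eq_extremum)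
    moreover have "set_integrable lborel A f"
      using that f unfolding set_integrable_def by (intro integrable_mult_indicator) auto
    ultimately show ?thesis by (rule set_integral_diff(1)[rotated])
  qed
  have h_int: "integrable lborel h"
    using int_fb[of B, unfolded set_integrable_def, THEN integrable_norm]
    unfolding h_def by (simp add: abs_mult)
  have "e * (b - a) > 0" using e ab by simp
  then obtain U0 where U0: "open U0" "M \<subseteq> U0" "(LINT x:U0 - M|lborel. h x) < e * (b - a)"
    using absolutely_continuous_open_superset[OF h_int, of M "e * (b - a)"] by (auto simp: h_def)
  define U where "U = U0 \<inter> B"
  have U: "open U" "M \<subseteq> U" "U \<subseteq> B" using U0 by (auto simp: U_def B_def M_def)
  have [measurable]: "U \<in> sets borel" using U by auto
  have U_e: "(LINT x:A|lborel. f x - b) \<le> e * (b - a)" if [measurable]: "A \<in> sets borel" and "A \<subseteq> U - M" for A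
  proof -
    have "(LINT x:A|lborel. f x - b) \<le> (LINT x:U0 - M|lborel. h x)"
      unfolding set_lebesgue_integral_def
    proof (rule integral_mono)
      show "integrable lborel (\<lambda>x. indicator A x *\<^sub>R (f x - b))"
        using int_fb[of A] that U by (auto simp: set_integrable_def)
      show "integrable lborel (\<lambda>x. indicator (U0 - M) x *\<^sub>R h x)"
        using h_int U0 by (intro integrable_mult_indicator) auto
      show "indicator A x *\<^sub>R (f x - b) \<le> indicator (U0 - M) x *\<^sub>R h x" for x
        using that by (auto simp: indicator_def h_def U_def)
    qed
    with U0 show ?thesis by simp
  qed
  define K where "K = {(x, r). 0 < r \<and> ball x r \<subseteq> U \<and> b * measure lborel (ball x r) < (LINT y:ball x r|lborel. f y)}"
  obtain C where C: "countable C" "C \<subseteq> K"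
    "pairwise (\<lambda>i j. disjnt (ball (fst i) (snd i)) (ball (fst j) (snd j))) C"
    "negligible (?S - (\<Union>i\<in>C. ball (fst i) (snd i)))"
  proof (rule Vitali_covering_theorem_balls[of ?S K fst snd])
    fix x d assume x: "x \<in> ?S" and d: "(0::real) < d"
    then have "x \<in> U" using U by (auto simp: M_def B_def)
    then obtain k where k: "k > 0" "ball x k \<subseteq> U" using U by (meson openE)
    have "min k d > 0" using k d by simp
    moreover have "\<forall>d>0. \<exists>r. 0 < r \<and> r < d \<and> b * measure lborel (ball x r) < (LINT y:ball x r|lborel. f y)"
      using x by simp
    ultimately obtain r where "0 < r" "r < min k d" "b * measure lborel (ball x r) < (LINT y:ball x r|lborel. f y)"
      by blast
    moreover have "ball x r \<subseteq> ball x k" using \<open>r < min k d\<close> by (intro subset_ball) auto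
    ultimately show "\<exists>i. i \<in> K \<and> x \<in> ball (fst i) (snd i) \<and> snd i < d"
      using k by (intro exI[of _ "(x, r)"]) (auto simp: K_def)
  qed
  have bound: "measure lebesgue (\<Union>i\<in>F. ball (fst i) (snd i) \<inter> M) \<le> e" if F: "F \<subseteq> C" "finite F" for F
  proof -
    define V where "V = (\<Union>i\<in>F. ball (fst i) (snd i))"
    have FK: "ball (fst i) (snd i) \<subseteq> U" "b * measure lborel (ball (fst i) (snd i)) < (LINT y:ball (fst i) (snd i)|lborel. f y)"
      if "i \<in> F" for i
    proof -
      have "i \<in> K" using that F C by blast
      then show "ball (fst i) (snd i) \<subseteq> U"
        "b * measure lborel (ball (fst i) (snd i)) < (LINT y:ball (fst i) (snd i)|lborel. f y)"
        by (simp_all add: K_def case_prod_beta)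
    qed
    have VU: "V \<subseteq> U" using FK by (auto simp: V_def)
    have [measurable]: "V \<in> sets borel" unfolding V_def by (intro borel_open open_UN) auto
    have VMf: "V \<inter> M \<in> fmeasurable lborel"
      by (rule fmeasurableI2[of B]) (use VU U ball_fm in \<open>auto simp: B_def\<close>)
    have "0 \<le> (\<Sum>i\<in>F. LINT x:ball (fst i) (snd i)|lborel. f x - b)"
    proof (rule sum_nonneg)
      fix i assume "i \<in> F"
      note i = FK[OF this]
      have "(LINT x:ball (fst i) (snd i)|lborel. f x - b)
        = (LINT x:ball (fst i) (snd i)|lborel. f x) - (LINT x:ball (fst i) (snd i)|lborel. b)"
      proof (rule set_integral_diff(2))
        show "set_integrable lborel (ball (fst i) (snd i)) f"
          using f unfolding set_integrable_def by (intro integrable_mult_indicator) auto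
        show "set_integrable lborel (ball (fst i) (snd i)) (\<lambda>x. b)"
          unfolding set_integrable_def using emeasure_lborel_ball_finite[of "fst i" "snd i"] by auto
      qed
      then show "0 \<le> (LINT x:ball (fst i) (snd i)|lborel. f x - b)"
        using i by (simp add: set_lebesgue_integral_def mult.commute)
    qed
    also have "\<dots> = (LINT x:V|lborel. f x - b)"
      unfolding V_def
    proof (rule set_integral_finite_Union[symmetric])
      show "disjoint_family_on (\<lambda>i. ball (fst i) (snd i)) F"
        using C(3) F unfolding disjoint_family_on_def pairwise_def disjnt_def by blast
      show "set_integrable lborel (ball (fst i) (snd i)) (\<lambda>x. f x - b)" if "i \<in> F" for i
        using FK[OF that] U by (intro int_fb) auto
    qed (use F in auto)
    also have "\<dots> = (LINT x:(V \<inter> M) \<union> (V - M)|lborel. f x - b)"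
      by (simp add: Int_Diff_Un)
    also have "\<dots> = (LINT x:V \<inter> M|lborel. f x - b) + (LINT x:V - M|lborel. f x - b)"
      by (rule set_integral_Un) (use VU U in \<open>auto intro!: int_fb\<close>)
    also have "(LINT x:V - M|lborel. f x - b) \<le> e * (b - a)"
      using VU by (intro U_e) auto
    also have "(LINT x:V \<inter> M|lborel. f x - b) \<le> (LINT x:V \<inter> M|lborel. a - b)"
    proof (rule set_integral_mono)
      show "set_integrable lborel (V \<inter> M) (\<lambda>x. f x - b)" using VU U by (intro int_fb) auto
      show "set_integrable lborel (V \<inter> M) (\<lambda>x. a - b)"
        using VMf unfolding set_integrable_def by (auto simp: fmeasurable_def top.not_eq_extremum)
    qed (auto simp: M_def)
    also have "(LINT x:V \<inter> M|lborel. a - b) = (a - b) * measure lborel (V \<inter> M)"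
      by (simp add: set_lebesgue_integral_def mult.commute)
    finally have "(b - a) * measure lborel (V \<inter> M) \<le> (b - a) * e"
      by (simp add: algebra_simps)
    then have "measure lborel (V \<inter> M) \<le> e" using ab by simp
    moreover have "(\<Union>i\<in>F. ball (fst i) (snd i) \<inter> M) = V \<inter> M" by (auto simp: V_def)
    ultimately show ?thesis by (simp add: measure_completion)
  qed
  let ?T = "(?S - (\<Union>i\<in>C. ball (fst i) (snd i))) \<union> (\<Union>i\<in>C. ball (fst i) (snd i) \<inter> M)"
  have meas: "ball (fst i) (snd i) \<inter> M \<in> lmeasurable" for i :: "'a \<times> real"
    by (rule fmeasurableI2[of "ball (fst i) (snd i)"]) auto
  have UN: "(\<Union>i\<in>C. ball (fst i) (snd i) \<inter> M) \<in> lmeasurable"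
    by (rule fmeasurable_UN_bound[OF \<open>countable C\<close> meas bound])
  have "measure lebesgue (\<Union>i\<in>C. ball (fst i) (snd i) \<inter> M) \<le> e"
    by (rule measure_UN_bound[OF \<open>countable C\<close> meas bound])
  moreover have "measure lebesgue ?T = measure lebesgue (\<Union>i\<in>C. ball (fst i) (snd i) \<inter> M)"
    by (subst Un_commute, rule measure_Un_null_set)
      (use C(4) UN in \<open>auto simp only: negligible_iff_null_sets fmeasurableD\<close>)
  ultimately have "measure lebesgue ?T \<le> e" by simp
  moreover have "?T \<in> lmeasurable" by (intro fmeasurable.Un negligible_imp_measurable C(4) UN)
  moreover have "?S \<subseteq> ?T" unfolding M_def B_def by blast
  ultimately show "\<exists>T. ?S \<subseteq> T \<and> T \<in> lmeasurable \<and> measure lebesgue T \<le> e" by blast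
qed


text \<open>Countably many null sets, one for each ball about the origin of integer radius and each pair of
  rational levels, give the upper bound for the averages at almost every point.\<close>

lemma eventually_ball_average_less:
  fixes f :: "'a::euclidean_space \<Rightarrow> real"
  assumes f: "integrable lborel f"
  shows "AE x in lborel. \<forall>c > f x.
    eventually (\<lambda>r. (LINT y:ball x r|lborel. f y) < c * measure lborel (ball x r)) (at_right 0)"
proof -
  define S where "S N a b = {x \<in> ball 0 N. f x \<le> a \<and>
    (\<forall>d>0. \<exists>r. 0 < r \<and> r < d \<and> b * measure lborel (ball x r) < (LINT y:ball x r|lborel. f y))}"
    for N a b
  have "AE x in lborel. x \<notin> S N a b" if "a < b" for N a b
  proof -
    have "S N a b \<in> null_sets lebesgue"
      using negligible_large_ball_averages[OF f that, of N] unfolding S_def negligible_iff_null_sets .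
    from AE_not_in[OF this] show ?thesis by (simp only: AE_completion_iff)
  qed
  then have "AE x in lborel. \<forall>N::nat. \<forall>a\<in>\<rat>. \<forall>b\<in>\<rat>. a < b \<longrightarrow> x \<notin> S (real N) a b"
    by (simp add: AE_all_countable AE_ball_countable countable_rat)
  then show ?thesis
  proof (rule AE_mp, intro AE_I2 impI allI)
    fix x c assume x: "\<forall>N::nat. \<forall>a\<in>\<rat>. \<forall>b\<in>\<rat>. a < b \<longrightarrow> x \<notin> S (real N) a b" and c: "f x < c"
    obtain a where a: "a \<in> \<rat>" "f x < a" "a < c" using Rats_dense_in_real[OF c] by blast
    obtain b where b: "b \<in> \<rat>" "a < b" "b < c" using Rats_dense_in_real[OF a(3)] by blast
    obtain N :: nat where "norm x < real N" using reals_Archimedean2 by blast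
    then have "\<not> (\<forall>d>0. \<exists>r. 0 < r \<and> r < d \<and> b * measure lborel (ball x r) < (LINT y:ball x r|lborel. f y))"
      using x[rule_format, OF a(1) b(1,2), of N] a by (auto simp: S_def)
    then obtain d where d: "d > 0" "\<And>r. 0 < r \<Longrightarrow> r < d \<Longrightarrow> (LINT y:ball x r|lborel. f y) \<le> b * measure lborel (ball x r)"
      by (meson not_le)
    have "(LINT y:ball x r|lborel. f y) < c * measure lborel (ball x r)" if "0 < r" "r < d" for r
      using d(2)[OF that] b content_ball_pos[OF that(1), of x]
      by (smt (verit) mult_strict_right_mono)
    then show "eventually (\<lambda>r. (LINT y:ball x r|lborel. f y) < c * measure lborel (ball x r)) (at_right 0)"
      using d(1) by (auto simp: eventually_at_right_field)
  qed
qed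

lemma ball_avg_tendsto_real:
  fixes f :: "'a::euclidean_space \<Rightarrow> real"
  assumes f: "integrable lborel f"
  shows "AE x in lborel. (ball_avg f x \<longlongrightarrow> f x) (at_right 0)"
proof -
  have "integrable lborel (\<lambda>x. - f x)" using f by simp
  note AE_conjI[OF eventually_ball_average_less[OF f] eventually_ball_average_less[OF this]]
  then show ?thesis
  proof (rule AE_mp, intro AE_I2 impI)
    fix x
    assume x: "(\<forall>c > f x. eventually (\<lambda>r. (LINT y:ball x r|lborel. f y) < c * measure lborel (ball x r)) (at_right 0))
      \<and> (\<forall>c > - f x. eventually (\<lambda>r. (LINT y:ball x r|lborel. - f y) < c * measure lborel (ball x r)) (at_right 0))"
    have pos: "eventually (\<lambda>r::real. r > 0) (at_right 0)" by (simp add: eventually_at_filter)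
    show "(ball_avg f x \<longlongrightarrow> f x) (at_right 0)"
    proof (rule order_tendstoI)
      fix c assume "f x < c"
      with x have "eventually (\<lambda>r. (LINT y:ball x r|lborel. f y) < c * measure lborel (ball x r)) (at_right 0)" by blast
      with pos show "eventually (\<lambda>r. ball_avg f x r < c) (at_right 0)"
      proof eventually_elim
        case (elim r)
        then show ?case using content_ball_pos[of r x] by (simp add: ball_avg_def field_simps)
      qed
    next
      fix c assume "c < f x"
      with x have "eventually (\<lambda>r. (LINT y:ball x r|lborel. - f y) < - c * measure lborel (ball x r)) (at_right 0)"
        by (metis neg_less_iff_less)
      with pos show "eventually (\<lambda>r. c < ball_avg f x r) (at_right 0)"
      proof eventually_elim
        case (elim r)
        then show ?case using content_ball_pos[of r x]
          by (simp add: ball_avg_def field_simps set_lebesgue_integral_def)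
      qed
    qed
  qed
qed

text \<open>Lebesgue's differentiation theorem. It identifies the precise representative of a weak gradient
  with the weak gradient almost everywhere.\<close>

theorem lebesgue_differentiation:
  fixes f :: "'a::euclidean_space \<Rightarrow> 'b::euclidean_space"
  assumes f: "loc_integrable f"
  shows "AE x in lborel. (ball_avg f x \<longlongrightarrow> f x) (at_right 0)"
proof -
  have ball: "set_integrable lborel (ball x r) f" for x r
    by (rule set_integrable_subset[of _ "cball x r"]) (use f in \<open>auto simp: loc_integrable_def\<close>)
  define g where "g N i x = indicator (ball 0 N) x *\<^sub>R f x \<bullet> i" for N i x
  have "integrable lborel (g N i)" for N i
    using ball[of 0 N] unfolding g_def set_integrable_def by (rule integrable_inner_left)
  then have "AE x in lborel. \<forall>N::nat. \<forall>i\<in>Basis. (ball_avg (g (real N) i) x \<longlongrightarrow> g (real N) i x) (at_right 0)"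
    by (simp add: AE_all_countable AE_ball_countable countable_finite ball_avg_tendsto_real)
  then show ?thesis
  proof (rule AE_mp, intro AE_I2 impI)
    fix x
    assume x: "\<forall>N::nat. \<forall>i\<in>Basis. (ball_avg (g (real N) i) x \<longlongrightarrow> g (real N) i x) (at_right 0)"
    obtain N :: nat where N: "norm x < real N" using reals_Archimedean2 by blast
    show "(ball_avg f x \<longlongrightarrow> f x) (at_right 0)"
      unfolding tendsto_componentwise_iff[of "ball_avg f x"]
    proof
      fix i :: 'b assume i: "i \<in> Basis"
      have gx: "g (real N) i x = f x \<bullet> i" using N by (simp add: g_def)
      have "eventually (\<lambda>r. r < real N - norm x) (at_right 0)"
        using N by (intro eventually_at_right_field[THEN iffD2] exI[of _ "real N - norm x"]) auto
      then have "eventually (\<lambda>r. ball_avg (g (real N) i) x r = ball_avg f x r \<bullet> i) (at_right 0)"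
      proof eventually_elim
        case (elim r)
        have "y \<in> ball 0 (real N)" if "y \<in> ball x r" for y
          using that elim norm_triangle_ineq2[of y x] by (simp add: dist_norm norm_minus_commute)
        then have "(LINT y:ball x r|lborel. g (real N) i y) = (LINT y|lborel. (indicator (ball x r) y *\<^sub>R f y) \<bullet> i)"
          unfolding set_lebesgue_integral_def
          by (intro Bochner_Integration.integral_cong) (auto simp: indicator_def g_def)
        also have "\<dots> = (LINT y:ball x r|lborel. f y) \<bullet> i"
          unfolding set_lebesgue_integral_def
          by (rule integral_inner_left) (use ball[of x r] in \<open>simp add: set_integrable_def\<close>)
        finally show ?case by (simp add: ball_avg_def)
      qed
      moreover have "(ball_avg (g (real N) i) x \<longlongrightarrow> f x \<bullet> i) (at_right 0)"
        using x i gx by (metis (no_types))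
      ultimately show "((\<lambda>r. ball_avg f x r \<bullet> i) \<longlongrightarrow> f x \<bullet> i) (at_right 0)"
        by (rule Lim_transform_eventually[rotated])
    qed
  qed
qed

section \<open>Inequalities and weak convergence in Lebesgue spaces\<close>

lemma powr_mid_convex:
  fixes a b p :: real
  assumes "p \<ge> 1" "a \<ge> 0" "b \<ge> 0"
  shows "((a + b) / 2) powr p \<le> (a powr p + b powr p) / 2"
proof -
  define m where "m = (a + b) / 2"
  have m: "m \<ge> 0" using assms by (simp add: m_def)
  have "m powr p + p * rpow m (p - 1) * (a - m) \<le> a powr p"
    "m powr p + p * rpow m (p - 1) * (b - m) \<le> b powr p"
    by (rule powr_tangent; use assms m in simp)+
  then have "2 * m powr p + p * rpow m (p - 1) * ((a - m) + (b - m)) \<le> a powr p + b powr p"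
    unfolding distrib_left by linarith
  moreover have "(a - m) + (b - m) = 0" by (simp add: m_def field_simps)
  ultimately show ?thesis by (simp add: m_def)
qed

lemma powr_add_le:
  fixes a b p :: real
  assumes "p \<ge> 0" "a \<ge> 0" "b \<ge> 0"
  shows "(a + b) powr p \<le> 2 powr p * (a powr p + b powr p)"
proof -
  have "(a + b) powr p \<le> (2 * max a b) powr p"
    using assms by (intro powr_mono2) auto
  also have "\<dots> = 2 powr p * (max a b) powr p"
    using assms by (simp add: powr_mult)
  also have "(max a b) powr p \<le> a powr p + b powr p"
    by (auto simp: max_def)
  finally show ?thesis by simp
qed

lemma norm_diff_powr_le:
  fixes x y :: "'a::real_normed_vector"
  assumes "p \<ge> 0"
  shows "norm (x - y) powr p \<le> 2 powr p * (norm x powr p + norm y powr p)"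
proof -
  have "norm (x - y) powr p \<le> (norm x + norm y) powr p"
    using assms by (intro powr_mono2 norm_triangle_ineq4) auto
  also have "\<dots> \<le> 2 powr p * (norm x powr p + norm y powr p)"
    using assms by (intro powr_add_le) auto
  finally show ?thesis .
qed

text \<open>Young's inequality with a truncation: if \<open>b\<close> is large compared with \<open>a\<^sup>1\<^sup>/\<^sup>(\<^sup>p\<^sup>-\<^sup>1\<^sup>)\<close>, the product is
  a small multiple of \<open>b\<^sup>p\<close>, and otherwise \<open>b\<close> may be truncated at \<open>a\<^sup>1\<^sup>/\<^sup>(\<^sup>p\<^sup>-\<^sup>1\<^sup>) / \<delta>\<close>. The truncated term is
  dominated by \<open>a\<close> to the conjugate exponent, uniformly in \<open>b\<close>.\<close>

lemma young_truncated:
  fixes a b p \<delta> :: real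
  assumes "p > 1" "a \<ge> 0" "b \<ge> 0" "\<delta> > 0"
  shows "a * b \<le> a * min b (a powr (1 / (p - 1)) / \<delta>) + \<delta> powr (p - 1) * b powr p"
proof (cases "b \<le> a powr (1 / (p - 1)) / \<delta>")
  case True
  then show ?thesis using assms by (simp add: min_absorb1)
next
  case False
  then have b: "b > 0" "a powr (1 / (p - 1)) \<le> \<delta> * b"
    using False assms order_le_less_trans[of 0 "a powr (1 / (p - 1)) / \<delta>" b] by (auto simp: field_simps not_le)
  have "a = (a powr (1 / (p - 1))) powr (p - 1)"
    using assms by (simp add: powr_powr)
  also have "\<dots> \<le> (\<delta> * b) powr (p - 1)"
    using assms b by (intro powr_mono2) auto
  also have "\<dots> = \<delta> powr (p - 1) * b powr (p - 1)"
    using assms by (simp add: powr_mult)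
  finally have "a * b \<le> \<delta> powr (p - 1) * b powr (p - 1) * b"
    using b by (intro mult_right_mono) auto
  also have "b powr (p - 1) * b = b powr p"
    using b(1) by (metis add.commute diff_add_cancel powr_add powr_one less_imp_le)
  then have "\<delta> powr (p - 1) * b powr (p - 1) * b = \<delta> powr (p - 1) * b powr p"
    by (simp add: mult.assoc)
  also have "\<dots> \<le> a * min b (a powr (1 / (p - 1)) / \<delta>) + \<delta> powr (p - 1) * b powr p"
    using assms by simp
  finally show ?thesis .
qed

lemma young_truncated_bound:
  fixes a b p \<delta> :: real
  assumes "p > 1" "a \<ge> 0" "\<delta> > 0"
  shows "a * min b (a powr (1 / (p - 1)) / \<delta>) \<le> a powr (p / (p - 1)) / \<delta>"
proof -
  have "a * min b (a powr (1 / (p - 1)) / \<delta>) \<le> a * (a powr (1 / (p - 1)) / \<delta>)"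
    using assms by (intro mult_left_mono) auto
  also have "a * a powr (1 / (p - 1)) = a powr (p / (p - 1))"
  proof (cases "a = 0")
    case False
    have "a * a powr (1 / (p - 1)) = a powr (1 + 1 / (p - 1))"
      using False assms by (simp add: powr_add)
    also have "1 + 1 / (p - 1) = p / (p - 1)" using assms by (simp add: field_simps)
    finally show ?thesis .
  qed simp
  then have "a * (a powr (1 / (p - 1)) / \<delta>) = a powr (p / (p - 1)) / \<delta>" by simp
  finally show ?thesis .
qed

lemma norm_mult_le_powr:
  assumes "p > 1"
  shows "norm x * norm y \<le> norm x powr (p / (p - 1)) + norm y powr p"
  using young_truncated[OF assms, of "norm x" "norm y" 1] young_truncated_bound[OF assms, of "norm x" 1 "norm y"]
  by simp

lemma abs_inner_le_powr:
  fixes x y :: "'a::real_inner"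
  assumes "p > 1"
  shows "\<bar>x \<bullet> y\<bar> \<le> norm x powr (p / (p - 1)) + norm y powr p"
  by (rule order_trans[OF Cauchy_Schwarz_ineq2 norm_mult_le_powr[OF assms]])

lemma integrable_inner_powr:
  fixes q h :: "'w \<Rightarrow> 'v::euclidean_space"
  assumes [measurable]: "q \<in> borel_measurable M" "h \<in> borel_measurable M"
    and p: "p > 1"
    and q: "integrable M (\<lambda>A. norm (q A) powr (p / (p - 1)))"
    and h: "integrable M (\<lambda>A. norm (h A) powr p)"
  shows "integrable M (\<lambda>A. q A \<bullet> h A)"
    and "\<bar>LINT A|M. q A \<bullet> h A\<bar> \<le> (LINT A|M. norm (q A) powr (p / (p - 1))) + (LINT A|M. norm (h A) powr p)"
proof -
  show i: "integrable M (\<lambda>A. q A \<bullet> h A)"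
    by (rule Bochner_Integration.integrable_bound[OF Bochner_Integration.integrable_add[OF q h]])
      (use abs_inner_le_powr[OF p] in \<open>auto intro!: AE_I2\<close>)
  have "\<bar>LINT A|M. q A \<bullet> h A\<bar> \<le> (LINT A|M. \<bar>q A \<bullet> h A\<bar>)"
    using integral_norm_bound[of M "\<lambda>A. q A \<bullet> h A"] by simp
  also have "\<dots> \<le> (LINT A|M. norm (q A) powr (p / (p - 1)) + norm (h A) powr p)"
    using i q h abs_inner_le_powr[OF p] by (intro integral_mono) auto
  also have "\<dots> = (LINT A|M. norm (q A) powr (p / (p - 1))) + (LINT A|M. norm (h A) powr p)"
    by (rule Bochner_Integration.integral_add[OF q h])
  finally show "\<bar>LINT A|M. q A \<bullet> h A\<bar> \<le> (LINT A|M. norm (q A) powr (p / (p - 1))) + (LINT A|M. norm (h A) powr p)" .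
qed

text \<open>A sequence that is bounded in \<open>L\<^sup>p\<close> and converges to zero almost everywhere converges weakly to zero.
  In the truncated form of Young's inequality the first term tends to zero by dominated convergence
  and the second one is small uniformly in \<open>n\<close>.\<close>

lemma bounded_AE_null_imp_weakly_null:
  fixes q :: "'w \<Rightarrow> 'v::euclidean_space" and h :: "nat \<Rightarrow> 'w \<Rightarrow> 'v"
  assumes [measurable]: "q \<in> borel_measurable M" "\<And>n. h n \<in> borel_measurable M"
    and p: "p > 1"
    and q: "integrable M (\<lambda>A. norm (q A) powr (p / (p - 1)))"
    and h: "\<And>n. integrable M (\<lambda>A. norm (h n A) powr p)" "\<And>n. (LINT A|M. norm (h n A) powr p) \<le> K"
    and lim: "AE A in M. (\<lambda>n. h n A) \<longlonglongrightarrow> 0"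
  shows "(\<lambda>n. LINT A|M. q A \<bullet> h n A) \<longlonglongrightarrow> 0"
proof (rule LIMSEQ_I)
  fix e :: real assume e: "e > 0"
  have K: "K \<ge> 0"
    by (rule order_trans[OF _ h(2)[of 0]]) (simp add: integral_nonneg_AE)
  define \<delta> where "\<delta> = (e / (2 * (K + 1))) powr (1 / (p - 1))"
  have \<delta>: "\<delta> > 0" "\<delta> powr (p - 1) = e / (2 * (K + 1))"
    using e K p by (auto simp: \<delta>_def powr_powr)
  define g where "g n A = norm (q A) * min (norm (h n A)) (norm (q A) powr (1 / (p - 1)) / \<delta>)" for n A
  have [measurable]: "g n \<in> borel_measurable M" for n unfolding g_def[abs_def] by measurable
  have g_nonneg: "g n A \<ge> 0" for n A using \<delta> by (auto simp: g_def)
  have g_bound: "g n A \<le> norm (q A) powr (p / (p - 1)) / \<delta>" for n A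
    unfolding g_def using \<delta> p by (intro young_truncated_bound) auto
  have qd: "integrable M (\<lambda>A. norm (q A) powr (p / (p - 1)) / \<delta>)" using q by simp
  have gi: "integrable M (g n)" for n
    by (rule Bochner_Integration.integrable_bound[OF qd])
      (use g_nonneg g_bound \<delta> in \<open>auto intro!: AE_I2\<close>)
  have "(\<lambda>n. LINT A|M. g n A) \<longlonglongrightarrow> (LINT A|M. 0)"
  proof (rule integral_dominated_convergence[OF _ _ qd])
    show "AE A in M. (\<lambda>n. g n A) \<longlonglongrightarrow> 0"
      using lim
    proof (rule AE_mp, intro AE_I2 impI)
      fix A assume "(\<lambda>n. h n A) \<longlonglongrightarrow> 0"
      then have "(\<lambda>n. norm (q A) * norm (h n A)) \<longlonglongrightarrow> norm (q A) * 0"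
        by (intro tendsto_intros tendsto_norm_zero)
      then show "(\<lambda>n. g n A) \<longlonglongrightarrow> 0"
        using g_nonneg by (intro tendsto_sandwich[of "\<lambda>_. 0" "\<lambda>n. g n A" sequentially "\<lambda>n. norm (q A) * norm (h n A)"])
          (auto simp: g_def intro!: mult_left_mono always_eventually)
    qed
    show "AE A in M. norm (g n A) \<le> norm (q A) powr (p / (p - 1)) / \<delta>" for n
      using g_nonneg g_bound by (intro AE_I2) auto
  qed auto
  then have "(\<lambda>n. LINT A|M. g n A) \<longlonglongrightarrow> 0" by simp
  from LIMSEQ_D[OF this, of "e / 2"] e obtain N where N: "\<And>n. n \<ge> N \<Longrightarrow> \<bar>LINT A|M. g n A\<bar> < e / 2"
    by auto
  have "norm ((LINT A|M. q A \<bullet> h n A) - 0) < e" if "n \<ge> N" for n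
  proof -
    have "\<bar>LINT A|M. q A \<bullet> h n A\<bar> \<le> (LINT A|M. \<bar>q A \<bullet> h n A\<bar>)"
      using integral_norm_bound[of M "\<lambda>A. q A \<bullet> h n A"] by simp
    also have "\<dots> \<le> (LINT A|M. g n A + \<delta> powr (p - 1) * norm (h n A) powr p)"
    proof (rule integral_mono)
      show "integrable M (\<lambda>A. \<bar>q A \<bullet> h n A\<bar>)" using integrable_inner_powr(1)[OF _ _ p q h(1)] by simp
      show "integrable M (\<lambda>A. g n A + \<delta> powr (p - 1) * norm (h n A) powr p)" using gi h(1) by simp
      show "\<bar>q A \<bullet> h n A\<bar> \<le> g n A + \<delta> powr (p - 1) * norm (h n A) powr p" for A
        using Cauchy_Schwarz_ineq2[of "q A" "h n A"] young_truncated[OF p, of "norm (q A)" "norm (h n A)" \<delta>] \<delta>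
        by (simp add: g_def)
    qed
    also have "\<dots> = (LINT A|M. g n A) + \<delta> powr (p - 1) * (LINT A|M. norm (h n A) powr p)"
      using gi h(1) by simp
    also have "\<delta> powr (p - 1) * (LINT A|M. norm (h n A) powr p) \<le> e / (2 * (K + 1)) * K"
      unfolding \<delta>(2) using h(2) e K by (intro mult_left_mono) auto
    also have "e / (2 * (K + 1)) * K \<le> e / 2" using e K by (simp add: field_simps)
    finally show ?thesis using N[OF that] by simp
  qed
  then show "\<exists>N. \<forall>n\<ge>N. norm ((LINT A|M. q A \<bullet> h n A) - 0) < e" by blast
qed

text \<open>Jensen's inequality for a probability density \<open>w\<close>. It is used with \<open>w = 1\<close> on a probability space
  and with the normalized indicator function of a ball.\<close>

lemma jensen_norm_powr:
  fixes g :: "'x \<Rightarrow> 'v::euclidean_space" and w :: "'x \<Rightarrow> real"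
  assumes p: "p \<ge> 1" and w: "integrable N w" "\<And>x. w x \<ge> 0" "(LINT x|N. w x) = 1"
    and g: "integrable N (\<lambda>x. w x *\<^sub>R g x)" and gp: "integrable N (\<lambda>x. w x * norm (g x) powr p)"
  shows "norm (LINT x|N. w x *\<^sub>R g x) powr p \<le> (LINT x|N. w x * norm (g x) powr p)"
proof -
  define m where "m = (LINT x|N. w x * norm (g x))"
  have gn: "integrable N (\<lambda>x. w x * norm (g x))"
    using integrable_norm[OF g] w by simp
  have m: "m \<ge> 0" unfolding m_def using w by (intro integral_nonneg_AE AE_I2) auto
  have "norm (LINT x|N. w x *\<^sub>R g x) \<le> m"
    unfolding m_def using integral_norm_bound[of N "\<lambda>x. w x *\<^sub>R g x"] w by simp
  then have "norm (LINT x|N. w x *\<^sub>R g x) powr p \<le> m powr p"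
    using p by (intro powr_mono2) auto
  also have "\<dots> = (LINT x|N. m powr p * w x + p * rpow m (p - 1) * (w x * norm (g x) - m * w x))"
    using w gn by (simp add: m_def[symmetric])
  also have "\<dots> \<le> (LINT x|N. w x * norm (g x) powr p)"
  proof (rule integral_mono)
    show "integrable N (\<lambda>x. m powr p * w x + p * rpow m (p - 1) * (w x * norm (g x) - m * w x))"
      using w gn by simp
    show "m powr p * w x + p * rpow m (p - 1) * (w x * norm (g x) - m * w x) \<le> w x * norm (g x) powr p" for x
    proof -
      have "w x * (m powr p + p * rpow m (p - 1) * (norm (g x) - m)) \<le> w x * norm (g x) powr p"
        using w m p by (intro mult_left_mono powr_tangent) auto
      then show ?thesis by (simp add: algebra_simps)
    qed
  qed (rule gp)
  finally show ?thesis .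
qed

lemma AE_summable_norm:
  fixes u :: "nat \<Rightarrow> 'w \<Rightarrow> 'v::euclidean_space"
  assumes u: "\<And>n. integrable M (u n)" and c: "\<And>n. (LINT A|M. norm (u n A)) \<le> c n" "summable c"
  shows "AE A in M. summable (\<lambda>n. norm (u n A))"
proof -
  have [measurable]: "u n \<in> borel_measurable M" for n using u by auto
  have c0: "c n \<ge> 0" for n
    by (rule order_trans[OF _ c(1)]) (simp add: integral_nonneg_AE)
  have "(\<integral>\<^sup>+A. (\<Sum>n. ennreal (norm (u n A))) \<partial>M) = (\<Sum>n. \<integral>\<^sup>+A. ennreal (norm (u n A)) \<partial>M)"
    by (rule nn_integral_suminf) measurable
  also have "\<dots> = (\<Sum>n. ennreal (LINT A|M. norm (u n A)))"
    using u by (subst nn_integral_eq_integral) auto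
  also have "\<dots> \<le> (\<Sum>n. ennreal (c n))"
    using c by (intro suminf_le) (auto intro: ennreal_leI)
  also have "\<dots> < \<infinity>"
    using c c0 by (simp add: suminf_ennreal2)
  finally have "AE A in M. (\<Sum>n. ennreal (norm (u n A))) \<noteq> \<infinity>"
    by (intro nn_integral_PInf_AE) auto
  then show ?thesis
    by (rule AE_mp) (auto intro!: AE_I2 summable_suminf_not_top)
qed

section \<open>Measure preserving flows\<close>

lemma lborel_shift:
  fixes f :: "'v::euclidean_space \<Rightarrow> 'b::{banach, second_countable_topology}"
  assumes "f \<in> borel_measurable borel"
  shows "(LINT x|lborel. f (x + a)) = (LINT x|lborel. f x)"
proof -
  have "(LINT x|lborel. f x) = (LINT x|distr lborel borel ((+) a). f x)"
    by (simp add: lborel_distr_plus)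
  also have "\<dots> = (LINT x|lborel. f (a + x))"
    using assms by (subst integral_distr) auto
  finally show ?thesis by (simp add: add.commute)
qed

lemma lborel_reflect: "distr lborel borel uminus = (lborel :: 'v::euclidean_space measure)"
  using lborel_affine[of "-1" "0::'v"] by (simp add: density_1)

lemma lborel_integral_reflect:
  fixes f :: "'v::euclidean_space \<Rightarrow> 'b::{banach, second_countable_topology}"
  assumes "f \<in> borel_measurable borel"
  shows "(LINT x|lborel. f (- x)) = (LINT x|lborel. f x)"
proof -
  have "(LINT x|lborel. f x) = (LINT x|distr lborel borel uminus. f x)"
    by (simp add: lborel_reflect)
  also have "\<dots> = (LINT x|lborel. f (- x))"
    using assms by (subst integral_distr) auto
  finally show ?thesis by simp
qed

lemma AE_lborel_shift:
  fixes a :: "'v::euclidean_space"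
  assumes "AE x in lborel. Q x"
  shows "AE x in lborel. Q (x + a)"
proof -
  have "AE x in distr lborel borel ((+) a). Q x" unfolding lborel_distr_plus by (rule assms)
  then have "AE x in lborel. Q (a + x)" by (rule AE_distrD[rotated]) auto
  then show ?thesis by (simp add: add.commute)
qed

lemma integrable_indicator_cball: "integrable lborel (\<lambda>x. C * indicator (cball (0::'v::euclidean_space) r) x :: real)"
  using emeasure_lborel_cball_finite[of 0 r] by (intro integrable_mult_right) auto

text \<open>The second projection of a product with \<open>lborel\<close> has to be recognized as a Borel function by the
  measurability prover.\<close>

lemma snd_lborel_measurable [measurable (raw)]:
  assumes "f \<in> N \<rightarrow>\<^sub>M L \<Otimes>\<^sub>M (lborel :: 'v::euclidean_space measure)"
  shows "(\<lambda>x. snd (f x)) \<in> borel_measurable N"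
  using measurable_compose[OF assms measurable_snd] by simp

text \<open>A measure preserving action \<open>T\<close> of a Euclidean space on a probability space. A random variable \<open>f\<close>
  gives rise to the stationary random field \<open>f (T x A)\<close>, and every stationary field that is used
  here has this form; so all statements about fields become statements about random variables.\<close>

locale measure_flow = prob_space M for M :: "'w measure" +
  fixes T :: "'v::euclidean_space \<Rightarrow> 'w \<Rightarrow> 'w"
  assumes T_joint: "(\<lambda>(A, x). T x A) \<in> M \<Otimes>\<^sub>M lborel \<rightarrow>\<^sub>M M"
    and T_add: "A \<in> space M \<Longrightarrow> T (x + y) A = T x (T y A)"
    and T_zero: "A \<in> space M \<Longrightarrow> T 0 A = A"
    and T_distr: "distr M M (T x) = M"
begin

sublocale P: pair_sigma_finite M lborel
  by (intro pair_sigma_finite.intro) (unfold_locales)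

lemma T_comp [measurable (raw)]:
  assumes "\<phi> \<in> borel_measurable N" "g \<in> N \<rightarrow>\<^sub>M M"
  shows "(\<lambda>w. T (\<phi> w) (g w)) \<in> N \<rightarrow>\<^sub>M M"
proof -
  have "(\<lambda>w. (g w, \<phi> w)) \<in> N \<rightarrow>\<^sub>M M \<Otimes>\<^sub>M lborel" using assms by measurable
  from measurable_compose[OF this T_joint] show ?thesis by simp
qed

lemma T_measurable [measurable]: "T x \<in> M \<rightarrow>\<^sub>M M"
  by measurable

lemma T_space: "A \<in> space M \<Longrightarrow> T x A \<in> space M"
  by (rule measurable_space[OF T_measurable])

lemma AE_T:
  assumes "AE A in M. Q A"
  shows "AE A in M. Q (T x A)"
  by (rule AE_distrD[OF T_measurable]) (unfold T_distr, rule assms)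

lemma integral_T:
  fixes f :: "'w \<Rightarrow> 'b::{banach, second_countable_topology}"
  assumes "f \<in> borel_measurable M"
  shows "(LINT A|M. f (T x A)) = (LINT A|M. f A)"
  using integral_distr[of "T x" M M f] assms by (simp add: T_distr)

lemma integrable_T:
  fixes f :: "'w \<Rightarrow> 'b::{banach, second_countable_topology}"
  assumes "integrable M f"
  shows "integrable M (\<lambda>A. f (T x A))"
  using integrable_distr[of "T x" M M f] assms by (simp add: T_distr)

lemma nn_integral_T:
  assumes "f \<in> borel_measurable M"
  shows "(\<integral>\<^sup>+A. f (T x A) \<partial>M) = (\<integral>\<^sup>+A. f A \<partial>M)"
  using nn_integral_distr[of "T x" M M f] assms by (simp add: T_distr)

text \<open>Fubini's theorem is applied throughout to products of a stationary field and a compactly supported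
  kernel; this lemma and the next one supply the integrability.\<close>

lemma integrable_pair_T:
  fixes k :: "'w \<Rightarrow> real"
  assumes k: "integrable M k" and \<eta>: "integrable lborel \<eta>"
    and [measurable]: "\<phi> \<in> borel_measurable borel"
  shows "integrable (M \<Otimes>\<^sub>M lborel) (\<lambda>(A, x). k (T (\<phi> x) A) * \<eta> x)"
proof (rule integrableI_bounded)
  have [measurable]: "k \<in> borel_measurable M" "\<eta> \<in> borel_measurable borel" using k \<eta> by auto
  show "(\<lambda>(A, x). k (T (\<phi> x) A) * \<eta> x) \<in> borel_measurable (M \<Otimes>\<^sub>M lborel)" by measurable
  have "(\<integral>\<^sup>+z. ennreal (norm (case z of (A, x) \<Rightarrow> k (T (\<phi> x) A) * \<eta> x)) \<partial>(M \<Otimes>\<^sub>M lborel))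
    = (\<integral>\<^sup>+x. \<integral>\<^sup>+A. ennreal (norm (k (T (\<phi> x) A) * \<eta> x)) \<partial>M \<partial>lborel)"
    by (subst P.nn_integral_snd[symmetric]) auto
  also have "\<dots> = (\<integral>\<^sup>+x. (\<integral>\<^sup>+A. ennreal (norm (k A)) \<partial>M) * ennreal (norm (\<eta> x)) \<partial>lborel)"
  proof (intro nn_integral_cong)
    fix x
    have "(\<integral>\<^sup>+A. ennreal (norm (k (T (\<phi> x) A) * \<eta> x)) \<partial>M)
      = (\<integral>\<^sup>+A. ennreal (norm (k (T (\<phi> x) A))) * ennreal (norm (\<eta> x)) \<partial>M)"
      by (simp add: abs_mult ennreal_mult)
    also have "\<dots> = (\<integral>\<^sup>+A. ennreal (norm (k (T (\<phi> x) A))) \<partial>M) * ennreal (norm (\<eta> x))"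
      by (rule nn_integral_multc) measurable
    also have "(\<integral>\<^sup>+A. ennreal (norm (k (T (\<phi> x) A))) \<partial>M) = (\<integral>\<^sup>+A. ennreal (norm (k A)) \<partial>M)"
      by (rule nn_integral_T[of "\<lambda>A. ennreal (norm (k A))"]) measurable
    finally show "(\<integral>\<^sup>+A. ennreal (norm (k (T (\<phi> x) A) * \<eta> x)) \<partial>M)
      = (\<integral>\<^sup>+A. ennreal (norm (k A)) \<partial>M) * ennreal (norm (\<eta> x))" .
  qed
  also have "\<dots> = (\<integral>\<^sup>+A. ennreal (norm (k A)) \<partial>M) * (\<integral>\<^sup>+x. ennreal (norm (\<eta> x)) \<partial>lborel)"
    by (rule nn_integral_cmult) measurable
  also have "\<dots> < \<infinity>"
    using k \<eta> by (simp add: integrable_iff_bounded ennreal_mult_less_top)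
  finally show "(\<integral>\<^sup>+z. ennreal (norm (case z of (A, x) \<Rightarrow> k (T (\<phi> x) A) * \<eta> x)) \<partial>(M \<Otimes>\<^sub>M lborel)) < \<infinity>" .
qed

lemma integrable_pair_dominated:
  fixes u :: "'w \<times> 'v \<Rightarrow> 'b::{banach, second_countable_topology}"
  assumes u [measurable]: "u \<in> borel_measurable (M \<Otimes>\<^sub>M lborel)"
    and k: "integrable M k" "integrable M l"
    and [measurable]: "\<phi> \<in> borel_measurable borel" "\<psi> \<in> borel_measurable borel"
    and bound: "\<And>A x. A \<in> space M \<Longrightarrow> norm (u (A, x)) \<le> (k (T (\<phi> x) A) + l (T (\<psi> x) A)) * (C * indicator (cball (0::'v) r) x)"
  shows "integrable (M \<Otimes>\<^sub>M lborel) u"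
proof -
  have "integrable (M \<Otimes>\<^sub>M lborel) (\<lambda>z. (case z of (A, x) \<Rightarrow> k (T (\<phi> x) A) * (C * indicator (cball (0::'v) r) x)) +
      (case z of (A, x) \<Rightarrow> l (T (\<psi> x) A) * (C * indicator (cball (0::'v) r) x)))"
    using k by (intro Bochner_Integration.integrable_add integrable_pair_T integrable_indicator_cball) auto
  then show ?thesis
  proof (rule Bochner_Integration.integrable_bound[OF _ u], intro AE_I2)
    fix z assume "z \<in> space (M \<Otimes>\<^sub>M (lborel :: 'v measure))"
    then obtain A x where z: "z = (A, x)" "A \<in> space M" by (auto simp: space_pair_measure)
    then show "norm (u z) \<le> norm ((case z of (A, x) \<Rightarrow> k (T (\<phi> x) A) * (C * indicator (cball (0::'v) r) x)) +
      (case z of (A, x) \<Rightarrow> l (T (\<psi> x) A) * (C * indicator (cball (0::'v) r) x)))"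
      using bound[OF z(2), of x] by (simp add: distrib_right)
  qed
qed

lemma AE_loc_integrable:
  fixes f :: "'w \<Rightarrow> 'b::{banach, second_countable_topology}"
  assumes f: "integrable M f"
  shows "AE A in M. loc_integrable (\<lambda>x. f (T x A))"
proof -
  have [measurable]: "f \<in> borel_measurable M" using f by auto
  have "AE A in M. integrable lborel (\<lambda>x. norm (f (T x A)) * (1 * indicator (cball 0 (real N)) x))" for N :: nat
    using P.AE_integrable_fst[OF integrable_pair_T[OF integrable_norm[OF f] integrable_indicator_cball, of "\<lambda>x. x" 1 "real N"]]
    by simp
  then have "AE A in M. \<forall>N::nat. integrable lborel (\<lambda>x. norm (f (T x A)) * (1 * indicator (cball 0 (real N)) x))"
    by (simp add: AE_all_countable)
  then show ?thesis
  proof (rule AE_mp, intro AE_I2 impI)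
    fix A assume A [measurable]: "A \<in> space M"
      and i: "\<forall>N::nat. integrable lborel (\<lambda>x. norm (f (T x A)) * (1 * indicator (cball 0 (real N)) x))"
    show "loc_integrable (\<lambda>x. f (T x A))"
      unfolding loc_integrable_def set_integrable_def
    proof (intro allI impI)
      fix K :: "'v set" assume K: "compact K"
      then have [measurable]: "K \<in> sets borel" by (simp add: borel_compact)
      from K obtain b where b: "\<forall>x\<in>K. norm x \<le> b"
        by (meson bounded_iff compact_imp_bounded)
      obtain N :: nat where "b \<le> real N" using real_arch_simple by blast
      with b have "K \<subseteq> cball 0 (real N)" by force
      then show "integrable lborel (\<lambda>x. indicat_real K x *\<^sub>R f (T x A))"
        by (intro Bochner_Integration.integrable_bound[OF i[rule_format, of N]] AE_I2)
          (auto simp: indicator_def)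
    qed
  qed
qed

lemma AE_flow_swap:
  fixes Q :: "'w \<Rightarrow> 'v \<Rightarrow> bool"
  assumes [measurable]: "Measurable.pred (M \<Otimes>\<^sub>M lborel) (\<lambda>(A, x). Q A x)"
    and "\<And>x. AE A in M. Q A x"
  shows "AE A in M. AE x in lborel. Q A x"
proof -
  have "AE x in lborel. AE A in M. Q A x" using assms(2) by simp
  then show ?thesis
    by (subst P.AE_commute) (use assms(1) in \<open>simp only: pred_def case_prod_beta'\<close>)
qed

end

locale ergodic_flow = measure_flow M T for M :: "'w measure" and T :: "'v::euclidean_space \<Rightarrow> 'w \<Rightarrow> 'w" +
  assumes ergodic: "\<And>Y :: 'w \<Rightarrow> real. integrable M Y \<Longrightarrow> \<forall>A\<in>space M. \<forall>z. Y (T z A) = Y A \<Longrightarrow>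
    AE A in M. Y A = (LINT A'|M. Y A')"
begin

text \<open>Ergodicity speaks about variables that are invariant under every shift at every sample point. From
  \<open>Y\<close>, whose invariance is only almost sure for each shift separately, such a variable \<open>Z\<close> is obtained
  as the value that \<open>Y\<close> takes along almost the whole orbit of \<open>A\<close>, and zero if there is no such
  value. Taking \<open>Z A\<close> to be an average over a piece of the orbit makes it measurable.\<close>

lemma AE_invariant_imp_constant:
  fixes Y :: "'w \<Rightarrow> real"
  assumes Y: "integrable M Y" and inv: "\<And>z. AE A in M. Y (T z A) = Y A"
  shows "AE A in M. Y A = (LINT A'|M. Y A')"
proof -
  have [measurable]: "Y \<in> borel_measurable M" using Y by auto
  define B where "B = ball (0::'v) 1"
  define V where "V = measure lborel B"
  have [measurable]: "B \<in> sets borel" by (simp add: B_def)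
  have V: "V > 0" using content_ball_pos[of 1 "0::'v"] by (simp add: V_def B_def)
  define m where "m A = (LINT x|lborel. indicator B x * Y (T x A)) / V" for A
  define good where "good c A \<longleftrightarrow> (AE x in lborel. Y (T x A) = c)" for c A
  define Z where "Z A = (if good (m A) A then m A else 0)" for A
  have m_meas [measurable]: "m \<in> borel_measurable M" unfolding m_def by measurable
  have good_eq: "good (m A) A \<longleftrightarrow> (\<integral>\<^sup>+x. indicator {x. Y (T x A) \<noteq> m A} x \<partial>lborel) = 0" if [measurable]: "A \<in> space M" for A
  proof -
    have "(\<integral>\<^sup>+x. indicator {x. Y (T x A) \<noteq> m A} x \<partial>lborel) = 0 \<longleftrightarrow>
      (AE x in lborel. indicator {x. Y (T x A) \<noteq> m A} x = (0::ennreal))"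
      by (rule nn_integral_0_iff_AE) measurable
    also have "\<dots> \<longleftrightarrow> good (m A) A" unfolding good_def
      by (intro AE_cong) (auto simp: indicator_def)
    finally show ?thesis by simp
  qed
  have [measurable]: "(\<lambda>A. \<integral>\<^sup>+x. indicator {x. Y (T x A) \<noteq> m A} x \<partial>lborel) \<in> borel_measurable M"
    by measurable
  have Z_meas [measurable]: "Z \<in> borel_measurable M"
  proof -
    have "(\<lambda>A. if (\<integral>\<^sup>+x. indicator {x. Y (T x A) \<noteq> m A} x \<partial>lborel) = 0 then m A else 0) \<in> borel_measurable M"
      by measurable
    then show ?thesis
      by (subst measurable_cong[of _ _ "\<lambda>A. if (\<integral>\<^sup>+x. indicator {x. Y (T x A) \<noteq> m A} x \<partial>lborel) = 0 then m A else 0"])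
        (auto simp: Z_def good_eq)
  qed
  \<comment> \<open>If the orbit has an almost everywhere constant value, \<open>m\<close> recovers it.\<close>
  have good_m: "m A = c" if "good c A" "A \<in> space M" for c A
  proof -
    have [measurable]: "A \<in> space M" by fact
    have "(LINT x|lborel. indicator B x * Y (T x A)) = (LINT x|lborel. indicator B x * c)"
      using that(1) unfolding good_def by (intro integral_cong_AE) auto
    also have "\<dots> = V * c"
      by (simp add: V_def)
    finally show ?thesis using V by (simp add: m_def)
  qed
  have good_shift: "good c (T z A)" if "good c A" "A \<in> space M" for c z A
    using AE_lborel_shift[of "\<lambda>x. Y (T x A) = c" z] that by (simp add: good_def T_add)
  have Z_inv: "Z (T z A) = Z A" if A: "A \<in> space M" for z A
  proof (cases "good (m A) A")
    case True
    from good_shift[OF this A] have "good (m A) (T z A)" .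
    moreover from good_m[OF this T_space[OF A]] have "m (T z A) = m A" .
    ultimately show ?thesis using True by (simp add: Z_def)
  next
    case False
    have "\<not> good (m (T z A)) (T z A)"
    proof
      assume g: "good (m (T z A)) (T z A)"
      have "T (- z) (T z A) = A" using T_add[OF A, of "- z" z] T_zero[OF A] by simp
      with good_shift[OF g T_space[OF A], of "- z"] have "good (m (T z A)) A" by simp
      with good_m[OF this A] False show False by simp
    qed
    with False show ?thesis by (simp add: Z_def)
  qed
  have "AE A in M. AE x in lborel. Y (T x A) = Y A"
    by (rule AE_flow_swap) (use inv in auto)
  then have ZY: "AE A in M. Z A = Y A"
  proof (rule AE_mp, intro AE_I2 impI)
    fix A assume "A \<in> space M" "AE x in lborel. Y (T x A) = Y A"
    then show "Z A = Y A" using good_m[of "Y A" A] by (simp add: Z_def good_def)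
  qed
  then have "integrable M Z" using Y by (subst integrable_cong_AE) auto
  then have "AE A in M. Z A = (LINT A'|M. Z A')" using Z_inv by (intro ergodic) auto
  moreover have "(LINT A'|M. Z A') = (LINT A'|M. Y A')" using ZY by (intro integral_cong_AE) auto
  ultimately show ?thesis using ZY by (auto elim: AE_mp)
qed

end

section \<open>The mean ergodic theorem\<close>

text \<open>Dyadic convex combinations of translates. They are generated by midpoints, the only combinations
  that occur in the parallelogram argument of the mean ergodic theorem.\<close>

inductive_set (in measure_flow) avgs :: "('w \<Rightarrow> 'c::real_vector) \<Rightarrow> ('w \<Rightarrow> 'c) set" for f where
  shifted: "(\<lambda>A. f (T z A)) \<in> avgs f"
| midpoint: "h \<in> avgs f \<Longrightarrow> k \<in> avgs f \<Longrightarrow> (\<lambda>A. (1/2) *\<^sub>R (h A + k A)) \<in> avgs f"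

context measure_flow
begin

lemma avgs_measurable:
  fixes f :: "'w \<Rightarrow> 'c::euclidean_space"
  assumes [measurable]: "f \<in> borel_measurable M" and "h \<in> avgs f"
  shows "h \<in> borel_measurable M"
  using assms(2) by induction auto

lemma avgs_powr:
  fixes f :: "'w \<Rightarrow> 'c::euclidean_space"
  assumes p: "p \<ge> 1" and f [measurable]: "f \<in> borel_measurable M"
    and fp: "integrable M (\<lambda>A. norm (f A) powr p)" and "h \<in> avgs f"
  shows "integrable M (\<lambda>A. norm (h A) powr p) \<and>
    (LINT A|M. norm (h A) powr p) \<le> (LINT A|M. norm (f A) powr p)"
  using assms(4)
proof induction
  case (shifted z)
  show ?case using integrable_T[OF fp] integral_T[of "\<lambda>A. norm (f A) powr p" z] by simp
next
  case (midpoint h k)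
  have [measurable]: "h \<in> borel_measurable M" "k \<in> borel_measurable M"
    by (rule avgs_measurable[OF f]; fact)+
  have le: "norm ((1/2) *\<^sub>R (h A + k A)) powr p \<le> (norm (h A) powr p + norm (k A) powr p) / 2" for A
  proof -
    have "norm ((1/2) *\<^sub>R (h A + k A)) powr p \<le> ((norm (h A) + norm (k A)) / 2) powr p"
      using p norm_triangle_ineq[of "h A" "k A"] by (intro powr_mono2) auto
    also have "\<dots> \<le> (norm (h A) powr p + norm (k A) powr p) / 2"
      using p by (intro powr_mid_convex) auto
    finally show ?thesis .
  qed
  have i: "integrable M (\<lambda>A. (norm (h A) powr p + norm (k A) powr p) / 2)" using midpoint by simp
  have j: "integrable M (\<lambda>A. norm ((1/2) *\<^sub>R (h A + k A)) powr p)"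
    by (rule Bochner_Integration.integrable_bound[OF i]) (use le in \<open>auto intro!: AE_I2\<close>)
  have "(LINT A|M. norm ((1/2) *\<^sub>R (h A + k A)) powr p) \<le> (LINT A|M. (norm (h A) powr p + norm (k A) powr p) / 2)"
    using le by (intro integral_mono i j)
  also have "\<dots> = ((LINT A|M. norm (h A) powr p) + (LINT A|M. norm (k A) powr p)) / 2"
    using midpoint by simp
  also have "\<dots> \<le> (LINT A|M. norm (f A) powr p)" using midpoint by simp
  finally show ?case using j by simp
qed

lemma avgs_integral:
  fixes f :: "'w \<Rightarrow> 'c::euclidean_space"
  assumes f: "integrable M f" and "h \<in> avgs f"
  shows "integrable M h \<and> (LINT A|M. h A) = (LINT A|M. f A)"
  using assms(2)
proof induction
  case (shifted z)
  show ?case using integrable_T[OF f] integral_T[of f z] f by auto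
next
  case (midpoint h k)
  then show ?case by (auto simp: scaleR_add_right[symmetric] scaleR_2[symmetric])
qed

lemma avgs_shift:
  assumes "h \<in> avgs f"
  shows "\<exists>h'\<in>avgs f. \<forall>A\<in>space M. h' A = h (T w A)"
  using assms
proof induction
  case (shifted z)
  show ?case by (rule bexI[OF _ avgs.shifted[of f "z + w"]]) (auto simp: T_add)
next
  case (midpoint h k)
  then obtain h' k' where "h' \<in> avgs f" "\<forall>A\<in>space M. h' A = h (T w A)"
     "k' \<in> avgs f" "\<forall>A\<in>space M. k' A = k (T w A)" by blast
  then show ?case by (intro bexI[OF _ avgs.midpoint[of h' f k']]) auto
qed

end

lemma summable_geometric_half: "summable (\<lambda>n. 5 * (1 / 2 :: real) ^ n)"
  by (intro summable_mult summable_geometric) auto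

lemma (in prob_space) integrable_norm_powr_imp_integrable:
  fixes f :: "'a \<Rightarrow> 'v::euclidean_space"
  assumes [measurable]: "f \<in> borel_measurable M" and p: "p \<ge> 1" and i: "integrable M (\<lambda>A. norm (f A) powr p)"
  shows "integrable M f"
proof -
  have pt: "x \<le> 1 + x powr p" if "x \<ge> 0" for x :: real
  proof (cases "x \<le> 1")
    case False
    then show ?thesis using powr_mono[of 1 p x] p by simp
  qed (simp add: add_increasing2)
  have j: "integrable M (\<lambda>A. 1 + norm (f A) powr p)" using i by simp
  show ?thesis
    by (rule Bochner_Integration.integrable_bound[OF j]) (use pt in \<open>auto intro!: AE_I2\<close>)
qed

text \<open>Geometric decay of the second moments gives geometric decay of the first ones. This replaces the
  completeness of \<open>L\<^sup>2\<close>: a fast Cauchy sequence converges almost everywhere because the norms of its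
  increments have a summable mean.\<close>

lemma (in prob_space) integral_norm_le_square:
  fixes u :: "'a \<Rightarrow> 'v::euclidean_space"
  assumes [measurable]: "u \<in> borel_measurable M" and i: "integrable M (\<lambda>A. (norm (u A))\<^sup>2)"
    and le: "(LINT A|M. (norm (u A))\<^sup>2) \<le> 4 * (1 / 16) ^ n"
  shows "integrable M u" "(LINT A|M. norm (u A)) \<le> 5 * (1 / 2) ^ n"
proof -
  have pt: "x \<le> 2 ^ n * x\<^sup>2 + (1 / 2) ^ n" if "x \<ge> 0" for x :: real
  proof (cases "x \<le> (1 / 2) ^ n")
    case True
    then show ?thesis by (simp add: add_increasing)
  next
    case False
    then have "1 \<le> 2 ^ n * x" by (simp add: field_simps)
    then have "x * 1 \<le> x * (2 ^ n * x)" using that by (intro mult_left_mono) auto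
    then show ?thesis by (simp add: power2_eq_square mult_ac add_increasing2)
  qed
  have j: "integrable M (\<lambda>A. 2 ^ n * (norm (u A))\<^sup>2 + (1 / 2) ^ n)" using i by simp
  show u: "integrable M u"
    by (rule Bochner_Integration.integrable_bound[OF j]) (use pt in \<open>auto intro!: AE_I2\<close>)
  have "(LINT A|M. norm (u A)) \<le> (LINT A|M. 2 ^ n * (norm (u A))\<^sup>2 + (1 / 2) ^ n)"
    using u j pt by (intro integral_mono) auto
  also have "\<dots> = 2 ^ n * (LINT A|M. (norm (u A))\<^sup>2) + (1 / 2) ^ n"
    using i by (simp add: prob_space)
  also have "\<dots> \<le> 2 ^ n * (4 * (1 / 16) ^ n) + (1 / 2) ^ n"
    using le by (intro add_right_mono mult_left_mono) auto
  also have "2 ^ n * (4 * (1 / 16) ^ n) = 4 * (1 / 8 :: real) ^ n"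
    by (simp add: power_mult_distrib[symmetric] power_divide) (simp add: power_mult_distrib[of 2 8 n, symmetric] field_simps)
  also have "(1 / 8 :: real) ^ n \<le> (1 / 2) ^ n" by (intro power_mono) auto
  finally show "(LINT A|M. norm (u A)) \<le> 5 * (1 / 2) ^ n" by simp
qed

context ergodic_flow
begin

text \<open>Two averages whose norms almost attain the infimum \<open>\<delta>\<close> are close, since their midpoint is again an
  average.\<close>

lemma avgs_parallelogram:
  fixes f :: "'w \<Rightarrow> 'c::euclidean_space"
  assumes f [measurable]: "f \<in> borel_measurable M" and f2: "integrable M (\<lambda>A. (norm (f A))\<^sup>2)"
    and h: "h \<in> avgs f" and k: "k \<in> avgs f"
    and \<delta>: "\<And>h. h \<in> avgs f \<Longrightarrow> \<delta> \<le> (LINT A|M. (norm (h A))\<^sup>2)"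
    and he: "(LINT A|M. (norm (h A))\<^sup>2) \<le> \<delta> + e" and ke: "(LINT A|M. (norm (k A))\<^sup>2) \<le> \<delta> + e"
  shows "integrable M (\<lambda>A. (norm (h A - k A))\<^sup>2)" "(LINT A|M. (norm (h A - k A))\<^sup>2) \<le> 4 * e"
proof -
  have sq: "integrable M (\<lambda>A. (norm (g A))\<^sup>2)" if "g \<in> avgs f" for g
    using avgs_powr[of 2 f g] that f2 by simp
  define m where "m A = (1/2) *\<^sub>R (h A + k A)" for A
  have m: "m \<in> avgs f" unfolding m_def using h k by (rule avgs.midpoint)
  have pt: "(norm (h A - k A))\<^sup>2 = 2 * (norm (h A))\<^sup>2 + 2 * (norm (k A))\<^sup>2 - 4 * (norm (m A))\<^sup>2" for A
    by (simp add: m_def power2_norm_eq_inner inner_diff_left inner_diff_right inner_add_left inner_add_right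
        inner_commute field_simps)
  show "integrable M (\<lambda>A. (norm (h A - k A))\<^sup>2)"
    unfolding pt using sq h k m by simp
  have "(LINT A|M. (norm (h A - k A))\<^sup>2) = 2 * (LINT A|M. (norm (h A))\<^sup>2) + 2 * (LINT A|M. (norm (k A))\<^sup>2)
    - 4 * (LINT A|M. (norm (m A))\<^sup>2)"
    unfolding pt using sq h k m by simp
  also have "\<dots> \<le> 4 * e" using he ke \<delta>[OF m] by simp
  finally show "(LINT A|M. (norm (h A - k A))\<^sup>2) \<le> 4 * e" .
qed

text \<open>Von Neumann's mean ergodic theorem in its convexity form. A fast minimizing sequence for the \<open>L\<^sup>2\<close>
  norm among the averages of \<open>f\<close> converges almost everywhere. Its translates are minimizing as well, so the
  limit is invariant, hence constant, hence equal to the mean of \<open>f\<close>.\<close>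

theorem mean_ergodic:
  fixes f :: "'w \<Rightarrow> 'c::euclidean_space"
  assumes f [measurable]: "f \<in> borel_measurable M" and f2: "integrable M (\<lambda>A. (norm (f A))\<^sup>2)"
    and f0: "(LINT A|M. f A) = 0"
  obtains h where "\<And>n. h n \<in> avgs f" "AE A in M. (\<lambda>n. h n A) \<longlonglongrightarrow> 0"
proof -
  define Q where "Q h = (LINT A|M. (norm (h A))\<^sup>2)" for h :: "'w \<Rightarrow> 'c"
  define \<delta> where "\<delta> = Inf (Q ` avgs f)"
  have bdd: "bdd_below (Q ` avgs f)" by (rule bdd_belowI[of _ 0]) (auto simp: Q_def)
  have \<delta>: "\<delta> \<le> Q h" if "h \<in> avgs f" for h unfolding \<delta>_def using bdd that by (intro cInf_lower) auto
  have "\<exists>h\<in>avgs f. Q h < \<delta> + (1 / 16) ^ n" for n :: nat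
  proof -
    have "Q ` avgs f \<noteq> {}" using avgs.shifted by blast
    then show ?thesis using cInf_lessD[of "Q ` avgs f" "\<delta> + (1 / 16) ^ n"] by (auto simp: \<delta>_def)
  qed
  then obtain h where h: "\<And>n. h n \<in> avgs f" "\<And>n. Q (h n) < \<delta> + (1 / 16) ^ n" by metis
  have [measurable]: "h n \<in> borel_measurable M" for n by (rule avgs_measurable[OF f h(1)])
  have fi: "integrable M f"
    using integrable_norm_powr_imp_integrable[OF f, of 2] f2 by simp
  have close: "integrable M (\<lambda>A. h n A - k A) \<and> (LINT A|M. norm (h n A - k A)) \<le> 5 * (1 / 2) ^ n"
    if k: "k \<in> avgs f" and kQ: "Q k \<le> \<delta> + (1 / 16) ^ n" for k n
  proof -
    have [measurable]: "k \<in> borel_measurable M" by (rule avgs_measurable[OF f k])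
    have "integrable M (\<lambda>A. (norm (h n A - k A))\<^sup>2)" "(LINT A|M. (norm (h n A - k A))\<^sup>2) \<le> 4 * (1 / 16) ^ n"
      by (rule avgs_parallelogram[OF f f2 h(1)[of n] k, of \<delta>];
          use \<delta> h(2)[of n] kQ in \<open>simp add: Q_def\<close>)+
    from integral_norm_le_square[OF _ this] show ?thesis by auto
  qed
  \<comment> \<open>The increments have summable means, so the sequence and its mean converge.\<close>
  define u where "u n A = h (Suc n) A - h n A" for n A
  have hS: "integrable M (u n) \<and> (LINT A|M. norm (u n A)) \<le> 5 * (1 / 2) ^ n" for n
  proof -
    have "Q (h (Suc n)) \<le> \<delta> + (1 / 16) ^ n"
    proof -
      have "(1 / 16 :: real) ^ Suc n \<le> (1 / 16) ^ n" by (intro power_decreasing) auto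
      with h(2)[of "Suc n"] show ?thesis by linarith
    qed
    note c = close[OF h(1) this]
    then have "integrable M (\<lambda>A. - (h n A - h (Suc n) A))" by (intro Bochner_Integration.integrable_minus) simp
    then show ?thesis using c by (simp add: u_def[abs_def] norm_minus_commute)
  qed
  have summ: "AE A in M. summable (\<lambda>n. norm (u n A))"
    by (rule AE_summable_norm[OF _ _ summable_geometric_half]) (use hS in auto)
  define g where "g A = h 0 A + (\<Sum>n. u n A)" for A
  have sum_int: "summable (\<lambda>n. LINT A|M. norm (u n A))"
    by (rule summable_comparison_test'[OF summable_geometric_half]) (use hS in auto)
  have suI: "integrable M (\<lambda>A. \<Sum>n. u n A)"
    using hS summ sum_int by (intro integrable_suminf) auto
  have u0: "(LINT A|M. u n A) = 0" for n
    using avgs_integral[OF fi h(1)] by (simp add: u_def f0)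
  have "(LINT A|M. (\<Sum>n. u n A)) = (\<Sum>n. (LINT A|M. u n A))"
    using hS summ sum_int by (intro integral_suminf) auto
  then have su0: "(LINT A|M. (\<Sum>n. u n A)) = 0" using u0 by simp
  have gi: "integrable M g" "(LINT A|M. g A) = 0"
  proof -
    have h0: "integrable M (h 0)" "(LINT A|M. h 0 A) = 0"
      using avgs_integral[OF fi h(1)[of 0]] f0 by simp_all
    show "integrable M g" unfolding g_def[abs_def] by (rule Bochner_Integration.integrable_add[OF h0(1) suI])
    show "(LINT A|M. g A) = 0"
      unfolding g_def by (rule trans[OF Bochner_Integration.integral_add[OF h0(1) suI]]) (simp only: h0(2) su0 add_0)
  qed
  have lim: "AE A in M. (\<lambda>n. h n A) \<longlonglongrightarrow> g A"
    using summ
  proof eventually_elim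
    case (elim A)
    then have "(\<lambda>n. \<Sum>i<n. u i A) \<longlonglongrightarrow> (\<Sum>n. u n A)"
      by (rule summable_LIMSEQ[OF summable_norm_cancel])
    moreover have "(\<Sum>i<n. u i A) = h n A - h 0 A" for n
      unfolding u_def by (rule sum_lessThan_telescope)
    ultimately have "(\<lambda>n. h n A - h 0 A) \<longlonglongrightarrow> (\<Sum>n. u n A)" by simp
    from tendsto_add[OF tendsto_const this, of "h 0 A"] show "(\<lambda>n. h n A) \<longlonglongrightarrow> g A"
      by (simp add: g_def)
  qed
  have inv: "AE A in M. g (T z A) = g A" for z
  proof -
    obtain h' where h': "\<And>n. h' n \<in> avgs f" "\<And>n A. A \<in> space M \<Longrightarrow> h' n A = h n (T z A)"
      using avgs_shift[OF h(1), of _ z] by metis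
    have [measurable]: "h' n \<in> borel_measurable M" for n by (rule avgs_measurable[OF f h'(1)])
    have "Q (h' n) = Q (h n)" for n
    proof -
      have "Q (h' n) = (LINT A|M. (norm (h n (T z A)))\<^sup>2)"
        unfolding Q_def by (intro Bochner_Integration.integral_cong) (auto simp: h'(2))
      also have "\<dots> = Q (h n)" unfolding Q_def by (rule integral_T) measurable
      finally show ?thesis .
    qed
    then have "Q (h' n) \<le> \<delta> + (1 / 16) ^ n" for n using h(2)[of n] by simp
    note c = close[OF h'(1) this]
    have "AE A in M. summable (\<lambda>n. norm (h n A - h' n A))"
      by (rule AE_summable_norm[OF _ _ summable_geometric_half]) (use c in auto)
    then show ?thesis using lim AE_T[OF lim, of z] AE_space
    proof eventually_elim
      case (elim A)
      have "(\<lambda>n. norm (h n A - h' n A)) \<longlonglongrightarrow> 0" using elim(1) by (rule summable_LIMSEQ_zero)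
      then have "(\<lambda>n. h n A - h' n A) \<longlonglongrightarrow> 0" by (rule tendsto_norm_zero_cancel)
      then have "(\<lambda>n. h n A - (h n A - h' n A)) \<longlonglongrightarrow> g A - 0" using elim(2) by (intro tendsto_diff)
      then have "(\<lambda>n. h n (T z A)) \<longlonglongrightarrow> g A" using h'(2)[OF elim(4)] by simp
      from LIMSEQ_unique[OF elim(3) this] show ?case .
    qed
  qed
  have "AE A in M. g A \<bullet> i = 0" if "i \<in> Basis" for i
  proof -
    have "AE A in M. g A \<bullet> i = (LINT A'|M. g A' \<bullet> i)"
    proof (rule AE_invariant_imp_constant)
      show "integrable M (\<lambda>A. g A \<bullet> i)" using gi by simp
      show "AE A in M. g (T z A) \<bullet> i = g A \<bullet> i" for z using inv[of z] by eventually_elim simp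
    qed
    moreover have "(LINT A'|M. g A' \<bullet> i) = 0" using gi by (simp add: integral_inner_left)
    ultimately show ?thesis by simp
  qed
  then have "AE A in M. \<forall>i\<in>Basis. g A \<bullet> i = 0" by (simp add: AE_ball_countable countable_finite)
  with lim have "AE A in M. (\<lambda>n. h n A) \<longlonglongrightarrow> 0"
  proof eventually_elim
    case (elim A)
    then have "g A = 0" using euclidean_eqI[of "g A" 0] by simp
    with elim show ?case by simp
  qed
  then show ?thesis by (rule that[OF h(1)])
qed

end

section \<open>Orthogonality of gradients and divergence-free fields\<close>

lemma bump_increment:
  fixes x z :: "'v::euclidean_space"
  shows "has_bochner_integral lborel (\<lambda>t. indicator {0..1} t *\<^sub>R (- (bump_grad s r (x - t *\<^sub>R z) \<bullet> z)))
    (bump s r (x - z) - bump s r x)"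
proof -
  have "has_bochner_integral lborel (\<lambda>t. indicator {0..1} t *\<^sub>R (- (bump_grad s r (x - t *\<^sub>R z) \<bullet> z)))
    (bump s r (x - 1 *\<^sub>R z) - bump s r (x - 0 *\<^sub>R z))"
  proof (rule has_bochner_integral_FTC_Icc)
    fix t :: real
    have "((\<lambda>t. x - t *\<^sub>R z) has_derivative (\<lambda>h. - (h *\<^sub>R z))) (at t within {0..1})"
      by (auto intro!: derivative_eq_intros)
    from has_derivative_compose[OF this bump_has_bump_grad]
    show "((\<lambda>t. bump s r (x - t *\<^sub>R z)) has_vector_derivative - (bump_grad s r (x - t *\<^sub>R z) \<bullet> z)) (at t within {0..1})"
      by (simp add: has_vector_derivative_def)
  next
    show "continuous_on {0..1} (\<lambda>t. - (bump_grad s r (x - t *\<^sub>R z) \<bullet> z))"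
      by (intro continuous_intros continuous_on_compose2[OF bump_grad_continuous[of UNIV]]) auto
  qed simp
  then show ?thesis by simp
qed

text \<open>A bounded function whose distributional gradient vanishes has translation invariant averages: the
  increment of the bump is the integral of its derivative along a segment, and the order of
  integration is exchanged.\<close>

lemma weak_gradient_zero_imp_bump_average_constant:
  fixes c :: "'v::euclidean_space \<Rightarrow> real"
  assumes c [measurable]: "c \<in> borel_measurable borel" and bound: "\<And>x. \<bar>c x\<bar> \<le> K"
    and s: "s > 0" and r: "r > 0"
    and zero: "\<And>a v. (LINT x|lborel. c x * (bump_grad s r (x - a) \<bullet> v)) = 0"
  shows "(LINT x|lborel. c x * bump s r (x - z)) = (LINT x|lborel. c x * bump s r x)"
proof -
  have K: "K \<ge> 0" using bound[of 0] by linarith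
  obtain B where B: "B > 0" "\<And>x::'v. norm (bump_grad s r x) \<le> B * indicator (cball 0 r) x"
    using bump_grad_bounded[OF s r] by blast
  define R where "R = r + norm z"
  define u where "u = (\<lambda>(x, t). c x * (indicator {0..1::real} t *\<^sub>R (- (bump_grad s r (x - t *\<^sub>R z) \<bullet> z))))"
  have [measurable]: "u \<in> borel_measurable (lborel \<Otimes>\<^sub>M lborel)" unfolding u_def by measurable
  have ubound: "norm (u (x, t)) \<le> (K * B * norm z * indicator (cball 0 R) x) * indicator {0..1} t" for x t
  proof (cases "t \<in> {0..1}")
    case t: True
    have "\<bar>bump_grad s r (x - t *\<^sub>R z) \<bullet> z\<bar> \<le> (B * indicator (cball 0 r) (x - t *\<^sub>R z)) * norm z"
      by (rule order_trans[OF Cauchy_Schwarz_ineq2]) (intro mult_right_mono B norm_ge_zero)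
    also have "\<dots> \<le> (B * indicator (cball 0 R) x) * norm z"
    proof (intro mult_right_mono mult_left_mono)
      have "norm x \<le> norm (x - t *\<^sub>R z) + norm (t *\<^sub>R z)" using norm_triangle_ineq[of "x - t *\<^sub>R z" "t *\<^sub>R z"] by simp
      also have "norm (t *\<^sub>R z) \<le> norm z" using t mult_right_mono[of t 1 "norm z"] by simp
      finally show "indicator (cball 0 r) (x - t *\<^sub>R z) \<le> (indicator (cball 0 R) x :: real)"
        by (auto simp: indicator_def R_def)
    qed (use B in auto)
    finally have "\<bar>c x\<bar> * \<bar>bump_grad s r (x - t *\<^sub>R z) \<bullet> z\<bar> \<le> K * ((B * indicator (cball 0 R) x) * norm z)"
      using bound K by (intro mult_mono) auto
    then show ?thesis using t by (simp add: u_def abs_mult mult_ac)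
  qed (simp add: u_def)
  have int: "integrable (lborel \<Otimes>\<^sub>M lborel) u"
  proof (rule Bochner_Integration.integrable_bound)
    have "emeasure (lborel \<Otimes>\<^sub>M lborel) (cball (0::'v) R \<times> {0..1::real}) < \<infinity>"
      using emeasure_lborel_cball_finite[of "0::'v" R]
      by (subst lborel.emeasure_pair_measure_Times) (auto simp: ennreal_mult_less_top)
    then show "integrable (lborel \<Otimes>\<^sub>M lborel)
        (\<lambda>p. (K * B * norm z) * indicator (cball (0::'v) R \<times> {0..1::real}) p)"
      by (intro integrable_mult_right integrable_real_indicator) (auto simp: pair_measureI)
    show "AE p in lborel \<Otimes>\<^sub>M lborel. norm (u p)
        \<le> norm ((K * B * norm z) * indicator (cball (0::'v) R \<times> {0..1::real}) p)"
    proof (intro AE_I2)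
      fix p :: "'v \<times> real"
      show "norm (u p) \<le> norm ((K * B * norm z) * indicator (cball (0::'v) R \<times> {0..1::real}) p)"
        using order_trans[OF ubound[of "fst p" "snd p"] abs_ge_self]
        by (cases p) (simp add: indicator_times mult.assoc)
    qed
  qed measurable
  have inner: "(LINT t|lborel. u (x, t)) = c x * (bump s r (x - z) - bump s r x)" for x
    unfolding u_def prod.case integral_mult_right_zero
      has_bochner_integral_integral_eq[OF bump_increment] ..
  have "(LINT x|lborel. c x * (bump s r (x - z) - bump s r x)) = (LINT x|lborel. LINT t|lborel. u (x, t))"
    by (simp add: inner)
  also have "\<dots> = (LINT t|lborel. LINT x|lborel. u (x, t))"
    by (rule lborel_pair.Fubini_integral[symmetric]) (use int in simp)
  also have "\<dots> = (LINT t|(lborel :: real measure). 0)"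
  proof (rule Bochner_Integration.integral_cong[OF refl])
    fix t :: real
    have "(LINT x|lborel. u (x, t)) = (LINT x|lborel. (- indicator {0..1} t) * (c x * (bump_grad s r (x - t *\<^sub>R z) \<bullet> z)))"
      by (intro Bochner_Integration.integral_cong) (auto simp: u_def)
    also have "\<dots> = (- indicator {0..1} t) * (LINT x|lborel. c x * (bump_grad s r (x - t *\<^sub>R z) \<bullet> z))"
      by (rule integral_mult_right_zero)
    also have "\<dots> = 0" by (simp add: zero)
    finally show "(LINT x|lborel. u (x, t)) = 0" .
  qed
  finally have diff: "(LINT x|lborel. c x * (bump s r (x - z) - bump s r x)) = 0" by simp
  have i: "integrable lborel (\<lambda>x. c x * bump s r (x - w))" for w
  proof (rule Bochner_Integration.integrable_bound[OF integrable_indicator_cball[of K "r + norm w"]])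
    show "AE x in lborel. norm (c x * bump s r (x - w)) \<le> norm (K * indicator (cball 0 (r + norm w)) x)"
    proof (intro AE_I2)
      fix x :: 'v
      show "norm (c x * bump s r (x - w)) \<le> norm (K * indicator (cball 0 (r + norm w)) x)"
      proof (cases "norm (x - w) \<ge> r")
        case True
        then show ?thesis using bump_outside[OF s r, of "x - w"] by simp
      next
        case False
        then have "norm x \<le> r + norm w" using norm_triangle_ineq[of "x - w" w] by simp
        moreover have "\<bar>c x\<bar> * bump s r (x - w) \<le> K * 1"
          using bound bump_bounds[of s r "x - w"] K by (intro mult_mono) auto
        ultimately show ?thesis using K bump_bounds[of s r "x - w"] by (simp add: abs_mult)
      qed
    qed
  qed measurable
  have "(LINT x|lborel. c x * bump s r (x - z)) - (LINT x|lborel. c x * bump s r x)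
      = (LINT x|lborel. c x * bump s r (x - z) - c x * bump s r x)"
    using i[of z] i[of 0] by simp
  also have "\<dots> = 0" using diff by (simp add: right_diff_distrib)
  finally show ?thesis by simp
qed

context measure_flow
begin

text \<open>The differentiation theorem at the origin. It holds at almost every point of almost every
  orbit, and by invariance of the measure one such point may be moved to the origin.\<close>

lemma AE_ball_avg_tendsto:
  fixes f :: "'w \<Rightarrow> 'c::euclidean_space"
  assumes f: "integrable M f"
  shows "AE A in M. (\<lambda>n. ball_avg (\<lambda>x. f (T x A)) 0 (inverse (real (Suc n)))) \<longlonglongrightarrow> f A"
proof -
  have [measurable]: "f \<in> borel_measurable M" using f by auto
  define X where "X n A = ball_avg (\<lambda>x. f (T x A)) 0 (inverse (real (Suc n)))" for n A
  define B where "B n = ball (0::'v) (inverse (real (Suc n)))" for n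
  have [measurable]: "B n \<in> sets borel" for n by (simp add: B_def)
  have X_eq: "X n A = (1 / measure lborel (B n)) *\<^sub>R (LINT x|lborel. indicator (B n) x *\<^sub>R f (T x A))" for n A
    by (simp add: X_def ball_avg_def set_lebesgue_integral_def B_def)
  have [measurable]: "X n \<in> borel_measurable M" for n
  proof -
    have "(\<lambda>A. LINT x|lborel. indicator (B n) x *\<^sub>R f (T x A)) \<in> borel_measurable M" by measurable
    then show ?thesis unfolding X_eq[abs_def] by (intro borel_measurable_scaleR borel_measurable_const)
  qed
  define G where "G A \<longleftrightarrow> (\<forall>k::nat. \<exists>N. \<forall>n\<ge>N. dist (X n A) (f A) < inverse (real (Suc k)))" for A
  have G_meas [measurable]: "Measurable.pred M G" unfolding G_def by measurable
  have G_iff: "G A \<longleftrightarrow> (\<lambda>n. X n A) \<longlonglongrightarrow> f A" for A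
  proof
    assume G: "G A"
    show "(\<lambda>n. X n A) \<longlonglongrightarrow> f A"
      unfolding lim_sequentially
    proof (intro allI impI)
      fix e :: real assume "e > 0"
      then obtain k where "inverse (real (Suc k)) < e" using reals_Archimedean by blast
      with G show "\<exists>N. \<forall>n\<ge>N. dist (X n A) (f A) < e" unfolding G_def by (meson less_trans)
    qed
  next
    assume "(\<lambda>n. X n A) \<longlonglongrightarrow> f A"
    then show "G A" unfolding G_def lim_sequentially by simp
  qed
  \<comment> \<open>The average at the origin for the shifted sample is the average at \<open>x\<close>.\<close>
  have X_shift: "X n (T x A) = ball_avg (\<lambda>y. f (T y A)) x (inverse (real (Suc n)))" if A [measurable]: "A \<in> space M" for n x A
  proof -
    let ?r = "inverse (real (Suc n))"
    have [measurable]: "ball x ?r \<in> sets borel" by simp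
    have "(LINT y|lborel. indicator (ball 0 ?r) y *\<^sub>R f (T y (T x A)))
      = (LINT y|lborel. (\<lambda>y. indicator (ball x ?r) y *\<^sub>R f (T y A)) (y + x))"
      using A by (intro Bochner_Integration.integral_cong)
        (auto simp: T_add indicator_def dist_norm)
    also have "\<dots> = (LINT y|lborel. indicator (ball x ?r) y *\<^sub>R f (T y A))"
      by (rule lborel_shift) measurable
    finally show ?thesis
      using content_ball_conv_unit_ball[of ?r x] content_ball_conv_unit_ball[of ?r "0::'v"]
      by (simp add: X_def ball_avg_def set_lebesgue_integral_def)
  qed
  have lim: "filterlim (\<lambda>n. inverse (real (Suc n))) (at_right 0) sequentially"
    unfolding filterlim_at using LIMSEQ_inverse_real_of_nat by (auto intro!: always_eventually)
  have "AE A in M. AE x in lborel. G (T x A)"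
    using AE_loc_integrable[OF f] AE_space
  proof eventually_elim
    case (elim A)
    show ?case using lebesgue_differentiation[OF elim(1)]
    proof eventually_elim
      case (elim x)
      have "(\<lambda>n. ball_avg (\<lambda>y. f (T y A)) x (inverse (real (Suc n)))) \<longlonglongrightarrow> f (T x A)"
        by (rule filterlim_compose[OF elim lim])
      then show ?case using \<open>A \<in> space M\<close> by (simp add: G_iff X_shift)
    qed
  qed
  moreover have "Measurable.pred (M \<Otimes>\<^sub>M lborel) (\<lambda>z. G (T (snd z) (fst z)))" by measurable
  ultimately have "AE x in lborel. AE A in M. G (T x A)"
    by (subst P.AE_commute[symmetric]) (simp_all only: pred_def)
  from eventually_happens[OF this] obtain x where "AE A in M. G (T x A)"
    by (auto simp: ae_filter_eq_bot_iff)
  then have "AE A in distr M M (T x). G A"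
    by (subst AE_distr_iff) auto
  then show ?thesis unfolding T_distr G_iff X_def .
qed

end

context ergodic_flow
begin

text \<open>That the stationary field of \<open>f\<close> is a gradient is only used against derivatives of radial bumps, where
  it amounts to the symmetry of the matrix of integrals. By stationarity it suffices to test with
  bumps centred at the origin. In this form the condition is visibly invariant under rotations.\<close>

definition curl_free :: "('w \<Rightarrow> 'v) \<Rightarrow> bool" where
  "curl_free f \<longleftrightarrow> (\<forall>s>0. \<forall>r>0. AE A in M. \<forall>v w.
    (LINT x|lborel. (f (T x A) \<bullet> v) * (bump_grad s r x \<bullet> w)) =
    (LINT x|lborel. (f (T x A) \<bullet> w) * (bump_grad s r x \<bullet> v)))"

definition divergence_free :: "('w \<Rightarrow> 'v) \<Rightarrow> bool" where
  "divergence_free q \<longleftrightarrow> (\<forall>s>0. \<forall>r>0. AE A in M. (LINT x|lborel. q (T x A) \<bullet> bump_grad s r x) = 0)"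

text \<open>The heart of the orthogonality. Let \<open>C\<^sub>i\<^sub>j(x)\<close> be the mean of \<open>q\<^sub>i(0) f\<^sub>j(x)\<close>, whose trace is the
  correlation in the statement. In the sense of distributions
  \<open>\<partial>\<^sub>j (\<Sum>\<^sub>i C\<^sub>i\<^sub>i) = \<Sum>\<^sub>i \<partial>\<^sub>i C\<^sub>i\<^sub>j = 0\<close>:
  the first equality holds because \<open>f\<close> is curl-free in \<open>x\<close>, the second one because by stationarity
  \<open>C\<^sub>i\<^sub>j(x)\<close> is also the mean of \<open>q\<^sub>i(-x) f\<^sub>j(0)\<close> and \<open>q\<close> is divergence-free.\<close>

lemma correlation_gradient_zero:
  fixes f q :: "'w \<Rightarrow> 'v"
  assumes p: "p > 1" and [measurable]: "f \<in> borel_measurable M" "q \<in> borel_measurable M"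
    and F: "integrable M (\<lambda>A. norm (f A) powr p)"
    and G: "integrable M (\<lambda>A. norm (q A) powr (p / (p - 1)))"
    and curl: "curl_free f" and div: "divergence_free q" and s: "s > 0" and r: "r > 0"
  shows "(LINT x|lborel. (LINT A|M. q A \<bullet> f (T x A)) * (bump_grad s r (x - a) \<bullet> v)) = 0"
proof -
  let ?D = "bump_grad s r :: 'v \<Rightarrow> 'v"
  obtain B where B: "B > 0" "\<And>x. norm (?D x) \<le> B * indicator (cball 0 r) x"
    using bump_grad_bounded[OF s r] by blast
  define c where "c x = (LINT A|M. q A \<bullet> f (T x A))" for x
  have [measurable]: "c \<in> borel_measurable borel" unfolding c_def by measurable
  have Db: "\<bar>?D x \<bullet> w\<bar> \<le> B * indicator (cball 0 r) x * norm w" for x w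
    by (rule order_trans[OF Cauchy_Schwarz_ineq2]) (intro mult_right_mono B norm_ge_zero)
  \<comment> \<open>The three integrands are related by the curl condition and by a shift of the sample point.\<close>
  define u1 where "u1 A x = (q A \<bullet> f (T (x + a) A)) * (?D x \<bullet> v)" for A x
  define u2 where "u2 A x = (f (T (x + a) A) \<bullet> v) * (?D x \<bullet> q A)" for A x
  define u3 where "u3 A x = (f (T a A) \<bullet> v) * (?D x \<bullet> q (T (- x) A))" for A x
  have i1: "integrable (M \<Otimes>\<^sub>M lborel) (\<lambda>(A, x). u1 A x)"
  proof (rule integrable_pair_dominated[OF _ G F, of _ "\<lambda>x. 0" "\<lambda>x. x + a" "B * norm v" r])
    show "(\<lambda>(A, x). u1 A x) \<in> borel_measurable (M \<Otimes>\<^sub>M lborel)" unfolding u1_def by measurable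
    fix A x assume A: "A \<in> space M"
    have "\<bar>u1 A x\<bar> \<le> (norm (q A) powr (p / (p - 1)) + norm (f (T (x + a) A)) powr p) * (B * indicator (cball 0 r) x * norm v)"
      unfolding u1_def abs_mult by (intro mult_mono abs_inner_le_powr p Db) auto
    then show "norm (case (A, x) of (A, x) \<Rightarrow> u1 A x) \<le> (norm (q (T 0 A)) powr (p / (p - 1)) + norm (f (T (x + a) A)) powr p) * (B * norm v * indicator (cball 0 r) x)"
      using T_zero[OF A] by (simp add: mult_ac)
  qed auto
  have fq: "\<bar>(y \<bullet> v) * (?D x \<bullet> w)\<bar> \<le> (norm w powr (p / (p - 1)) + norm y powr p) * (B * norm v * indicator (cball 0 r) x)" for x y w
  proof -
    have "\<bar>(y \<bullet> v) * (?D x \<bullet> w)\<bar> \<le> (norm y * norm v) * (B * indicator (cball 0 r) x * norm w)"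
      unfolding abs_mult by (intro mult_mono Cauchy_Schwarz_ineq2 Db) auto
    also have "\<dots> = (norm w * norm y) * (B * norm v * indicator (cball 0 r) x)" by (simp add: mult_ac)
    also have "\<dots> \<le> (norm w powr (p / (p - 1)) + norm y powr p) * (B * norm v * indicator (cball 0 r) x)"
      using B by (intro mult_right_mono norm_mult_le_powr p) auto
    finally show ?thesis .
  qed
  have i2: "integrable (M \<Otimes>\<^sub>M lborel) (\<lambda>(A, x). u2 A x)"
  proof (rule integrable_pair_dominated[OF _ G F, of _ "\<lambda>x. 0" "\<lambda>x. x + a" "B * norm v" r])
    show "(\<lambda>(A, x). u2 A x) \<in> borel_measurable (M \<Otimes>\<^sub>M lborel)" unfolding u2_def by measurable
    fix A x assume A: "A \<in> space M"
    show "norm (case (A, x) of (A, x) \<Rightarrow> u2 A x) \<le> (norm (q (T 0 A)) powr (p / (p - 1)) + norm (f (T (x + a) A)) powr p) * (B * norm v * indicator (cball 0 r) x)"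
      using T_zero[OF A] fq[of "f (T (x + a) A)" x "q A"] by (simp add: u2_def)
  qed auto
  have i3: "integrable (M \<Otimes>\<^sub>M lborel) (\<lambda>(A, x). u3 A x)"
  proof (rule integrable_pair_dominated[OF _ G F, of _ "\<lambda>x. - x" "\<lambda>x. a" "B * norm v" r])
    show "(\<lambda>(A, x). u3 A x) \<in> borel_measurable (M \<Otimes>\<^sub>M lborel)" unfolding u3_def by measurable
    fix A x assume A: "A \<in> space M"
    show "norm (case (A, x) of (A, x) \<Rightarrow> u3 A x) \<le> (norm (q (T (- x) A)) powr (p / (p - 1)) + norm (f (T a A)) powr p) * (B * norm v * indicator (cball 0 r) x)"
      using fq[of "f (T a A)" x "q (T (- x) A)"] by (simp add: u3_def)
  qed auto
  have "(LINT x|lborel. c x * (?D (x - a) \<bullet> v)) = (LINT x|lborel. c (x + a) * (?D x \<bullet> v))"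
    using lborel_shift[of "\<lambda>x. c x * (?D (x - a) \<bullet> v)" a] by simp
  also have "\<dots> = (LINT x|lborel. (LINT A|M. u1 A x))"
    by (simp add: c_def u1_def)
  also have "\<dots> = (LINT A|M. (LINT x|lborel. u1 A x))"
    by (rule P.Fubini_integral[OF i1])
  also have "\<dots> = (LINT A|M. (LINT x|lborel. u2 A x))"
  proof (rule integral_cong_AE)
    show "(\<lambda>A. LINT x|lborel. u1 A x) \<in> borel_measurable M" unfolding u1_def by measurable
    show "(\<lambda>A. LINT x|lborel. u2 A x) \<in> borel_measurable M" unfolding u2_def by measurable
    have "AE A in M. \<forall>v w. (LINT x|lborel. (f (T x (T a A)) \<bullet> v) * (?D x \<bullet> w)) =
        (LINT x|lborel. (f (T x (T a A)) \<bullet> w) * (?D x \<bullet> v))"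
      by (rule AE_T) (use curl s r in \<open>simp add: curl_free_def\<close>)
    then show "AE A in M. (LINT x|lborel. u1 A x) = (LINT x|lborel. u2 A x)"
      using AE_space
    proof eventually_elim
      case (elim A)
      then show ?case using elim(1)[rule_format, of "q A" v] by (simp add: u1_def u2_def T_add inner_commute)
    qed
  qed
  also have "\<dots> = (LINT x|lborel. (LINT A|M. u2 A x))"
    by (rule P.Fubini_integral[OF i2, symmetric])
  also have "\<dots> = (LINT x|lborel. (LINT A|M. u3 A x))"
  proof (rule Bochner_Integration.integral_cong[OF refl])
    fix x
    have [measurable]: "(\<lambda>A. u3 A x) \<in> borel_measurable M" unfolding u3_def by measurable
    have "u3 (T x A) x = u2 A x" if "A \<in> space M" for A
      using T_add[OF that, of a x] T_add[OF that, of "- x" x] T_zero[OF that]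
      by (simp add: u3_def u2_def add.commute)
    then have "(LINT A|M. u2 A x) = (LINT A|M. u3 (T x A) x)"
      by (intro Bochner_Integration.integral_cong) auto
    also have "\<dots> = (LINT A|M. u3 A x)" by (rule integral_T) measurable
    finally show "(LINT A|M. u2 A x) = (LINT A|M. u3 A x)" .
  qed
  also have "\<dots> = (LINT A|M. (LINT x|lborel. u3 A x))"
    by (rule P.Fubini_integral[OF i3])
  also have "\<dots> = (LINT A|M. 0)"
  proof (rule integral_cong_AE)
    show "(\<lambda>A. LINT x|lborel. u3 A x) \<in> borel_measurable M" unfolding u3_def by measurable
    have "AE A in M. (LINT x|lborel. q (T x A) \<bullet> ?D x) = 0"
      using div s r by (simp add: divergence_free_def)
    then show "AE A in M. (LINT x|lborel. u3 A x) = 0"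
      using AE_space
    proof eventually_elim
      case (elim A)
      have [measurable]: "A \<in> space M" by (rule elim)
      have "(LINT x|lborel. ?D x \<bullet> q (T (- x) A)) = (LINT x|lborel. ?D (- x) \<bullet> q (T (- (- x)) A))"
        by (rule lborel_integral_reflect[symmetric]) measurable
      also have "\<dots> = (LINT x|lborel. - (q (T x A) \<bullet> ?D x))"
        by (simp add: bump_grad_uminus inner_commute)
      also have "\<dots> = 0" using elim(1) by simp
      finally show ?case unfolding u3_def by (simp only: integral_mult_right_zero mult_zero_right)
    qed
  qed simp
  finally show ?thesis by (simp add: c_def)
qed

text \<open>The correlation is constant in the sense of distributions, so \<open>f\<close> may be replaced by any average of
  its translates without changing the bump average \<open>\<kappa>\<close>. The mean ergodic theorem provides averages
  that tend to zero almost everywhere and stay bounded in \<open>L\<^sup>p\<close>, hence \<open>\<kappa> = 0\<close>.\<close>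

lemma correlation_bump_average_zero:
  fixes f q :: "'w \<Rightarrow> 'v"
  assumes p: "p \<ge> 2" and f [measurable]: "f \<in> borel_measurable M" and q [measurable]: "q \<in> borel_measurable M"
    and F: "integrable M (\<lambda>A. norm (f A) powr p)"
    and G: "integrable M (\<lambda>A. norm (q A) powr (p / (p - 1)))"
    and curl: "curl_free f" and div: "divergence_free q"
    and mean: "(LINT A|M. f A) = 0" and s: "s > 0" and r: "r > 0"
  shows "(LINT x|lborel. (LINT A|M. q A \<bullet> f (T x A)) * bump s r x) = 0"
proof -
  have p1: "p > 1" "p \<ge> 1" using p by auto
  define c where "c h x = (LINT A|M. q A \<bullet> h (T x A))" for h :: "'w \<Rightarrow> 'v" and x
  define K where "K = (LINT A|M. norm (q A) powr (p / (p - 1))) + (LINT A|M. norm (f A) powr p)"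
  have K: "K \<ge> 0" by (simp add: K_def integral_nonneg_AE)
  note avm = avgs_measurable[OF f]
  have qh: "integrable M (\<lambda>A. q A \<bullet> h (T x A))" "\<bar>c h x\<bar> \<le> K" if h: "h \<in> avgs f" for h x
  proof -
    have [measurable]: "h \<in> borel_measurable M" by (rule avm[OF h])
    have hp: "integrable M (\<lambda>A. norm (h A) powr p)" "(LINT A|M. norm (h A) powr p) \<le> (LINT A|M. norm (f A) powr p)"
      using avgs_powr[OF p1(2) f F h] by auto
    have hT: "integrable M (\<lambda>A. norm (h (T x A)) powr p)" using integrable_T[OF hp(1)] .
    have hT': "(LINT A|M. norm (h (T x A)) powr p) = (LINT A|M. norm (h A) powr p)"
      by (rule integral_T) measurable
    show "integrable M (\<lambda>A. q A \<bullet> h (T x A))"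
      by (rule integrable_inner_powr(1)[OF _ _ p1(1) G hT]) measurable
    have "\<bar>c h x\<bar> \<le> (LINT A|M. norm (q A) powr (p / (p - 1))) + (LINT A|M. norm (h (T x A)) powr p)"
      unfolding c_def by (rule integrable_inner_powr(2)[OF _ _ p1(1) G hT]) measurable
    then show "\<bar>c h x\<bar> \<le> K" using hp(2) hT' by (simp add: K_def)
  qed
  have cm: "c h \<in> borel_measurable borel" if "h \<in> avgs f" for h
  proof -
    have [measurable]: "h \<in> borel_measurable M" by (rule avm[OF that])
    show ?thesis unfolding c_def by measurable
  qed
  have dom: "integrable lborel (\<lambda>x. K * indicator (cball (0::'v) r) x)" by (rule integrable_indicator_cball)
  have cb_le: "norm (c h x * bump s r x) \<le> K * indicator (cball 0 r) x" if h: "h \<in> avgs f" for h x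
  proof (cases "norm x \<le> r")
    case True
    have "\<bar>c h x\<bar> * bump s r x \<le> K * 1" using qh(2)[OF h, of x] bump_bounds[of s r x] K by (intro mult_mono) auto
    then show ?thesis using True bump_bounds[of s r x] by (simp add: abs_mult)
  qed (simp add: bump_outside[OF s r])
  have ci: "integrable lborel (\<lambda>x. c h x * bump s r x)" if h: "h \<in> avgs f" for h
  proof (rule Bochner_Integration.integrable_bound[OF dom])
    show "(\<lambda>x. c h x * bump s r x) \<in> borel_measurable lborel" using cm[OF h] by measurable
    show "AE x in lborel. norm (c h x * bump s r x) \<le> norm (K * indicator (cball 0 r) x)"
      using cb_le[OF h] K by (intro AE_I2) (auto intro: order_trans)
  qed
  have f_avg: "\<exists>g\<in>avgs f. \<forall>x. c g x = c f x"
  proof (rule bexI[OF _ avgs.shifted[of f 0]], intro allI)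
    show "c (\<lambda>A. f (T 0 A)) x = c f x" for x
      unfolding c_def by (intro Bochner_Integration.integral_cong) (auto simp: T_zero T_space)
  qed
  have cfm [measurable]: "c f \<in> borel_measurable borel" unfolding c_def by measurable
  have cf_bound: "\<bar>c f x\<bar> \<le> K" for x using f_avg qh(2) by metis
  define \<kappa> where "\<kappa> = (LINT x|lborel. c f x * bump s r x)"
  have const: "(LINT x|lborel. c f x * bump s r (x - z)) = \<kappa>" for z
    unfolding \<kappa>_def
  proof (rule weak_gradient_zero_imp_bump_average_constant[OF cfm cf_bound s r])
    show "(LINT x|lborel. c f x * (bump_grad s r (x - a) \<bullet> v)) = 0" for a v
      unfolding c_def by (rule correlation_gradient_zero[OF p1(1) f q F G curl div s r])
  qed
  have kappa: "(LINT x|lborel. c h x * bump s r x) = \<kappa>" if "h \<in> avgs f" for h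
    using that
  proof induction
    case (shifted z)
    have "c (\<lambda>A. f (T z A)) x = c f (x + z)" for x
      unfolding c_def by (intro Bochner_Integration.integral_cong) (auto simp: T_add[symmetric] add.commute)
    then have "(LINT x|lborel. c (\<lambda>A. f (T z A)) x * bump s r x) = (LINT x|lborel. (\<lambda>x. c f x * bump s r (x - z)) (x + z))"
      by simp
    also have "\<dots> = (LINT x|lborel. c f x * bump s r (x - z))" by (rule lborel_shift) measurable
    finally show ?case using const by simp
  next
    case (midpoint h k)
    have "c (\<lambda>A. (1/2) *\<^sub>R (h A + k A)) x = (1/2) * (c h x + c k x)" for x
    proof -
      have "c (\<lambda>A. (1/2) *\<^sub>R (h A + k A)) x = (LINT A|M. (1/2) * (q A \<bullet> h (T x A) + q A \<bullet> k (T x A)))"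
        by (simp add: c_def inner_add_right)
      also have "\<dots> = (1/2) * (c h x + c k x)"
        unfolding c_def integral_mult_right_zero
        by (subst Bochner_Integration.integral_add) (use qh(1) midpoint.hyps in auto)
      finally show ?thesis .
    qed
    then have "(LINT x|lborel. c (\<lambda>A. (1/2) *\<^sub>R (h A + k A)) x * bump s r x)
      = (LINT x|lborel. (1/2) * (c h x * bump s r x + c k x * bump s r x))"
      by (simp add: algebra_simps)
    also have "\<dots> = (1/2) * (\<kappa> + \<kappa>)"
      unfolding integral_mult_right_zero
      by (subst Bochner_Integration.integral_add) (use ci midpoint in auto)
    finally show ?case by simp
  qed
  have "integrable M (\<lambda>A. (norm (f A))\<^sup>2)"
  proof (rule Bochner_Integration.integrable_bound)
    show "integrable M (\<lambda>A. 1 + norm (f A) powr p)" using F by simp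
    have "x\<^sup>2 \<le> 1 + x powr p" if "x \<ge> 0" for x :: real
    proof (cases "x \<le> 1")
      case True
      then have "x\<^sup>2 \<le> 1" using that by (simp add: power_le_one)
      then show ?thesis by (simp add: add_increasing2)
    next
      case False
      then have "x powr 2 \<le> x powr p" using p by (intro powr_mono) auto
      then show ?thesis using False by simp
    qed
    then show "AE A in M. norm ((norm (f A))\<^sup>2) \<le> norm (1 + norm (f A) powr p)" by (intro AE_I2) auto
  qed measurable
  from mean_ergodic[OF f this mean] obtain h where h: "\<And>n. h n \<in> avgs f" "AE A in M. (\<lambda>n. h n A) \<longlonglongrightarrow> 0" by blast
  have "(\<lambda>n. c (h n) x) \<longlonglongrightarrow> 0" for x
    unfolding c_def
  proof (rule bounded_AE_null_imp_weakly_null[OF q _ p1(1) G])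
    fix n
    have [measurable]: "h n \<in> borel_measurable M" by (rule avm[OF h(1)])
    show "(\<lambda>A. h n (T x A)) \<in> borel_measurable M" by measurable
    have hp: "integrable M (\<lambda>A. norm (h n A) powr p)" "(LINT A|M. norm (h n A) powr p) \<le> (LINT A|M. norm (f A) powr p)"
      using avgs_powr[OF p1(2) f F h(1)] by auto
    show "integrable M (\<lambda>A. norm (h n (T x A)) powr p)" using integrable_T[OF hp(1)] .
    have "(LINT A|M. norm (h n (T x A)) powr p) = (LINT A|M. norm (h n A) powr p)"
      by (rule integral_T) measurable
    with hp(2) show "(LINT A|M. norm (h n (T x A)) powr p) \<le> (LINT A|M. norm (f A) powr p)" by simp
    show "AE A in M. (\<lambda>n. h n (T x A)) \<longlonglongrightarrow> 0" by (rule AE_T[OF h(2)])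
  qed
  then have "(\<lambda>n. c (h n) x * bump s r x) \<longlonglongrightarrow> 0 * bump s r x" for x by (intro tendsto_intros)
  then have lim0: "(\<lambda>n. c (h n) x * bump s r x) \<longlonglongrightarrow> 0" for x by simp
  have "(\<lambda>n. LINT x|lborel. c (h n) x * bump s r x) \<longlonglongrightarrow> (LINT x|(lborel :: 'v measure). 0)"
  proof (rule integral_dominated_convergence[OF _ _ dom])
    show "(\<lambda>x. c (h n) x * bump s r x) \<in> borel_measurable lborel" for n using cm[OF h(1)] by measurable
    show "AE x in lborel. (\<lambda>n. c (h n) x * bump s r x) \<longlonglongrightarrow> 0" using lim0 by (intro AE_I2)
    show "AE x in lborel. norm (c (h n) x * bump s r x) \<le> K * indicator (cball 0 r) x" for n
      using cb_le[OF h(1)] by (intro AE_I2)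
  qed simp
  then have "(\<lambda>n. \<kappa>) \<longlonglongrightarrow> 0" using kappa[OF h(1)] by simp
  then have "\<kappa> = 0" by (simp add: LIMSEQ_const_iff)
  then show ?thesis by (simp add: \<kappa>_def c_def)
qed

text \<open>A stationary gradient field with zero mean is orthogonal to every stationary divergence-free field of
  the dual integrability. The bump averages of the correlation vanish, hence so do its averages over
  balls; these equal the mean of the product of \<open>q\<close> with the average of \<open>f\<close> over a small ball, which
  converges weakly to \<open>f\<close> at the origin.\<close>

theorem div_curl_orthogonal:
  fixes f q :: "'w \<Rightarrow> 'v"
  assumes p: "p \<ge> 2" and f [measurable]: "f \<in> borel_measurable M" and q [measurable]: "q \<in> borel_measurable M"
    and F: "integrable M (\<lambda>A. norm (f A) powr p)"
    and G: "integrable M (\<lambda>A. norm (q A) powr (p / (p - 1)))"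
    and curl: "curl_free f" and div: "divergence_free q"
    and mean: "(LINT A|M. f A) = 0"
  shows "(LINT A|M. q A \<bullet> f A) = 0"
proof -
  have p1: "p > 1" "p \<ge> 1" using p by auto
  define c where "c x = (LINT A|M. q A \<bullet> f (T x A))" for x
  define K where "K = (LINT A|M. norm (q A) powr (p / (p - 1))) + (LINT A|M. norm (f A) powr p)"
  have K: "K \<ge> 0" by (simp add: K_def integral_nonneg_AE)
  have cm [measurable]: "c \<in> borel_measurable borel" unfolding c_def by measurable
  have cb: "\<bar>c x\<bar> \<le> K" for x
  proof -
    have "\<bar>c x\<bar> \<le> (LINT A|M. norm (q A) powr (p / (p - 1))) + (LINT A|M. norm (f (T x A)) powr p)"
      unfolding c_def by (rule integrable_inner_powr(2)[OF _ _ p1(1) G integrable_T[OF F]]) measurable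
    also have "(LINT A|M. norm (f (T x A)) powr p) = (LINT A|M. norm (f A) powr p)"
      by (rule integral_T) measurable
    finally show ?thesis by (simp add: K_def)
  qed
  \<comment> \<open>The indicator function of a ball is a bounded limit of bumps.\<close>
  have ball_zero: "(LINT x|lborel. c x * indicator (ball 0 r) x) = 0" if r: "r > 0" for r
  proof -
    have "(\<lambda>n. LINT x|lborel. c x * bump (real (Suc n)) r x) \<longlonglongrightarrow> (LINT x|lborel. c x * indicator (ball 0 r) x)"
    proof (rule integral_dominated_convergence[OF _ _ integrable_indicator_cball[of K r]])
      have [measurable]: "ball (0::'v) r \<in> sets borel" by simp
      show "(\<lambda>x. c x * indicator (ball 0 r) x) \<in> borel_measurable lborel" by measurable
      show "(\<lambda>x. c x * bump (real (Suc n)) r x) \<in> borel_measurable lborel" for n by measurable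
      show "AE x in lborel. (\<lambda>n. c x * bump (real (Suc n)) r x) \<longlonglongrightarrow> c x * indicator (ball 0 r) x"
        by (intro AE_I2 tendsto_intros bump_tendsto_indicator r)
      show "AE x in lborel. norm (c x * bump (real (Suc n)) r x) \<le> K * indicator (cball 0 r) x" for n
      proof (intro AE_I2)
        fix x :: 'v
        have s: "real (Suc n) > 0" by simp
        show "norm (c x * bump (real (Suc n)) r x) \<le> K * indicator (cball 0 r) x"
        proof (cases "norm x \<le> r")
          case True
          have "\<bar>c x\<bar> * bump (real (Suc n)) r x \<le> K * 1"
            using cb[of x] bump_bounds[of "real (Suc n)" r x] K by (intro mult_mono) auto
          then show ?thesis using True bump_bounds[of "real (Suc n)" r x] by (simp add: abs_mult del: of_nat_Suc)
        qed (simp add: bump_outside[OF s r] del: of_nat_Suc)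
      qed
    qed
    moreover have "(LINT x|lborel. c x * bump (real (Suc n)) r x) = 0" for n
      unfolding c_def by (rule correlation_bump_average_zero[OF p f q F G curl div mean _ r]) simp
    ultimately show ?thesis by (simp add: LIMSEQ_const_iff)
  qed
  have fi: "integrable M f" by (rule integrable_norm_powr_imp_integrable[OF f p1(2) F])
  define R where "R n = inverse (real (Suc n))" for n
  define V where "V n = measure lborel (ball (0::'v) (R n))" for n
  have R: "R n > 0" for n by (simp add: R_def)
  have V: "V n > 0" for n using content_ball_pos[OF R[of n], of "0::'v"] by (simp add: V_def)
  \<comment> \<open>The normalized indicator function of a small ball.\<close>
  define w where "w n x = indicator (ball (0::'v) (R n)) x / V n" for n x
  have [measurable]: "w n \<in> borel_measurable borel" for n
  proof -
    have [measurable]: "ball (0::'v) (R n) \<in> sets borel" by simp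
    show ?thesis unfolding w_def by measurable
  qed
  have w: "w n x \<ge> 0" "w n x \<le> (1 / V n) * indicator (cball 0 (R n)) x" for n x
    using V[of n] by (auto simp: w_def indicator_def)
  have wi: "integrable lborel (w n)" for n
    by (rule Bochner_Integration.integrable_bound[OF integrable_indicator_cball[of "1 / V n" "R n"]])
      (use w V in \<open>auto intro!: AE_I2 simp: abs_of_pos\<close>)
  have w1: "(LINT x|lborel. w n x) = 1" for n
    using V[of n] by (simp add: w_def V_def)
  define X where "X n A = (LINT x|lborel. w n x *\<^sub>R f (T x A))" for n A
  have Xm [measurable]: "X n \<in> borel_measurable M" for n unfolding X_def by measurable
  have X_eq: "X n A = ball_avg (\<lambda>x. f (T x A)) 0 (R n)" for n A
    by (simp add: X_def ball_avg_def w_def V_def set_lebesgue_integral_def integral_scaleR_right[symmetric] divide_inverse_commute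
        del: integral_scaleR_right)
  have lim: "AE A in M. (\<lambda>n. X n A) \<longlonglongrightarrow> f A"
    unfolding X_eq R_def by (rule AE_ball_avg_tendsto[OF fi])
  have Fw: "integrable (M \<Otimes>\<^sub>M lborel) (\<lambda>(A, x). norm (f (T x A)) powr p * w n x)" for n
    by (rule integrable_pair_T[OF F wi]) measurable
  have fw: "integrable (M \<Otimes>\<^sub>M lborel) (\<lambda>(A, x). norm (f (T x A)) * w n x)" for n
    by (rule integrable_pair_T[OF integrable_norm[OF fi] wi]) measurable
  define Y where "Y n A = (LINT x|lborel. norm (f (T x A)) powr p * w n x)" for n A
  have Yi: "integrable M (Y n)" for n
    using P.integrable_fst'[OF Fw[of n]] by (simp add: Y_def[abs_def])
  have fwi: "AE A in M. integrable lborel (\<lambda>x. w n x *\<^sub>R f (T x A))" for n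
    using P.AE_integrable_fst[OF fw[of n]] AE_space
  proof eventually_elim
    case (elim A)
    have [measurable]: "A \<in> space M" by (rule elim)
    show ?case
      by (rule Bochner_Integration.integrable_bound[OF elim(1)]) (use w in \<open>auto simp: mult.commute\<close>)
  qed
  have XY: "AE A in M. norm (X n A) powr p \<le> Y n A" for n
    using P.AE_integrable_fst[OF Fw[of n]] fwi[of n]
  proof eventually_elim
    case (elim A)
    then show ?case
      unfolding X_def Y_def mult.commute[of _ "w n _"]
      by (intro jensen_norm_powr p1 wi w w1) (simp_all add: mult.commute)
  qed
  have EY: "(LINT A|M. Y n A) = (LINT A|M. norm (f A) powr p)" for n
  proof -
    have "(LINT A|M. Y n A) = (LINT x|lborel. (LINT A|M. norm (f (T x A)) powr p * w n x))"
      unfolding Y_def by (rule P.Fubini_integral[OF Fw, symmetric])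
    also have "\<dots> = (LINT x|lborel. (LINT A|M. norm (f A) powr p) * w n x)"
      using integral_T[of "\<lambda>A. norm (f A) powr p"] by simp
    finally show ?thesis by (simp add: w1)
  qed
  have Xp: "integrable M (\<lambda>A. norm (X n A) powr p)" for n
    by (rule Bochner_Integration.integrable_bound[OF Yi[of n]])
      (use XY[of n] in \<open>auto elim!: eventually_mono intro: order_trans[OF _ abs_ge_self]\<close>)
  have EX: "(LINT A|M. norm (X n A) powr p) \<le> (LINT A|M. norm (f A) powr p)" for n
    unfolding EY[of n, symmetric] by (rule integral_mono_AE[OF Xp Yi XY])
  have qX: "(LINT A|M. q A \<bullet> X n A) = 0" for n
  proof -
    define u where "u A x = w n x * (q A \<bullet> f (T x A))" for A x
    have [measurable]: "(\<lambda>(A, x). u A x) \<in> borel_measurable (M \<Otimes>\<^sub>M lborel)" unfolding u_def by measurable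
    have ui: "integrable (M \<Otimes>\<^sub>M lborel) (\<lambda>(A, x). u A x)"
    proof (rule integrable_pair_dominated[OF _ G F, of _ "\<lambda>x. 0" "\<lambda>x. x" "1 / V n" "R n"])
      fix A x assume A: "A \<in> space M"
      have "norm (u A x) \<le> ((1 / V n) * indicator (cball 0 (R n)) x) * (norm (q A) powr (p / (p - 1)) + norm (f (T x A)) powr p)"
        unfolding u_def real_norm_def abs_mult
        using w[of n x] by (intro mult_mono abs_inner_le_powr p1) (auto simp: abs_of_nonneg)
      then show "norm (case (A, x) of (A, x) \<Rightarrow> u A x) \<le> (norm (q (T 0 A)) powr (p / (p - 1)) + norm (f (T x A)) powr p) * (1 / V n * indicator (cball 0 (R n)) x)"
        using T_zero[OF A] by (simp add: mult_ac)
    qed auto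
    have "(LINT A|M. q A \<bullet> X n A) = (LINT A|M. (LINT x|lborel. u A x))"
    proof (rule integral_cong_AE)
      show "(\<lambda>A. LINT x|lborel. u A x) \<in> borel_measurable M" unfolding u_def by measurable
      show "AE A in M. q A \<bullet> X n A = (LINT x|lborel. u A x)"
        using fwi[of n]
      proof eventually_elim
        case (elim A)
        then show ?case unfolding X_def u_def
          using integral_inner_right[of "q A" lborel "\<lambda>x. w n x *\<^sub>R f (T x A)"] by simp
      qed
    qed measurable
    also have "\<dots> = (LINT x|lborel. (LINT A|M. u A x))" by (rule P.Fubini_integral[OF ui, symmetric])
    also have "\<dots> = (LINT x|lborel. (1 / V n) * (c x * indicator (ball 0 (R n)) x))"
      by (intro Bochner_Integration.integral_cong) (auto simp: u_def c_def w_def)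
    also have "\<dots> = 0" unfolding integral_mult_right_zero using ball_zero[OF R] by simp
    finally show ?thesis .
  qed
  have "(\<lambda>n. LINT A|M. q A \<bullet> (X n A - f A)) \<longlonglongrightarrow> 0"
  proof (rule bounded_AE_null_imp_weakly_null[OF q _ p1(1) G])
    fix n
    show "(\<lambda>A. X n A - f A) \<in> borel_measurable M" by measurable
    have le: "norm (X n A - f A) powr p \<le> 2 powr p * (norm (X n A) powr p + norm (f A) powr p)" for A
      using p by (intro norm_diff_powr_le) simp
    have i: "integrable M (\<lambda>A. 2 powr p * (norm (X n A) powr p + norm (f A) powr p))" using Xp F by simp
    show j: "integrable M (\<lambda>A. norm (X n A - f A) powr p)"
      by (rule Bochner_Integration.integrable_bound[OF i])
        (use le in \<open>auto intro!: AE_I2 intro: order_trans[OF _ abs_ge_self]\<close>)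
    have "(LINT A|M. norm (X n A - f A) powr p) \<le> (LINT A|M. 2 powr p * (norm (X n A) powr p + norm (f A) powr p))"
      using le by (intro integral_mono i j)
    also have "\<dots> = 2 powr p * ((LINT A|M. norm (X n A) powr p) + (LINT A|M. norm (f A) powr p))"
      using Xp F by simp
    also have "\<dots> \<le> 2 powr p * ((LINT A|M. norm (f A) powr p) + (LINT A|M. norm (f A) powr p))"
      using EX by (intro mult_left_mono add_right_mono) auto
    finally show "(LINT A|M. norm (X n A - f A) powr p)
      \<le> 2 powr p * ((LINT A|M. norm (f A) powr p) + (LINT A|M. norm (f A) powr p))" .
  next
    show "AE A in M. (\<lambda>n. X n A - f A) \<longlonglongrightarrow> 0"
      using lim by eventually_elim (rule LIM_zero)
  qed
  moreover have "(LINT A|M. q A \<bullet> (X n A - f A)) = - (LINT A|M. q A \<bullet> f A)" for n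
  proof -
    have "(LINT A|M. q A \<bullet> (X n A - f A)) = (LINT A|M. q A \<bullet> X n A - q A \<bullet> f A)"
      by (simp add: inner_diff_right)
    also have "\<dots> = (LINT A|M. q A \<bullet> X n A) - (LINT A|M. q A \<bullet> f A)"
      by (intro Bochner_Integration.integral_diff integrable_inner_powr(1)[OF _ _ p1(1) G] Xp F) measurable
    finally show ?thesis by (simp add: qX)
  qed
  ultimately show ?thesis by (simp add: LIMSEQ_const_iff)
qed

end

section \<open>Homogenized energy of a scalar medium\<close>

lemma rpow_nonneg: "rpow t s \<ge> 0"
  by (simp add: rpow_def)

lemma rpow_mono: "0 \<le> x \<Longrightarrow> x \<le> y \<Longrightarrow> 0 \<le> s \<Longrightarrow> rpow x s \<le> rpow y s"
  by (simp add: rpow_def powr_mono2)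

lemma rpow_times_square:
  assumes "t \<ge> 0" "p \<ge> 2"
  shows "rpow t (p - 2) * t\<^sup>2 = t powr p"
proof (cases "t = 0 \<or> p = 2")
  case False
  then have "t powr (p - 2) * t powr 2 = t powr p" by (simp add: powr_add[symmetric])
  then show ?thesis using False assms by (simp add: rpow_def)
qed (use assms in \<open>auto simp: rpow_def\<close>)

lemma rpow_times_square_le:
  assumes "s \<ge> 0" "t \<ge> 0" "p \<ge> 2"
  shows "rpow s (p - 2) * t\<^sup>2 \<le> s powr p + t powr p"
proof -
  have "rpow s (p - 2) * t\<^sup>2 \<le> rpow (max s t) (p - 2) * (max s t)\<^sup>2"
    using assms by (intro mult_mono rpow_mono power_mono rpow_nonneg) auto
  also have "\<dots> = (max s t) powr p" using assms by (intro rpow_times_square) auto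
  also have "\<dots> \<le> s powr p + t powr p" by (auto simp: max_def)
  finally show ?thesis .
qed

text \<open>The density whose derivative is \<open>t + t\<^sup>p\<^sup>-\<^sup>1\<close>, so that the flux is the gradient of
  \<open>\<beta> (p_energy p |\<zeta>|)\<close> in \<open>\<zeta>\<close>.\<close>

definition p_energy :: "real \<Rightarrow> real \<Rightarrow> real" where
  "p_energy p t = t\<^sup>2 / 2 + t powr p / p"

text \<open>Because \<open>p \<ge> 2\<close>, the energy density is convex even as a function of the square of its argument. This
  is stronger than convexity, and it is what makes the homogenized energy convex in \<open>|\<xi>|\<^sup>2\<close>.\<close>

lemma p_energy_convex_in_square:
  assumes "p \<ge> 2" "s \<ge> 0" "t \<ge> 0"
  shows "p_energy p t \<ge> p_energy p s + (1 + rpow s (p - 2)) / 2 * (t\<^sup>2 - s\<^sup>2)"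
proof -
  have sq: "(x\<^sup>2) powr (p / 2) = x powr p" if "x \<ge> 0" for x :: real
    using that by (metis powr_powr powr_numeral times_divide_eq_right mult.commute nonzero_mult_div_cancel_left zero_neq_numeral)
  have rs: "rpow (s\<^sup>2) (p / 2 - 1) = rpow s (p - 2)"
  proof (cases "p = 2")
    case False
    have "(s\<^sup>2) powr (p / 2 - 1) = (s powr 2) powr (p / 2 - 1)" using assms by simp
    also have "\<dots> = s powr (2 * (p / 2 - 1))" by (rule powr_powr)
    also have "2 * (p / 2 - 1) = p - 2" by simp
    finally show ?thesis using False by (simp add: rpow_def)
  qed (simp add: rpow_def)
  have "(t\<^sup>2) powr (p / 2) \<ge> (s\<^sup>2) powr (p / 2) + (p / 2) * rpow (s\<^sup>2) (p / 2 - 1) * (t\<^sup>2 - s\<^sup>2)"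
    using assms by (intro powr_tangent) auto
  then have "t powr p \<ge> s powr p + p * (rpow s (p - 2) / 2 * (t\<^sup>2 - s\<^sup>2))"
    using sq[OF assms(2)] sq[OF assms(3)] rs by (simp add: mult_ac)
  then have "t powr p / p \<ge> (s powr p + p * (rpow s (p - 2) / 2 * (t\<^sup>2 - s\<^sup>2))) / p"
    using assms by (intro divide_right_mono) auto
  then show ?thesis using assms unfolding p_energy_def add_divide_distrib by (simp add: field_simps)
qed

lemma norm_diff_scaleR_square:
  fixes x y :: "'a::real_inner"
  shows "(norm (y - l *\<^sub>R x))\<^sup>2 = (norm y)\<^sup>2 - 2 * l * (x \<bullet> y) + l\<^sup>2 * (norm x)\<^sup>2"
  unfolding power2_norm_eq_inner inner_diff_left inner_diff_right inner_scaleR_left inner_scaleR_right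
  by (simp add: inner_commute power2_eq_square algebra_simps)

text \<open>A scalar coefficient \<open>\<beta>\<close> and, for each direction \<open>\<xi>\<close>, a stationary gradient field \<open>f \<xi>\<close> with zero mean
  for which the flux of \<open>\<xi> + f \<xi>\<close> is divergence-free.\<close>

locale scalar_medium = ergodic_flow M T
  for M :: "'w measure" and T :: "'v::euclidean_space \<Rightarrow> 'w \<Rightarrow> 'w" +
  fixes \<beta> :: "'w \<Rightarrow> real" and p lam :: real and f :: "'v \<Rightarrow> 'w \<Rightarrow> 'v"
  assumes p: "p \<ge> 2" and lam: "lam > 0"
    and \<beta>_measurable [measurable]: "\<beta> \<in> borel_measurable M"
    and \<beta>_bounds: "AE A in M. lam \<le> \<beta> A \<and> \<beta> A \<le> 1"
    and f_measurable [measurable]: "\<And>\<xi>. f \<xi> \<in> borel_measurable M"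
    and f_powr: "\<And>\<xi>. integrable M (\<lambda>A. norm (f \<xi> A) powr p)"
    and f_mean: "\<And>\<xi>. (LINT A|M. f \<xi> A) = 0"
    and f_curl: "\<And>\<xi>. curl_free (f \<xi>)"
    and f_div: "\<And>\<xi>. divergence_free
      (\<lambda>A. \<beta> A *\<^sub>R ((1 + rpow (norm (\<xi> + f \<xi> A)) (p - 2)) *\<^sub>R (\<xi> + f \<xi> A)))"
begin

text \<open>The fields among which \<open>f \<xi>\<close> minimizes the energy.\<close>

definition competitor :: "('w \<Rightarrow> 'v) \<Rightarrow> bool" where
  "competitor g \<longleftrightarrow> g \<in> borel_measurable M \<and> integrable M (\<lambda>A. norm (g A) powr p) \<and>
    (LINT A|M. g A) = 0 \<and> curl_free g"

definition flux_at :: "'v \<Rightarrow> 'w \<Rightarrow> 'v" where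
  "flux_at \<xi> A = \<beta> A *\<^sub>R ((1 + rpow (norm (\<xi> + f \<xi> A)) (p - 2)) *\<^sub>R (\<xi> + f \<xi> A))"

definition mean_flux :: "'v \<Rightarrow> 'v" where
  "mean_flux \<xi> = (LINT A|M. flux_at \<xi> A)"

definition energy :: "'v \<Rightarrow> ('w \<Rightarrow> 'v) \<Rightarrow> real" where
  "energy \<xi> g = (LINT A|M. \<beta> A * p_energy p (norm (\<xi> + g A)))"

definition min_energy :: "'v \<Rightarrow> real" where
  "min_energy \<xi> = energy \<xi> (f \<xi>)"

lemma exponent_bounds: "p > 1" "p \<ge> 1" "p \<ge> 0" using p by auto

lemma f_competitor: "competitor (f \<xi>)"
  by (simp add: competitor_def f_measurable f_powr f_mean f_curl)

lemma rpow_measurable [measurable (raw)]: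
  "g \<in> borel_measurable N \<Longrightarrow> (\<lambda>x. rpow (g x) s) \<in> borel_measurable N"
  by (simp add: rpow_def)

lemma flux_at_measurable [measurable]: "flux_at \<xi> \<in> borel_measurable M"
  unfolding flux_at_def[abs_def] by measurable

lemma shifted_powr:
  assumes "competitor g"
  shows "integrable M (\<lambda>A. norm (\<xi> + g A) powr p)"
proof -
  have [measurable]: "g \<in> borel_measurable M" and g: "integrable M (\<lambda>A. norm (g A) powr p)"
    using assms by (auto simp: competitor_def)
  have i: "integrable M (\<lambda>A. 2 powr p * (norm \<xi> powr p + norm (g A) powr p))" using g by simp
  show ?thesis
    by (rule Bochner_Integration.integrable_bound[OF i])
      (use norm_diff_powr_le[OF exponent_bounds(3), of \<xi> "- g _"] in \<open>auto intro!: AE_I2 intro: order_trans[OF _ abs_ge_self]\<close>)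
qed

lemma integrable_square_of_powr:
  fixes h :: "'w \<Rightarrow> 'c::euclidean_space"
  assumes [measurable]: "h \<in> borel_measurable M" and h: "integrable M (\<lambda>A. norm (h A) powr p)"
  shows "integrable M (\<lambda>A. (norm (h A))\<^sup>2)"
proof -
  have i: "integrable M (\<lambda>A. 1 powr p + norm (h A) powr p)" using h by simp
  have "(norm (h A))\<^sup>2 \<le> 1 powr p + norm (h A) powr p" for A
    using rpow_times_square_le[of 1 "norm (h A)" p] p by (simp add: rpow_def split: if_splits)
  then show ?thesis
    by (intro Bochner_Integration.integrable_bound[OF i] AE_I2) auto
qed

lemma AE_\<beta>: "AE A in M. \<bar>\<beta> A\<bar> \<le> 1"
  using \<beta>_bounds by eventually_elim (use lam in auto)

lemma integrable_\<beta>: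
  fixes h :: "'w \<Rightarrow> real"
  assumes "integrable M h"
  shows "integrable M (\<lambda>A. \<beta> A * h A)"
proof (rule Bochner_Integration.integrable_bound[OF assms])
  show "AE A in M. norm (\<beta> A * h A) \<le> norm (h A)"
    using AE_\<beta> by eventually_elim (auto simp: abs_mult intro: mult_left_le_one_le)
qed (use assms in measurable)

lemma integrable_energy:
  assumes "competitor g"
  shows "integrable M (\<lambda>A. \<beta> A * p_energy p (norm (\<xi> + g A)))"
proof -
  have [measurable]: "g \<in> borel_measurable M" using assms by (simp add: competitor_def)
  have "integrable M (\<lambda>A. (norm (\<xi> + g A))\<^sup>2)"
    by (rule integrable_square_of_powr[OF _ shifted_powr[OF assms]]) measurable
  then show ?thesis
    unfolding p_energy_def using shifted_powr[OF assms] by (intro integrable_\<beta>) simp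
qed

lemma flux_powr: "integrable M (\<lambda>A. norm (flux_at \<xi> A) powr (p / (p - 1)))"
proof -
  define p' where "p' = p / (p - 1)"
  have p': "p' \<ge> 0" "(p - 1) * p' = p" using p by (auto simp: p'_def)
  have i: "integrable M (\<lambda>A. 2 powr p' * (1 + norm (\<xi> + f \<xi> A) powr p))"
    using shifted_powr[OF f_competitor] by simp
  have "AE A in M. norm (flux_at \<xi> A) powr p' \<le> 2 powr p' * (1 + norm (\<xi> + f \<xi> A) powr p)"
    using AE_\<beta>
  proof eventually_elim
    case (elim A)
    define t where "t = norm (\<xi> + f \<xi> A)"
    \<comment> \<open>For \<open>m \<ge> 1\<close> both terms of the flux are bounded by the power \<open>p - 1\<close>.\<close>
    define m where "m = max 1 t"
    have t: "t \<ge> 0" "t \<le> m" "m \<ge> 1" by (auto simp: t_def m_def)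
    have "norm (flux_at \<xi> A) = \<bar>\<beta> A\<bar> * ((1 + rpow t (p - 2)) * t)"
      using rpow_nonneg[of t "p - 2"] by (simp add: flux_at_def t_def abs_mult)
    also have "\<dots> \<le> 1 * ((1 + rpow t (p - 2)) * t)"
      using elim t rpow_nonneg[of t "p - 2"] by (intro mult_right_mono) auto
    also have "\<dots> \<le> 1 * ((m powr (p - 2) + m powr (p - 2)) * m)"
    proof (intro mult_mono add_mono)
      show "1 \<le> m powr (p - 2)" using t p by (intro ge_one_powr_ge_zero) auto
      have "rpow t (p - 2) \<le> rpow m (p - 2)" using t p by (intro rpow_mono) auto
      also have "\<dots> \<le> m powr (p - 2)" using t by (simp add: rpow_def)
      finally show "rpow t (p - 2) \<le> m powr (p - 2)" .
    qed (use t rpow_nonneg[of t "p - 2"] in auto)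
    also have "\<dots> = 2 * (m powr (p - 2) * m powr 1)" using t by simp
    also have "m powr (p - 2) * m powr 1 = m powr (p - 1)" by (simp only: powr_add[symmetric]) simp
    finally have "norm (flux_at \<xi> A) powr p' \<le> (2 * m powr (p - 1)) powr p'"
      using p' by (intro powr_mono2) auto
    also have "\<dots> = 2 powr p' * m powr p"
      using p'(2) by (simp add: powr_mult powr_powr)
    also have "m powr p \<le> 1 + t powr p" by (auto simp: m_def max_def)
    finally show ?case by (simp add: t_def)
  qed
  then show ?thesis unfolding p'_def[symmetric]
    by (intro Bochner_Integration.integrable_bound[OF i])
      (auto elim!: eventually_mono intro: order_trans[OF _ abs_ge_self])
qed

lemma flux_orthogonal:
  assumes "competitor g"
  shows "integrable M (\<lambda>A. flux_at \<xi> A \<bullet> g A)" "(LINT A|M. flux_at \<xi> A \<bullet> g A) = 0"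
proof -
  have g: "g \<in> borel_measurable M" "integrable M (\<lambda>A. norm (g A) powr p)" "(LINT A|M. g A) = 0" "curl_free g"
    using assms by (auto simp: competitor_def)
  show "integrable M (\<lambda>A. flux_at \<xi> A \<bullet> g A)"
    by (rule integrable_inner_powr(1)[OF flux_at_measurable g(1) exponent_bounds(1) flux_powr g(2)])
  show "(LINT A|M. flux_at \<xi> A \<bullet> g A) = 0"
    by (rule div_curl_orthogonal[OF p g(1) flux_at_measurable g(2) flux_powr g(4) _ g(3)])
      (use f_div in \<open>simp add: flux_at_def[abs_def]\<close>)
qed

lemma flux_integrable: "integrable M (flux_at \<xi>)"
  by (rule integrable_norm_powr_imp_integrable[OF _ _ flux_powr]) (use p in \<open>auto simp: field_simps\<close>)

lemma flux_inner:
  assumes "competitor g"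
  shows "integrable M (\<lambda>A. flux_at \<xi> A \<bullet> (\<eta> + g A))" "(LINT A|M. flux_at \<xi> A \<bullet> (\<eta> + g A)) = mean_flux \<xi> \<bullet> \<eta>"
  using flux_integrable flux_orthogonal[OF assms]
  by (auto simp: inner_add_right mean_flux_def integral_inner_left)

text \<open>Convexity of the energy density along \<open>\<xi> + f \<xi>\<close> and orthogonality of the flux. For \<open>\<eta> = \<xi>\<close> this is
  the minimality of \<open>f \<xi>\<close>; for \<open>g = f \<eta>\<close> it says that the mean flux is a subgradient of the
  homogenized energy.\<close>

lemma energy_above_tangent:
  assumes g: "competitor g"
  shows "energy \<eta> g \<ge> min_energy \<xi> + mean_flux \<xi> \<bullet> (\<eta> - \<xi>)"
proof -
  let ?x = "\<lambda>A. \<xi> + f \<xi> A" and ?y = "\<lambda>A. \<eta> + g A"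
  have "min_energy \<xi> + mean_flux \<xi> \<bullet> (\<eta> - \<xi>)
    = (LINT A|M. \<beta> A * p_energy p (norm (?x A)) + (flux_at \<xi> A \<bullet> ?y A - flux_at \<xi> A \<bullet> ?x A))"
    using integrable_energy[OF f_competitor] flux_inner[OF g] flux_inner[OF f_competitor]
    by (simp add: min_energy_def energy_def inner_diff_right)
  also have "\<dots> \<le> energy \<eta> g"
    unfolding energy_def
  proof (rule integral_mono_AE)
    show "AE A in M. \<beta> A * p_energy p (norm (?x A)) + (flux_at \<xi> A \<bullet> ?y A - flux_at \<xi> A \<bullet> ?x A)
      \<le> \<beta> A * p_energy p (norm (?y A))"
      using \<beta>_bounds
    proof eventually_elim
      case (elim A)
      define k where "k = 1 + rpow (norm (?x A)) (p - 2)"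
      have k: "k \<ge> 0" by (simp add: k_def rpow_nonneg)
      have "0 \<le> (norm (?y A - ?x A))\<^sup>2" by simp
      then have "2 * (?x A \<bullet> (?y A - ?x A)) \<le> (norm (?y A))\<^sup>2 - (norm (?x A))\<^sup>2"
        by (simp add: power2_norm_eq_inner inner_diff_left inner_diff_right inner_commute)
      then have "k / 2 * (2 * (?x A \<bullet> (?y A - ?x A))) \<le> k / 2 * ((norm (?y A))\<^sup>2 - (norm (?x A))\<^sup>2)"
        using k by (intro mult_left_mono) auto
      also have "\<dots> \<le> p_energy p (norm (?y A)) - p_energy p (norm (?x A))"
        using p_energy_convex_in_square[OF p, of "norm (?x A)" "norm (?y A)"] by (simp add: k_def)
      finally have "\<beta> A * (k * (?x A \<bullet> (?y A - ?x A))) \<le> \<beta> A * (p_energy p (norm (?y A)) - p_energy p (norm (?x A)))"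
        using elim lam by (intro mult_left_mono) auto
      moreover have "flux_at \<xi> A \<bullet> ?y A - flux_at \<xi> A \<bullet> ?x A = \<beta> A * (k * (?x A \<bullet> (?y A - ?x A)))"
        by (simp add: flux_at_def k_def[symmetric] inner_diff_right right_diff_distrib)
      ultimately show ?case by (simp add: right_diff_distrib)
    qed
    show "integrable M (\<lambda>A. \<beta> A * p_energy p (norm (?x A)) + (flux_at \<xi> A \<bullet> ?y A - flux_at \<xi> A \<bullet> ?x A))"
      using integrable_energy[OF f_competitor] flux_inner[OF g] flux_inner[OF f_competitor] by simp
  qed (rule integrable_energy[OF g])
  finally show ?thesis .
qed

text \<open>The tangent inequality for the homogenized energy as a function of \<open>|\<xi>|\<^sup>2\<close> along a ray. Let
  \<open>x = \<xi> + f \<xi>\<close> and \<open>y = l \<xi> + f (l \<xi>)\<close>. Convexity of the density in the square bounds the difference of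
  the energies of \<open>y\<close> and \<open>x\<close> from below by \<open>|y|\<^sup>2 - |x|\<^sup>2\<close> with half the weight \<open>\<beta> (1 + |x|\<^sup>p\<^sup>-\<^sup>2)\<close>, and
  \<open>|y|\<^sup>2 \<ge> l\<^sup>2 |x|\<^sup>2 + 2 l x \<bullet> (y - l x)\<close>. The last term integrates to zero against this weight,
  because the weighted \<open>x\<close> is the flux and \<open>y - l x\<close> is a competitor.\<close>

lemma min_energy_along_ray:
  "min_energy (l *\<^sub>R \<xi>) \<ge> min_energy \<xi> + (l\<^sup>2 - 1) / 2 * (mean_flux \<xi> \<bullet> \<xi>)"
proof -
  let ?x = "\<lambda>A. \<xi> + f \<xi> A" and ?y = "\<lambda>A. l *\<^sub>R \<xi> + f (l *\<^sub>R \<xi>) A"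
  \<comment> \<open>The multiple of \<open>flux \<bullet> x\<close> that arises from \<open>- |x|\<^sup>2\<close> and \<open>- l\<^sup>2 |x|\<^sup>2\<close>, halved.\<close>
  define c where "c = - (l\<^sup>2 + 1) / 2"
  note i = integrable_energy[OF f_competitor] flux_inner[OF f_competitor]
  have "min_energy \<xi> + (l\<^sup>2 - 1) / 2 * (mean_flux \<xi> \<bullet> \<xi>)
    = (LINT A|M. \<beta> A * p_energy p (norm (?x A)) + (c * (flux_at \<xi> A \<bullet> ?x A) + l * (flux_at \<xi> A \<bullet> ?y A)))"
  proof -
    have "(LINT A|M. \<beta> A * p_energy p (norm (?x A)) + (c * (flux_at \<xi> A \<bullet> ?x A) + l * (flux_at \<xi> A \<bullet> ?y A)))
      = min_energy \<xi> + (c * (mean_flux \<xi> \<bullet> \<xi>) + l * (mean_flux \<xi> \<bullet> (l *\<^sub>R \<xi>)))"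
      using i by (simp add: min_energy_def energy_def del: inner_scaleR_right)
    then show ?thesis by (simp add: c_def field_simps power2_eq_square)
  qed
  also have "\<dots> \<le> min_energy (l *\<^sub>R \<xi>)"
    unfolding min_energy_def energy_def
  proof (rule integral_mono_AE)
    show "AE A in M. \<beta> A * p_energy p (norm (?x A)) + (c * (flux_at \<xi> A \<bullet> ?x A) + l * (flux_at \<xi> A \<bullet> ?y A))
      \<le> \<beta> A * p_energy p (norm (?y A))"
      using \<beta>_bounds
    proof eventually_elim
      case (elim A)
      define k where "k = 1 + rpow (norm (?x A)) (p - 2)"
      have k: "k \<ge> 0" by (simp add: k_def rpow_nonneg)
      have "0 \<le> (norm (?y A - l *\<^sub>R ?x A))\<^sup>2" by simp
      also have "\<dots> = (norm (?y A))\<^sup>2 - 2 * l * (?x A \<bullet> ?y A) + l\<^sup>2 * (norm (?x A))\<^sup>2"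
        by (rule norm_diff_scaleR_square)
      finally have "2 * l * (?x A \<bullet> ?y A) - (l\<^sup>2 + 1) * (norm (?x A))\<^sup>2 \<le> (norm (?y A))\<^sup>2 - (norm (?x A))\<^sup>2"
        unfolding distrib_right by linarith
      then have "k / 2 * (2 * l * (?x A \<bullet> ?y A) - (l\<^sup>2 + 1) * (norm (?x A))\<^sup>2)
          \<le> k / 2 * ((norm (?y A))\<^sup>2 - (norm (?x A))\<^sup>2)"
        using k by (intro mult_left_mono) auto
      also have "\<dots> \<le> p_energy p (norm (?y A)) - p_energy p (norm (?x A))"
        using p_energy_convex_in_square[OF p, of "norm (?x A)" "norm (?y A)"] by (simp add: k_def)
      finally have main: "\<beta> A * (k / 2 * (2 * l * (?x A \<bullet> ?y A) - (l\<^sup>2 + 1) * (norm (?x A))\<^sup>2))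
          \<le> \<beta> A * (p_energy p (norm (?y A)) - p_energy p (norm (?x A)))"
        using elim lam by (intro mult_left_mono) auto
      have split: "\<beta> A * (k / 2 * (2 * l * X - (l\<^sup>2 + 1) * N)) = c * (\<beta> A * (k * N)) + l * (\<beta> A * (k * X))" for X N
        by (simp add: c_def field_simps)
      have fx: "flux_at \<xi> A \<bullet> ?y A = \<beta> A * (k * (?x A \<bullet> ?y A))"
        "flux_at \<xi> A \<bullet> ?x A = \<beta> A * (k * (norm (?x A))\<^sup>2)"
        by (simp_all only: flux_at_def k_def[symmetric] power2_norm_eq_inner inner_scaleR_left)
      show ?case using main unfolding fx split right_diff_distrib[of "\<beta> A" "p_energy p (norm (?y A))"] by linarith
    qed
    show "integrable M (\<lambda>A. \<beta> A * p_energy p (norm (?x A)) + (c * (flux_at \<xi> A \<bullet> ?x A) + l * (flux_at \<xi> A \<bullet> ?y A)))"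
      using i by (intro Bochner_Integration.integrable_add integrable_mult_right) auto
  qed (rule i(1))
  finally show ?thesis .
qed

lemma flux_coercive: "lam * ((norm \<xi>)\<^sup>2 + norm \<xi> powr p) \<le> mean_flux \<xi> \<bullet> \<xi>"
proof -
  let ?x = "\<lambda>A. \<xi> + f \<xi> A"
  have xp: "integrable M (\<lambda>A. norm (?x A) powr p)" by (rule shifted_powr[OF f_competitor])
  have x2: "integrable M (\<lambda>A. norm (?x A) powr 2)"
    using integrable_square_of_powr[OF _ xp] by simp
  have fi: "integrable M (f \<xi>)" by (rule integrable_norm_powr_imp_integrable[OF f_measurable exponent_bounds(2) f_powr])
  have jensen: "norm \<xi> powr s \<le> (LINT A|M. norm (?x A) powr s)" if "s \<ge> 1" "integrable M (\<lambda>A. norm (?x A) powr s)" for s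
    using jensen_norm_powr[of s M "\<lambda>A. 1" ?x] that fi f_mean by (simp add: prob_space)
  have "lam * ((norm \<xi>)\<^sup>2 + norm \<xi> powr p) \<le> lam * ((LINT A|M. norm (?x A) powr 2) + (LINT A|M. norm (?x A) powr p))"
    using jensen[OF _ x2] jensen[OF exponent_bounds(2) xp] lam by (intro mult_left_mono add_mono) auto
  also have "\<dots> = (LINT A|M. lam * ((norm (?x A))\<^sup>2 + norm (?x A) powr p))"
    using x2 xp by simp
  also have "\<dots> \<le> (LINT A|M. flux_at \<xi> A \<bullet> ?x A)"
  proof (rule integral_mono_AE)
    show "integrable M (\<lambda>A. lam * ((norm (?x A))\<^sup>2 + norm (?x A) powr p))" using x2 xp by simp
    show "integrable M (\<lambda>A. flux_at \<xi> A \<bullet> ?x A)" by (rule flux_inner[OF f_competitor])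
    show "AE A in M. lam * ((norm (?x A))\<^sup>2 + norm (?x A) powr p) \<le> flux_at \<xi> A \<bullet> ?x A"
      using \<beta>_bounds
    proof eventually_elim
      case (elim A)
      have "flux_at \<xi> A \<bullet> ?x A = \<beta> A * ((1 + rpow (norm (?x A)) (p - 2)) * (norm (?x A))\<^sup>2)"
        by (simp add: flux_at_def power2_norm_eq_inner)
      also have "(1 + rpow (norm (?x A)) (p - 2)) * (norm (?x A))\<^sup>2 = (norm (?x A))\<^sup>2 + norm (?x A) powr p"
        using rpow_times_square[OF norm_ge_zero p] by (simp add: distrib_right)
      finally show ?case using elim by (simp add: mult_right_mono)
    qed
  qed
  also have "\<dots> = mean_flux \<xi> \<bullet> \<xi>" by (rule flux_inner[OF f_competitor])
  finally show ?thesis .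
qed

lemma mean_flux_zero: "mean_flux 0 = 0"
proof -
  have int: "integrable M (\<lambda>A. flux_at 0 A \<bullet> f 0 A)" and z: "(LINT A|M. flux_at 0 A \<bullet> f 0 A) = 0"
    using flux_orthogonal[OF f_competitor] by auto
  have pos: "AE A in M. lam * (norm (f 0 A))\<^sup>2 \<le> flux_at 0 A \<bullet> f 0 A"
    using \<beta>_bounds
  proof eventually_elim
    case (elim A)
    have "flux_at 0 A \<bullet> f 0 A = \<beta> A * ((1 + rpow (norm (f 0 A)) (p - 2)) * (norm (f 0 A))\<^sup>2)"
      by (simp add: flux_at_def power2_norm_eq_inner)
    moreover have "1 * (norm (f 0 A))\<^sup>2 \<le> (1 + rpow (norm (f 0 A)) (p - 2)) * (norm (f 0 A))\<^sup>2"
      by (intro mult_right_mono) (auto simp: rpow_nonneg)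
    ultimately show ?case using elim lam by (auto intro!: mult_mono)
  qed
  then have "AE A in M. 0 \<le> flux_at 0 A \<bullet> f 0 A"
    by eventually_elim (use lam in \<open>auto intro: order_trans[rotated]\<close>)
  with z int have "AE A in M. flux_at 0 A \<bullet> f 0 A = 0" by (simp add: integral_nonneg_eq_0_iff_AE)
  with pos have "AE A in M. flux_at 0 A = 0"
  proof eventually_elim
    case (elim A)
    then have "(norm (f 0 A))\<^sup>2 \<le> 0" using lam by (simp add: mult_le_0_iff)
    then show ?case by (simp add: flux_at_def)
  qed
  then have "mean_flux 0 = (LINT A|M. 0)" unfolding mean_flux_def by (intro integral_cong_AE) auto
  then show ?thesis by simp
qed

text \<open>If the homogenized energy is radial, its subgradient at \<open>\<xi>\<close> is a multiple \<open>\<psi> \<xi>\<close> of \<open>\<xi>\<close>: among all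
  vectors of length \<open>|\<xi>|\<close>, \<open>\<xi>\<close> maximizes the inner product with the subgradient. By the tangent
  inequality along rays the energy is a convex function of \<open>|\<xi>|\<^sup>2\<close> with slope \<open>\<psi> / 2\<close>, so \<open>\<psi>\<close> increases
  with \<open>|\<xi>|\<close>. The claim follows from the identity
  \<open>(\<psi>\<^sub>1 \<xi>\<^sub>1 - \<psi>\<^sub>2 \<xi>\<^sub>2) \<bullet> (\<xi>\<^sub>1 - \<xi>\<^sub>2) = (\<psi>\<^sub>1 + \<psi>\<^sub>2) |\<xi>\<^sub>1 - \<xi>\<^sub>2|\<^sup>2 / 2 + (\<psi>\<^sub>1 - \<psi>\<^sub>2) (|\<xi>\<^sub>1|\<^sup>2 - |\<xi>\<^sub>2|\<^sup>2) / 2\<close>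
  and coercivity, which bounds \<open>\<psi>\<close> from below. The rotational symmetry of the law enters only through
  the hypothesis, in the weak form that a competitor attains the energy.\<close>

theorem monotone_of_radial_energy:
  assumes radial: "\<And>\<xi> \<eta>. norm \<xi> = norm \<eta> \<Longrightarrow> \<exists>g. competitor g \<and> energy \<eta> g = min_energy \<xi>"
  shows "(mean_flux \<xi>\<^sub>1 - mean_flux \<xi>\<^sub>2) \<bullet> (\<xi>\<^sub>1 - \<xi>\<^sub>2) \<ge>
    lam / 2 * (2 + rpow (norm \<xi>\<^sub>1) (p - 2) + rpow (norm \<xi>\<^sub>2) (p - 2)) * (norm (\<xi>\<^sub>1 - \<xi>\<^sub>2))\<^sup>2"
proof -
  have le: "min_energy \<eta> \<le> min_energy \<xi>" if "norm \<xi> = norm \<eta>" for \<xi> \<eta>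
    using radial[OF that] energy_above_tangent[of _ \<eta> \<eta>] by force
  have eq: "min_energy \<eta> = min_energy \<xi>" if "norm \<xi> = norm \<eta>" for \<xi> \<eta>
    using le[OF that] le[OF that[symmetric]] by simp
  define \<rho> where "\<rho> \<xi> = lam * (1 + rpow (norm \<xi>) (p - 2))" for \<xi> :: 'v
  \<comment> \<open>The value at zero is the lower bound \<open>\<rho> 0\<close>, so that the monotonicity of \<open>\<psi>\<close> extends to zero.\<close>
  define \<psi> where "\<psi> \<xi> = (if \<xi> = 0 then \<rho> 0 else mean_flux \<xi> \<bullet> \<xi> / (norm \<xi>)\<^sup>2)" for \<xi>
  have parallel: "mean_flux \<xi> = \<psi> \<xi> *\<^sub>R \<xi>" for \<xi>
  proof (cases "\<xi> = 0")
    case True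
    then show ?thesis by (simp add: mean_flux_zero)
  next
    case False
    define v where "v = mean_flux \<xi>"
    have "v \<bullet> \<xi> > 0"
      using flux_coercive[of \<xi>] lam False
      by (auto simp: v_def intro!: less_le_trans[OF _ flux_coercive[of \<xi>]] mult_pos_pos add_pos_nonneg)
    then have v: "v \<noteq> 0" by auto
    \<comment> \<open>The vector of length \<open>|\<xi>|\<close> in the direction of the subgradient; equality in Cauchy-Schwarz follows.\<close>
    define \<eta> where "\<eta> = (norm \<xi> / norm v) *\<^sub>R v"
    have "norm \<xi> = norm \<eta>" using v by (simp add: \<eta>_def)
    from energy_above_tangent[OF f_competitor[of \<eta>], where \<eta> = \<eta> and \<xi> = \<xi>] eq[OF this] have "v \<bullet> (\<eta> - \<xi>) \<le> 0"
      by (simp add: min_energy_def v_def)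
    then have "v \<bullet> \<eta> \<le> v \<bullet> \<xi>" by (simp add: inner_diff_right)
    moreover have "v \<bullet> \<eta> = norm v * norm \<xi>"
      using v by (simp add: \<eta>_def power2_norm_eq_inner[symmetric] power2_eq_square)
    ultimately have "v \<bullet> \<xi> = norm v * norm \<xi>" using norm_cauchy_schwarz[of v \<xi>] by linarith
    then have *: "norm v *\<^sub>R \<xi> = norm \<xi> *\<^sub>R v" and vx: "v \<bullet> \<xi> = norm v * norm \<xi>"
      by (auto simp: norm_cauchy_schwarz_eq)
    have "\<psi> \<xi> = norm v / norm \<xi>" using False vx by (simp add: \<psi>_def v_def[symmetric] power2_eq_square)
    then have "\<psi> \<xi> *\<^sub>R \<xi> = (1 / norm \<xi>) *\<^sub>R (norm v *\<^sub>R \<xi>)" by simp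
    also have "\<dots> = v" unfolding * using False by simp
    finally show ?thesis by (simp add: v_def)
  qed
  have \<psi>_ge: "\<rho> \<xi> \<le> \<psi> \<xi>" for \<xi>
  proof (cases "\<xi> = 0")
    case False
    have "\<rho> \<xi> * (norm \<xi>)\<^sup>2 \<le> mean_flux \<xi> \<bullet> \<xi>"
      using flux_coercive[of \<xi>] rpow_times_square[OF norm_ge_zero p, of \<xi>] by (simp add: \<rho>_def algebra_simps)
    then show ?thesis using False by (simp add: \<psi>_def field_simps)
  qed (simp add: \<psi>_def)
  have \<psi>_ray: "min_energy \<eta> \<ge> min_energy \<xi> + ((norm \<eta>)\<^sup>2 - (norm \<xi>)\<^sup>2) / 2 * \<psi> \<xi>" if "\<xi> \<noteq> 0" for \<xi> \<eta>
  proof -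
    define l where "l = norm \<eta> / norm \<xi>"
    have "min_energy \<eta> = min_energy (l *\<^sub>R \<xi>)"
      using that by (intro eq) (simp add: l_def)
    also have "\<dots> \<ge> min_energy \<xi> + (l\<^sup>2 - 1) / 2 * (mean_flux \<xi> \<bullet> \<xi>)" by (rule min_energy_along_ray)
    also have "(l\<^sup>2 - 1) / 2 * (mean_flux \<xi> \<bullet> \<xi>) = ((norm \<eta>)\<^sup>2 - (norm \<xi>)\<^sup>2) / 2 * \<psi> \<xi>"
      using that by (simp add: l_def \<psi>_def power_divide field_simps)
    finally show ?thesis .
  qed
  have \<rho>_mono: "\<rho> 0 \<le> \<rho> \<xi>" for \<xi>
    using lam p by (auto simp: \<rho>_def intro!: rpow_mono)
  have mono: "0 \<le> (\<psi> \<xi>\<^sub>1 - \<psi> \<xi>\<^sub>2) * ((norm \<xi>\<^sub>1)\<^sup>2 - (norm \<xi>\<^sub>2)\<^sup>2)"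
  proof -
    consider "\<xi>\<^sub>1 = 0" | "\<xi>\<^sub>2 = 0" | "\<xi>\<^sub>1 \<noteq> 0" "\<xi>\<^sub>2 \<noteq> 0" by blast
    then show ?thesis
    proof cases
      case 1
      have "\<psi> \<xi>\<^sub>1 \<le> \<psi> \<xi>\<^sub>2" using order_trans[OF \<rho>_mono \<psi>_ge[of \<xi>\<^sub>2]] 1 by (simp add: \<psi>_def)
      then show ?thesis using 1 by (intro mult_nonpos_nonpos) auto
    next
      case 2
      have "\<psi> \<xi>\<^sub>2 \<le> \<psi> \<xi>\<^sub>1" using order_trans[OF \<rho>_mono \<psi>_ge[of \<xi>\<^sub>1]] 2 by (simp add: \<psi>_def)
      then show ?thesis using 2 by (intro mult_nonneg_nonneg) auto
    next
      case 3
      then show ?thesis using \<psi>_ray[of \<xi>\<^sub>1 \<xi>\<^sub>2] \<psi>_ray[of \<xi>\<^sub>2 \<xi>\<^sub>1] by (simp add: field_simps)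
    qed
  qed
  define d where "d = (norm (\<xi>\<^sub>1 - \<xi>\<^sub>2))\<^sup>2"
  have "(mean_flux \<xi>\<^sub>1 - mean_flux \<xi>\<^sub>2) \<bullet> (\<xi>\<^sub>1 - \<xi>\<^sub>2)
    = (\<psi> \<xi>\<^sub>1 + \<psi> \<xi>\<^sub>2) / 2 * d + (\<psi> \<xi>\<^sub>1 - \<psi> \<xi>\<^sub>2) * ((norm \<xi>\<^sub>1)\<^sup>2 - (norm \<xi>\<^sub>2)\<^sup>2) / 2"
    unfolding d_def parallel[of \<xi>\<^sub>1] parallel[of \<xi>\<^sub>2] power2_norm_eq_inner
    by (simp add: inner_diff_left inner_diff_right inner_commute[of \<xi>\<^sub>2 \<xi>\<^sub>1] field_simps)
  also have "\<dots> \<ge> (\<psi> \<xi>\<^sub>1 + \<psi> \<xi>\<^sub>2) / 2 * d" using mono by simp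
  also have "(\<psi> \<xi>\<^sub>1 + \<psi> \<xi>\<^sub>2) / 2 * d \<ge> (\<rho> \<xi>\<^sub>1 + \<rho> \<xi>\<^sub>2) / 2 * d"
    using \<psi>_ge[of \<xi>\<^sub>1] \<psi>_ge[of \<xi>\<^sub>2] by (intro mult_right_mono) (auto simp: d_def)
  also have "(\<rho> \<xi>\<^sub>1 + \<rho> \<xi>\<^sub>2) / 2 * d = lam / 2 * (2 + rpow (norm \<xi>\<^sub>1) (p - 2) + rpow (norm \<xi>\<^sub>2) (p - 2)) * d"
    by (simp add: \<rho>_def algebra_simps)
  finally show ?thesis by (simp add: d_def)
qed

end

section \<open>Isometries, smooth pullbacks and joint measurability\<close>

lemma nn_integral_lborel_shift:
  fixes g :: "'v::euclidean_space \<Rightarrow> ennreal"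
  assumes "g \<in> borel_measurable borel"
  shows "(\<integral>\<^sup>+x. g (x + a) \<partial>lborel) = (\<integral>\<^sup>+x. g x \<partial>lborel)"
proof -
  have "(\<integral>\<^sup>+x. g x \<partial>lborel) = (\<integral>\<^sup>+x. g x \<partial>distr lborel borel ((+) a))" by (simp only: lborel_distr_plus)
  also have "\<dots> = (\<integral>\<^sup>+x. g (a + x) \<partial>lborel)" using assms by (subst nn_integral_distr) auto
  finally show ?thesis by (simp add: add.commute)
qed

text \<open>A translation invariant measure is a multiple of Lebesgue measure. The classical proof multiplies
  the measure of \<open>E\<close> by that of the unit ball and exchanges the two by invariance; the isometry
  preserves the ball, so the factor is one.\<close>

lemma lborel_distr_isometry:
  fixes S S' :: "'v::euclidean_space \<Rightarrow> 'v"
  assumes lin: "linear S" and inv: "\<And>x. S (S' x) = x" and norm: "\<And>x. norm (S x) = norm x"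
  shows "distr lborel borel S = lborel"
proof (rule measure_eqI)
  have [measurable]: "S \<in> borel_measurable borel"
    by (intro borel_measurable_continuous_onI linear_continuous_on linear_conv_bounded_linear[THEN iffD1] lin)
  fix E assume "E \<in> sets (distr lborel borel S)"
  then have [measurable]: "E \<in> sets borel" by simp
  define h :: "'v \<Rightarrow> ennreal" where "h = indicator (ball 0 1)"
  define V where "V = (\<integral>\<^sup>+x. h x \<partial>(lborel :: 'v measure))"
  have [measurable]: "h \<in> borel_measurable borel" unfolding h_def by (intro borel_measurable_indicator) simp
  have V: "V \<noteq> 0" "V \<noteq> \<infinity>"
  proof -
    have V_eq: "V = emeasure lborel (ball (0::'v) 1)" by (simp add: V_def h_def)
    show "V \<noteq> \<infinity>" using emeasure_lborel_ball_finite[of "0::'v" 1] by (simp add: V_eq)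
    show "V \<noteq> 0" using content_ball_pos[of 1 "0::'v"] by (auto simp: V_eq measure_def)
  qed
  have "emeasure (distr lborel borel S) E = (\<integral>\<^sup>+z. indicator E z \<partial>distr lborel borel S)" by simp
  also have "\<dots> = (\<integral>\<^sup>+y. indicator E (S y) \<partial>lborel)" by (rule nn_integral_distr) measurable
  finally have "emeasure (distr lborel borel S) E * V = (\<integral>\<^sup>+y. indicator E (S y) \<partial>lborel) * V" by simp
  also have "\<dots> = (\<integral>\<^sup>+y. indicator E (S y) * V \<partial>lborel)"
    by (rule nn_integral_multc[symmetric]) measurable
  also have "\<dots> = (\<integral>\<^sup>+y. (\<integral>\<^sup>+x. indicator E (S y) * h (x - S y) \<partial>lborel) \<partial>lborel)"
  proof (rule nn_integral_cong)
    fix y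
    have "V = (\<integral>\<^sup>+x. h (x - S y) \<partial>lborel)"
      using nn_integral_lborel_shift[of h "- S y"] by (simp add: V_def)
    then show "indicator E (S y) * V = (\<integral>\<^sup>+x. indicator E (S y) * h (x - S y) \<partial>lborel)"
      by (simp add: nn_integral_cmult)
  qed
  also have "\<dots> = (\<integral>\<^sup>+x. (\<integral>\<^sup>+y. indicator E (S y) * h (x - S y) \<partial>lborel) \<partial>lborel)"
    by (rule lborel_pair.Fubini') measurable
  also have "\<dots> = (\<integral>\<^sup>+x. (\<integral>\<^sup>+y. indicator E (S y + x) * h (- S y) \<partial>lborel) \<partial>lborel)"
  proof (rule nn_integral_cong)
    fix x
    have "(\<integral>\<^sup>+y. indicator E (S (y + S' x)) * h (x - S (y + S' x)) \<partial>lborel)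
      = (\<integral>\<^sup>+y. indicator E (S y) * h (x - S y) \<partial>lborel)"
      by (rule nn_integral_lborel_shift) measurable
    then show "(\<integral>\<^sup>+y. indicator E (S y) * h (x - S y) \<partial>lborel)
      = (\<integral>\<^sup>+y. indicator E (S y + x) * h (- S y) \<partial>lborel)"
      by (simp add: linear_add[OF lin] inv)
  qed
  also have "\<dots> = (\<integral>\<^sup>+y. (\<integral>\<^sup>+x. indicator E (S y + x) * h (- S y) \<partial>lborel) \<partial>lborel)"
    by (rule lborel_pair.Fubini') measurable
  also have "\<dots> = (\<integral>\<^sup>+y. emeasure lborel E * h y \<partial>lborel)"
  proof (rule nn_integral_cong)
    fix y
    have e1: "(\<integral>\<^sup>+x. indicator E (S y + x) * h (- S y) \<partial>lborel) = (\<integral>\<^sup>+x. indicator E (x + S y) \<partial>lborel) * h (- S y)"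
      by (subst nn_integral_multc[symmetric]) (auto simp: add.commute)
    have e2: "(\<integral>\<^sup>+x. indicator E (x + S y) \<partial>lborel) = emeasure lborel E"
      using nn_integral_lborel_shift[of "indicator E" "S y"] by simp
    have "h (- S y) = h y" by (simp add: h_def indicator_def norm)
    with e1 e2 show "(\<integral>\<^sup>+x. indicator E (S y + x) * h (- S y) \<partial>lborel) = emeasure lborel E * h y"
      by metis
  qed
  also have "\<dots> = emeasure lborel E * V" unfolding V_def by (rule nn_integral_cmult) measurable
  finally show "emeasure (distr lborel borel S) E = emeasure lborel E"
    using V by (metis ennreal_mult_divide_eq infinity_ennreal_def)
qed simp

lemma smooth_differentiable:
  assumes "smooth f" "vs \<in> lists Basis"
  shows "(iter_deriv vs f has_derivative frechet_derivative (iter_deriv vs f) (at x)) (at x)"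
  using assms by (simp add: smooth_def frechet_derivative_works[symmetric])

lemma smooth_continuous:
  assumes "smooth f"
  shows "continuous_on S f"
proof -
  have "f differentiable (at x)" for x
    using assms[unfolded smooth_def, rule_format, of "[]" x] by (simp add: iter_deriv_def)
  then show ?thesis
    by (intro continuous_at_imp_continuous_on ballI differentiable_imp_continuous_within)
qed

text \<open>Derivatives of \<open>f (S x + a)\<close> are combinations of derivatives of \<open>f\<close> at \<open>S x + a\<close>. The set of such
  combinations is closed under directional derivatives, which proves smoothness of the pullback
  without a formula for its higher derivatives.\<close>

inductive_set pullback_derivs :: "('a::euclidean_space \<Rightarrow> 'b::real_normed_vector) \<Rightarrow> ('a \<Rightarrow> 'a) \<Rightarrow> 'a \<Rightarrow> ('a \<Rightarrow> 'b) set"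
  for f S a where
  base: "vs \<in> lists Basis \<Longrightarrow> (\<lambda>x. iter_deriv vs f (S x + a)) \<in> pullback_derivs f S a"
| zero: "(\<lambda>x. 0) \<in> pullback_derivs f S a"
| add_scaled: "g \<in> pullback_derivs f S a \<Longrightarrow> h \<in> pullback_derivs f S a \<Longrightarrow>
    (\<lambda>x. c *\<^sub>R g x + h x) \<in> pullback_derivs f S a"

lemma pullback_derivs_sum:
  assumes "finite B" "\<And>b. b \<in> B \<Longrightarrow> g b \<in> pullback_derivs f S a"
  shows "(\<lambda>x. \<Sum>b\<in>B. c b *\<^sub>R g b x) \<in> pullback_derivs f S a"
  using assms by (induction B rule: finite_induct) (auto intro: pullback_derivs.intros)

lemma pullback_derivs_derivative:
  fixes f :: "'a::euclidean_space \<Rightarrow> 'b::real_normed_vector"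
  assumes f: "smooth f" and lin: "linear S" and "g \<in> pullback_derivs f S a"
  shows "\<exists>D. (\<forall>v. D v \<in> pullback_derivs f S a) \<and> (\<forall>x. (g has_derivative (\<lambda>v. D v x)) (at x))"
  using assms(3)
proof induction
  case (base vs)
  define D where "D v x = (\<Sum>b\<in>Basis. (S v \<bullet> b) *\<^sub>R iter_deriv (b # vs) f (S x + a))" for v x
  show ?case
  proof (intro exI[of _ D] conjI allI)
    show "D v \<in> pullback_derivs f S a" for v
      unfolding D_def using base by (intro pullback_derivs_sum pullback_derivs.base) auto
    fix x
    have S: "(S has_derivative S) (at x)" using lin by (simp add: linear_imp_has_derivative)
    have "((\<lambda>x. S x + a) has_derivative S) (at x)" by (rule has_derivative_add_const[OF S])
    from has_derivative_compose[OF this smooth_differentiable[OF f base]]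
    have "((\<lambda>x. iter_deriv vs f (S x + a)) has_derivative
      (\<lambda>v. frechet_derivative (iter_deriv vs f) (at (S x + a)) (S v))) (at x)" .
    moreover have "frechet_derivative (iter_deriv vs f) (at (S x + a)) (S v) = D v x" for v
    proof -
      have l: "linear (frechet_derivative (iter_deriv vs f) (at (S x + a)))"
        using smooth_differentiable[OF f base] by (rule has_derivative_linear)
      have "frechet_derivative (iter_deriv vs f) (at (S x + a)) (S v)
        = frechet_derivative (iter_deriv vs f) (at (S x + a)) (\<Sum>b\<in>Basis. (S v \<bullet> b) *\<^sub>R b)"
        by (simp add: euclidean_representation)
      also have "\<dots> = (\<Sum>b\<in>Basis. (S v \<bullet> b) *\<^sub>R frechet_derivative (iter_deriv vs f) (at (S x + a)) b)"
        by (simp add: linear_sum[OF l] linear_scale[OF l])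
      also have "\<dots> = D v x"
        by (simp add: D_def iter_deriv_def dir_deriv_def)
      finally show ?thesis .
    qed
    ultimately show "((\<lambda>x. iter_deriv vs f (S x + a)) has_derivative (\<lambda>v. D v x)) (at x)" by simp
  qed
next
  case zero
  show ?case by (rule exI[of _ "\<lambda>v x. 0"]) (auto intro: pullback_derivs.zero)
next
  case (add_scaled g h c)
  then obtain D E where "\<forall>v. D v \<in> pullback_derivs f S a" "\<forall>x. (g has_derivative (\<lambda>v. D v x)) (at x)"
    "\<forall>v. E v \<in> pullback_derivs f S a" "\<forall>x. (h has_derivative (\<lambda>v. E v x)) (at x)" by blast
  then show ?case
    by (intro exI[of _ "\<lambda>v x. c *\<^sub>R D v x + E v x"])
      (auto intro!: pullback_derivs.add_scaled has_derivative_add has_derivative_scaleR_right)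
qed

lemma smooth_affine_pullback:
  fixes f :: "'a::euclidean_space \<Rightarrow> 'b::real_normed_vector" and S :: "'a \<Rightarrow> 'a"
  assumes f: "smooth f" and lin: "linear S"
  shows "smooth (\<lambda>x. f (S x + a))"
proof -
  have *: "iter_deriv us (\<lambda>x. f (S x + a)) \<in> pullback_derivs f S a" for us
  proof (induction us)
    case Nil
    show ?case using pullback_derivs.base[of "[]" f S a] by (simp add: iter_deriv_def)
  next
    case (Cons v us)
    obtain D where D: "\<forall>v. D v \<in> pullback_derivs f S a"
      "\<forall>x. (iter_deriv us (\<lambda>x. f (S x + a)) has_derivative (\<lambda>v. D v x)) (at x)"
      using pullback_derivs_derivative[OF f lin Cons] by blast
    have "iter_deriv (v # us) (\<lambda>x. f (S x + a)) x = D v x" for x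
      using dir_deriv_eqI[OF D(2)[rule_format]] by (simp add: iter_deriv_def)
    then have "iter_deriv (v # us) (\<lambda>x. f (S x + a)) = D v" by (rule ext)
    with D(1) show ?case by simp
  qed
  have "iter_deriv us (\<lambda>x. f (S x + a)) differentiable (at x)" for us x
    using pullback_derivs_derivative[OF f lin *[of us]] unfolding differentiable_def by blast
  then show ?thesis by (simp add: smooth_def)
qed

lemma smooth_shift: "smooth f \<Longrightarrow> smooth (shift z f)"
  using smooth_affine_pullback[of f "\<lambda>x. x" z] by (simp add: shift_def[abs_def] linear_ident[unfolded id_def])

text \<open>A field that is continuous in space is the limit of its values at the points of finer and finer
  lattices.\<close>

lemma evaluation_jointly_measurable:
  fixes \<Psi> :: "'w \<Rightarrow> real^'d \<Rightarrow> 'b::{metric_space, second_countable_topology}"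
  assumes meas: "\<And>x. (\<lambda>A. \<Psi> A x) \<in> borel_measurable M"
    and cont: "\<And>A. A \<in> space M \<Longrightarrow> continuous_on UNIV (\<Psi> A)"
  shows "(\<lambda>(A, x). \<Psi> A x) \<in> borel_measurable (M \<Otimes>\<^sub>M lborel)"
proof -
  define k where "k n x = (\<lambda>i. \<lfloor>real (Suc n) * x $ i\<rfloor>)" for n and x :: "real^'d"
  define F where "F n j = ((\<chi> i. of_int (j i) / real (Suc n)) :: real^'d)" for n and j :: "'d \<Rightarrow> int"
  have k_meas: "k n \<in> borel \<rightarrow>\<^sub>M count_space UNIV" for n
  proof (subst measurable_count_space_eq2_countable, intro conjI ballI)
    fix j :: "'d \<Rightarrow> int"
    have "k n -` {j} \<inter> space borel = (\<Inter>i. {x. \<lfloor>real (Suc n) * x $ i\<rfloor> = j i})"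
      by (auto simp: k_def fun_eq_iff)
    also have "\<dots> \<in> sets borel"
      by (intro sets.countable_INT') (auto intro!: measurable_sets_borel)
    finally show "k n -` {j} \<inter> space borel \<in> sets borel" .
  qed simp
  have lim: "(\<lambda>n. F n (k n x)) \<longlonglongrightarrow> x" for x :: "real^'d"
  proof (rule vec_tendstoI)
    fix i
    have "(\<lambda>n. x $ i - F n (k n x) $ i) \<longlonglongrightarrow> 0"
    proof (rule tendsto_sandwich[OF _ _ tendsto_const LIMSEQ_inverse_real_of_nat])
      have *: "0 \<le> x $ i - F n (k n x) $ i \<and> x $ i - F n (k n x) $ i \<le> inverse (real (Suc n))" for n
      proof -
        let ?m = "real (Suc n)" and ?l = "of_int \<lfloor>real (Suc n) * x $ i\<rfloor> :: real"
        have m: "?m > 0" by simp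
        have l: "?l \<le> ?m * x $ i" "?m * x $ i - ?l \<le> 1" by linarith+
        have "x $ i - F n (k n x) $ i = (?m * x $ i - ?l) / ?m"
          unfolding F_def k_def vec_lambda_beta diff_divide_distrib using m by (simp del: of_nat_Suc)
        moreover have "(?m * x $ i - ?l) / ?m \<le> 1 / ?m" using l m by (intro divide_right_mono) auto
        moreover have "0 \<le> (?m * x $ i - ?l) / ?m" using l m by (intro divide_nonneg_pos) auto
        ultimately show ?thesis by (simp add: inverse_eq_divide del: of_nat_Suc)
      qed
      show "\<forall>\<^sub>F n in sequentially. 0 \<le> x $ i - F n (k n x) $ i"
        "\<forall>\<^sub>F n in sequentially. x $ i - F n (k n x) $ i \<le> inverse (real (Suc n))"
        using * by (auto intro!: always_eventually)
    qed
    from tendsto_diff[OF tendsto_const this, of "x $ i"] show "(\<lambda>n. F n (k n x) $ i) \<longlonglongrightarrow> x $ i" by simp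
  qed
  show ?thesis
  proof (rule borel_measurable_LIMSEQ_metric)
    fix n
    have "(\<lambda>z. \<Psi> (fst z) (F n (k n (snd z)))) \<in> borel_measurable (M \<Otimes>\<^sub>M lborel)"
    proof (rule measurable_compose_countable[where g = "\<lambda>z. k n (snd z)"])
      show "(\<lambda>z. \<Psi> (fst z) (F n j)) \<in> borel_measurable (M \<Otimes>\<^sub>M lborel)" for j
        using measurable_compose[OF measurable_fst meas] .
      show "(\<lambda>z. k n (snd z)) \<in> M \<Otimes>\<^sub>M lborel \<rightarrow>\<^sub>M count_space UNIV"
        by (rule measurable_compose[OF _ k_meas]) measurable
    qed
    then show "(\<lambda>(A, x). \<Psi> A (F n (k n x))) \<in> borel_measurable (M \<Otimes>\<^sub>M lborel)" by (simp add: case_prod_beta')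
  next
    fix z :: "'w \<times> (real^'d)" assume "z \<in> space (M \<Otimes>\<^sub>M lborel)"
    then have "fst z \<in> space M" by (auto simp: space_pair_measure)
    from cont[OF this] have "isCont (\<Psi> (fst z)) (snd z)" by (simp add: continuous_on_eq_continuous_at)
    from isCont_tendsto_compose[OF this lim] show "(\<lambda>n. case z of (A, x) \<Rightarrow> \<Psi> A (F n (k n x))) \<longlonglongrightarrow> (case z of (A, x) \<Rightarrow> \<Psi> A x)"
      by (simp add: case_prod_beta')
  qed
qed

section \<open>Weak gradients and precise representatives\<close>

lemma loc_integrable_measurable:
  fixes f :: "'a::euclidean_space \<Rightarrow> 'b::euclidean_space"
  assumes "loc_integrable f"
  shows "f \<in> borel_measurable borel"
proof (rule borel_measurable_LIMSEQ_metric)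
  fix n :: nat
  have "set_integrable lborel (cball 0 (real n)) f" using assms by (simp add: loc_integrable_def)
  then have "(\<lambda>x. indicator (cball 0 (real n)) x *\<^sub>R f x) \<in> borel_measurable lborel"
    unfolding set_integrable_def by (rule borel_measurable_integrable)
  then show "(\<lambda>x. indicator (cball 0 (real n)) x *\<^sub>R f x) \<in> borel_measurable borel"
    by simp
next
  fix x :: 'a
  obtain N :: nat where N: "norm x \<le> real N" using real_arch_simple by blast
  show "(\<lambda>n. indicator (cball 0 (real n)) x *\<^sub>R f x) \<longlonglongrightarrow> f x"
  proof (rule tendsto_eventually, rule eventually_sequentiallyI)
    fix n assume "N \<le> n"
    then have "norm x \<le> real n" using N by (simp add: order_trans)
    then show "indicator (cball 0 (real n)) x *\<^sub>R f x = f x" by simp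
  qed
qed

lemma loc_integrable_dominated:
  fixes u :: "'a::euclidean_space \<Rightarrow> 'b::euclidean_space" and g :: "'a \<Rightarrow> 'c::euclidean_space"
  assumes u: "loc_integrable u" and g: "g \<in> borel_measurable borel"
    and bound: "\<And>x. norm (g x) \<le> norm (u x) * (C * indicator (cball 0 r) x)"
  shows "integrable lborel g"
proof -
  have "set_integrable lborel (cball 0 r) u" using u by (simp add: loc_integrable_def)
  then have i: "integrable lborel (\<lambda>x. C *\<^sub>R (indicator (cball 0 r) x *\<^sub>R u x))"
    unfolding set_integrable_def by (rule integrable_scaleR_right)
  show ?thesis
  proof (rule Bochner_Integration.integrable_bound[OF i])
    show "AE x in lborel. norm (g x) \<le> norm (C *\<^sub>R (indicator (cball 0 r) x *\<^sub>R u x))"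
    proof (intro AE_I2)
      fix x
      have "norm (g x) \<le> C * (indicator (cball 0 r) x * norm (u x))"
        using bound[of x] by (simp add: mult_ac)
      also have "\<dots> \<le> \<bar>C\<bar> * (indicator (cball 0 r) x * norm (u x))"
        by (intro mult_right_mono) auto
      finally show "norm (g x) \<le> norm (C *\<^sub>R (indicator (cball 0 r) x *\<^sub>R u x))"
        by (simp add: abs_mult mult.assoc)
    qed
  qed (use g in simp)
qed

text \<open>The second derivative of the bump, applied to \<open>v\<close>.\<close>

definition bump_hessian :: "real \<Rightarrow> real \<Rightarrow> 'a::euclidean_space \<Rightarrow> 'a \<Rightarrow> 'a" where
  "bump_hessian s r x v =
    (- 2 * s * flat_exp 2 (s * (r\<^sup>2 - x \<bullet> x))) *\<^sub>R v +
    (4 * s\<^sup>2 * (flat_exp 4 (s * (r\<^sup>2 - x \<bullet> x)) - 2 * flat_exp 3 (s * (r\<^sup>2 - x \<bullet> x))) * (x \<bullet> v)) *\<^sub>R x"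

lemma bump_hessian_symmetric: "bump_hessian s r x v \<bullet> w = bump_hessian s r x w \<bullet> v"
  unfolding bump_hessian_def inner_add_left inner_scaleR_left by (simp add: inner_commute)

lemma bump_grad_has_bump_hessian:
  "((\<lambda>x. bump_grad s r x \<bullet> v) has_derivative (\<lambda>h. bump_hessian s r x v \<bullet> h)) (at x)"
proof -
  define a where "a x = - 2 * s * flat_exp 2 (s * (r\<^sup>2 - x \<bullet> x))" for x :: 'a
  define a' where "a' = 4 * s\<^sup>2 * (flat_exp 4 (s * (r\<^sup>2 - x \<bullet> x)) - 2 * flat_exp 3 (s * (r\<^sup>2 - x \<bullet> x)))"
  have a: "(a has_derivative (\<lambda>v. a' * (x \<bullet> v))) (at x)"
    unfolding a_def[abs_def]
    by (rule derivative_eq_intros bump_has_derivative refl)+ (simp add: a'_def fun_eq_iff power2_eq_square)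
  have h: "bump_hessian s r x v = a x *\<^sub>R v + (a' * (x \<bullet> v)) *\<^sub>R x"
    by (simp add: bump_hessian_def a_def a'_def)
  show ?thesis
    unfolding bump_grad_def inner_scaleR_left a_def[symmetric] h
    by (rule derivative_eq_intros a refl)+ (simp add: fun_eq_iff inner_add_left inner_add_right inner_commute mult_ac)
qed

lemma grad_bump_grad: "grad (\<lambda>x. bump_grad s r x \<bullet> v) x = bump_hessian s r x v"
  unfolding grad_def
  by (simp add: dir_deriv_eqI[OF bump_grad_has_bump_hessian] inner_axis vec_eq_iff)

lemma bump_hessian_bounded:
  fixes v :: "'a::euclidean_space"
  assumes "s > 0" "r > 0"
  obtains C where "\<And>x. norm (bump_hessian s r x v) \<le> C * indicator (cball 0 r) x"
    and "(\<lambda>x. bump_hessian s r x v) \<in> borel_measurable borel"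
proof -
  have fc: "continuous_on UNIV (\<lambda>x::'a. flat_exp k (s * (r\<^sup>2 - x \<bullet> x)))" for k
    by (rule continuous_on_compose2[of UNIV "flat_exp k"])
      (auto intro!: continuous_intros continuous_at_imp_continuous_on flat_exp_continuous)
  have c: "continuous_on UNIV (\<lambda>x. bump_hessian s r x v)"
    unfolding bump_hessian_def by (intro continuous_intros fc)
  have "compact ((\<lambda>x. bump_hessian s r x v) ` cball 0 r)"
    by (intro compact_continuous_image continuous_on_subset[OF c] compact_cball) auto
  then obtain C where C: "\<forall>y \<in> (\<lambda>x. bump_hessian s r x v) ` cball 0 r. norm y \<le> C"
    by (metis compact_imp_bounded bounded_iff)
  have "norm (bump_hessian s r x v) \<le> C * indicator (cball 0 r) x" for x
    using C assms by (auto simp: indicator_def bump_hessian_def flat_exp_outside)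
  then show ?thesis using c by (intro that[of C] borel_measurable_continuous_onI)
qed

text \<open>The weak gradient is tested with a component of the gradient of a bump; the curl vanishes because
  the second derivative of the bump is symmetric.\<close>

lemma weak_gradient_curl_free:
  fixes u :: "real^'d \<Rightarrow> real" and H :: "real^'d \<Rightarrow> real^'d"
  assumes w: "weak_gradient u H" and s: "s > 0" and r: "r > 0"
  shows "(LINT x|lborel. (H x \<bullet> v) * (bump_grad s r x \<bullet> w)) = (LINT x|lborel. (H x \<bullet> w) * (bump_grad s r x \<bullet> v))"
proof -
  have u: "loc_integrable u" and H: "loc_integrable H" using w by (auto simp: weak_gradient_def)
  note [measurable] = loc_integrable_measurable[OF u] loc_integrable_measurable[OF H]
  have key: "(LINT x|lborel. (H x \<bullet> v) * (bump_grad s r x \<bullet> w)) = - (LINT x|lborel. u x * (bump_hessian s r x w \<bullet> v))" for v w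
  proof -
    obtain B where B: "B > 0" "\<And>x::real^'d. norm (bump_grad s r x) \<le> B * indicator (cball 0 r) x"
      using bump_grad_bounded[OF s r] by blast
    obtain C where C: "\<And>x. norm (bump_hessian s r x w) \<le> C * indicator (cball 0 r) x"
      and [measurable]: "(\<lambda>x. bump_hessian s r x w) \<in> borel_measurable borel"
      using bump_hessian_bounded[OF s r] by blast
    have i1: "integrable lborel (\<lambda>x. u x *\<^sub>R bump_hessian s r x w)"
    proof (rule loc_integrable_dominated[OF u])
      show "norm (u x *\<^sub>R bump_hessian s r x w) \<le> norm (u x) * (C * indicator (cball 0 r) x)" for x
        using C[of x] by (auto intro: mult_left_mono)
    qed measurable
    have i2: "integrable lborel (\<lambda>x. (bump_grad s r x \<bullet> w) *\<^sub>R H x)"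
    proof (rule loc_integrable_dominated[OF H])
      fix x
      have "\<bar>bump_grad s r x \<bullet> w\<bar> \<le> B * indicator (cball 0 r) x * norm w"
        by (rule order_trans[OF Cauchy_Schwarz_ineq2]) (intro mult_right_mono B norm_ge_zero)
      then have "norm (H x) * \<bar>bump_grad s r x \<bullet> w\<bar> \<le> norm (H x) * (B * indicator (cball 0 r) x * norm w)"
        by (intro mult_left_mono) auto
      then show "norm ((bump_grad s r x \<bullet> w) *\<^sub>R H x) \<le> norm (H x) * (B * norm w * indicator (cball 0 r) x)"
        by (simp add: mult_ac)
    qed measurable
    have "(LINT x|lborel. u x *\<^sub>R bump_hessian s r x w) = - (LINT x|lborel. (bump_grad s r x \<bullet> w) *\<^sub>R H x)"
      using w test_fun_bump_grad[OF s r, of w] unfolding weak_gradient_def by (auto simp: grad_bump_grad[symmetric])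
    then have "(LINT x|lborel. u x *\<^sub>R bump_hessian s r x w) \<bullet> v = - ((LINT x|lborel. (bump_grad s r x \<bullet> w) *\<^sub>R H x) \<bullet> v)"
      by simp
    then show ?thesis
      using integral_inner_left[of v lborel "\<lambda>x. u x *\<^sub>R bump_hessian s r x w"] i1
        integral_inner_left[of v lborel "\<lambda>x. (bump_grad s r x \<bullet> w) *\<^sub>R H x"] i2
      by (simp add: mult.commute)
  qed
  show ?thesis unfolding key by (simp add: bump_hessian_symmetric[of s r _ v w])
qed

lemma precise_rep_eqI:
  assumes "(ball_avg f x \<longlongrightarrow> l) (at_right 0)"
  shows "precise_rep f x = l"
  using assms tendsto_Lim[OF _ assms] by (auto simp: precise_rep_def)

text \<open>Since a precise representative is determined by ball averages alone, its value at a point does not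
  see which representative of the weak gradient was selected. This makes the value at the origin
  compatible with shifts.\<close>

lemma precise_rep_cong: "ball_avg f x = ball_avg g y \<Longrightarrow> precise_rep f x = precise_rep g y"
  by (simp add: precise_rep_def)

lemma ball_avg_cong_AE:
  assumes [measurable]: "f \<in> borel_measurable borel" "g \<in> borel_measurable borel" and "AE x in lborel. f x = g x"
  shows "ball_avg f z = ball_avg g z"
proof
  fix r
  have [measurable]: "ball z r \<in> sets borel" by simp
  have "(LINT y:ball z r|lborel. f y) = (LINT y:ball z r|lborel. g y)"
    unfolding set_lebesgue_integral_def
    by (rule integral_cong_AE) (use assms(3) in \<open>auto elim: eventually_mono\<close>)
  then show "ball_avg f z r = ball_avg g z r" by (simp add: ball_avg_def)
qed

lemma ball_avg_shift:
  assumes [measurable]: "f \<in> borel_measurable borel"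
  shows "ball_avg (\<lambda>x. f (x + z)) 0 = ball_avg f z"
proof
  fix r
  have [measurable]: "ball z r \<in> sets borel" by simp
  have "(LINT y|lborel. indicator (ball 0 r) y *\<^sub>R f (y + z)) = (LINT y|lborel. (\<lambda>y. indicator (ball z r) y *\<^sub>R f y) (y + z))"
    by (intro Bochner_Integration.integral_cong) (auto simp: indicator_def dist_norm)
  also have "\<dots> = (LINT y|lborel. indicator (ball z r) y *\<^sub>R f y)"
    by (rule lborel_shift) measurable
  finally have "(LINT y:ball 0 r|lborel. f (y + z)) = (LINT y:ball z r|lborel. f y)"
    by (simp add: set_lebesgue_integral_def)
  moreover have "measure lborel (ball (0::'a) r) = measure lborel (ball z r)"
  proof (cases "r > 0")
    case True
    then show ?thesis using content_ball_conv_unit_ball[of r z] content_ball_conv_unit_ball[of r "0::'a"] by simp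
  next
    case False
    then have "ball (0::'a) r = {}" "ball z r = {}" by auto
    then show ?thesis by (simp only:)
  qed
  ultimately show "ball_avg (\<lambda>x. f (x + z)) 0 r = ball_avg f z r" by (simp add: ball_avg_def)
qed

lemma wgrad_representative:
  assumes "W1p_loc p u"
  obtains H where "weak_gradient u H" "wgrad u = precise_rep H" "AE x in lborel. wgrad u x = H x"
proof -
  define H where "H = (SOME G. weak_gradient u G)"
  have H: "weak_gradient u H"
    unfolding H_def using assms someI_ex[of "weak_gradient u"] by (auto simp: W1p_loc_def)
  then have "AE x in lborel. (ball_avg H x \<longlongrightarrow> H x) (at_right 0)"
    by (intro lebesgue_differentiation) (simp add: weak_gradient_def)
  then have "AE x in lborel. wgrad u x = H x"
    by eventually_elim (simp add: wgrad_def H_def[symmetric] precise_rep_eqI)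
  then show ?thesis using H by (intro that[of H]) (auto simp: wgrad_def H_def)
qed

section \<open>The shift flow on coefficient fields\<close>

lemma space_coeff_law: "coeff_law P \<Longrightarrow> space P = {A. smooth A}"
  using sets_eq_imp_space_eq[of P coeff_space]
  by (simp add: coeff_law_def coeff_space_def space_restrict_space space_PiM)

lemma measurable_evaluation:
  assumes "coeff_law P"
  shows "(\<lambda>A. A x) \<in> borel_measurable P"
proof -
  have "(\<lambda>A. A x) \<in> borel_measurable coeff_space"
    unfolding coeff_space_def by (intro measurable_restrict_space1 measurable_component_singleton) simp
  then show ?thesis using assms by (simp add: coeff_law_def cong: measurable_cong_sets)
qed

lemma measurable_into_coeff:
  assumes law: "coeff_law P" and sm: "\<And>w. w \<in> space N \<Longrightarrow> smooth (g w)"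
    and m: "\<And>x. (\<lambda>w. g w x) \<in> borel_measurable N"
  shows "g \<in> N \<rightarrow>\<^sub>M P"
proof -
  have "(\<lambda>w x. g w x) \<in> N \<rightarrow>\<^sub>M (\<Pi>\<^sub>M x\<in>UNIV. borel)"
    by (rule measurable_PiM_single') (auto intro: m)
  then have "g \<in> N \<rightarrow>\<^sub>M coeff_space"
    unfolding coeff_space_def using sm by (intro measurable_restrict_space2) auto
  then show ?thesis using law by (simp add: coeff_law_def cong: measurable_cong_sets)
qed

lemma coeff_jointly_measurable:
  assumes "coeff_law P"
  shows "(\<lambda>(A, x). A x) \<in> borel_measurable (P \<Otimes>\<^sub>M lborel)"
  by (rule evaluation_jointly_measurable)
    (auto intro: measurable_evaluation assms smooth_continuous simp: space_coeff_law[OF assms])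

lemma ergodic_flow_shift:
  fixes P :: "('d::finite) coeff measure"
  assumes law: "coeff_law P" and stat: "stationary_law P" and erg: "ergodic_law P"
  shows "ergodic_flow P shift"
proof -
  interpret prob_space P using law by (simp add: coeff_law_def)
  show ?thesis
  proof unfold_locales
    show "(\<lambda>(A, x). shift x A) \<in> P \<Otimes>\<^sub>M lborel \<rightarrow>\<^sub>M P"
    proof (rule measurable_into_coeff[OF law])
      show "smooth (case w of (A, x) \<Rightarrow> shift x A)" if "w \<in> space (P \<Otimes>\<^sub>M lborel)" for w
        using that by (auto simp: space_pair_measure space_coeff_law[OF law] smooth_shift)
      fix y :: "real^'d"
      have "(\<lambda>w. (fst w, y + snd w)) \<in> P \<Otimes>\<^sub>M lborel \<rightarrow>\<^sub>M P \<Otimes>\<^sub>M lborel" by measurable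
      from measurable_compose[OF this coeff_jointly_measurable[OF law]]
      show "(\<lambda>w. (case w of (A, x) \<Rightarrow> shift x A) y) \<in> borel_measurable (P \<Otimes>\<^sub>M lborel)"
        by (simp add: shift_def case_prod_beta')
    qed
    show "distr P P (shift x) = P" for x using stat by (simp add: stationary_law_def)
    show "AE A in P. Y A = (LINT A'|P. Y A')" if "integrable P Y" "\<forall>A\<in>space P. \<forall>z. Y (shift z A) = Y A"
      for Y :: "'d coeff \<Rightarrow> real"
      using erg that by (simp add: ergodic_law_def)
  qed (auto simp: shift_def fun_eq_iff add_ac)
qed

section \<open>Corrector gradients and rotated media\<close>

text \<open>The gradient of a corrector is the stationary field generated by its value at the origin. The
  definition of stationarity gives this only up to null sets in space; the precise representatives
  of the two sides agree at every point.\<close>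

lemma corrector_gradient:
  fixes P :: "('d::finite) coeff measure"
  assumes law: "coeff_law P" and stat: "stationary_law P" and erg: "ergodic_law P" and p: "p \<ge> 2"
    and cor: "corrector P p K \<xi> \<phi>"
  defines "f \<equiv> \<lambda>A. wgrad (\<phi> A) 0"
  shows "f \<in> borel_measurable P"
    and "integrable P (\<lambda>A. norm (f A) powr p)"
    and "(LINT A|P. f A) = 0"
    and "AE A in P. AE x in lborel. wgrad (\<phi> A) x = f (shift x A)"
    and "ergodic_flow.curl_free P shift f"
proof -
  interpret ergodic_flow P shift by (rule ergodic_flow_shift[OF law stat erg])
  define X where "X A = wgrad (\<phi> A)" for A
  have X_joint: "(\<lambda>(A, x). X A x) \<in> borel_measurable (P \<Otimes>\<^sub>M lborel)"
    and X_stat: "\<And>z. AE A in P. AE x in lborel. X A (x + z) = X (shift z A) x"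
    using cor by (auto simp: corrector_def stationary_field_def random_field_def X_def)
  have "(\<lambda>A. (A, 0)) \<in> P \<rightarrow>\<^sub>M P \<Otimes>\<^sub>M lborel" by measurable
  from measurable_compose[OF this X_joint] show f [measurable]: "f \<in> borel_measurable P"
    by (simp add: f_def X_def)
  have Xm: "X A \<in> borel_measurable borel" if "A \<in> space P" for A
    using measurable_Pair2[OF X_joint that] by simp
  show "(LINT A|P. f A) = 0" using cor by (simp add: corrector_def f_def)
  show "integrable P (\<lambda>A. norm (f A) powr p)"
  proof (rule integrableI_bounded)
    have "(\<integral>\<^sup>+A. ennreal (norm (norm (f A) powr p)) \<partial>P)
      \<le> (\<integral>\<^sup>+A. ennreal ((norm (f A))\<^sup>2 + rpow (norm (f A)) p) \<partial>P)"
      using p by (intro nn_integral_mono ennreal_leI) (auto simp: rpow_def)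
    also have "\<dots> \<le> ennreal (K * ((norm \<xi>)\<^sup>2 + rpow (norm \<xi>) p))"
      using cor by (simp add: corrector_def f_def)
    also have "\<dots> < \<infinity>" by simp
    finally show "(\<integral>\<^sup>+A. ennreal (norm (norm (f A) powr p)) \<partial>P) < \<infinity>" .
  qed measurable
  define good where "good A \<longleftrightarrow> A \<in> space P \<and> W1p_loc p (\<phi> A)" for A
  have good: "AE A in P. good A"
    using cor AE_space unfolding corrector_def good_def by auto
  have rep: "\<exists>H. weak_gradient (\<phi> A) H \<and> H \<in> borel_measurable borel \<and> X A = precise_rep H \<and>
      ball_avg (X A) = ball_avg H \<and> (AE x in lborel. X A x = H x)" if "good A" for A
  proof -
    obtain H where H: "weak_gradient (\<phi> A) H" "wgrad (\<phi> A) = precise_rep H" "AE x in lborel. wgrad (\<phi> A) x = H x"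
      using wgrad_representative[of p "\<phi> A"] \<open>good A\<close> by (auto simp: good_def)
    have m: "H \<in> borel_measurable borel" using H(1) by (intro loc_integrable_measurable) (simp add: weak_gradient_def)
    have "ball_avg (X A) = ball_avg H"
    proof
      show "ball_avg (X A) z = ball_avg H z" for z
        using H(3) \<open>good A\<close> by (intro ball_avg_cong_AE[OF Xm m]) (auto simp: good_def X_def)
    qed
    then show ?thesis using H m by (auto simp: X_def)
  qed
  have point: "AE A in P. X A z = f (shift z A)" for z
    using good AE_T[OF good, of z] X_stat[of z]
  proof eventually_elim
    case (elim A)
    obtain H H' where H: "X A = precise_rep H" "ball_avg (X A) = ball_avg H"
      and H': "X (shift z A) = precise_rep H'" "ball_avg (X (shift z A)) = ball_avg H'"
      using rep[OF elim(1)] rep[OF elim(2)] by blast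
    have [measurable]: "X A \<in> borel_measurable borel" "X (shift z A) \<in> borel_measurable borel"
      using elim(1,2) Xm by (auto simp: good_def)
    have "ball_avg H' 0 = ball_avg (\<lambda>x. X A (x + z)) 0"
      unfolding H'(2)[symmetric] by (rule ball_avg_cong_AE[symmetric]) (use elim(3) in measurable)
    also have "\<dots> = ball_avg H z" unfolding H(2)[symmetric] by (rule ball_avg_shift) measurable
    finally have "precise_rep H' 0 = precise_rep H z" by (rule precise_rep_cong)
    then show ?case using H(1) H'(1) by (simp add: f_def X_def)
  qed
  have field: "AE A in P. AE x in lborel. X A x = f (shift x A)"
  proof (rule AE_flow_swap[OF _ point])
    have [measurable]: "(\<lambda>z. X (fst z) (snd z)) \<in> borel_measurable (P \<Otimes>\<^sub>M lborel)"
      using X_joint by (simp add: case_prod_beta')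
    show "Measurable.pred (P \<Otimes>\<^sub>M lborel) (\<lambda>(A, x). X A x = f (shift x A))" by measurable
  qed
  then show "AE A in P. AE x in lborel. wgrad (\<phi> A) x = f (shift x A)" by (simp add: X_def)
  show "curl_free f"
    unfolding curl_free_def
  proof (intro allI impI)
    fix s r :: real assume s: "s > 0" and r: "r > 0"
    show "AE A in P. \<forall>v w. (LINT x|lborel. (f (shift x A) \<bullet> v) * (bump_grad s r x \<bullet> w))
      = (LINT x|lborel. (f (shift x A) \<bullet> w) * (bump_grad s r x \<bullet> v))"
      using good field
    proof eventually_elim
      case (elim A)
      have A [measurable]: "A \<in> space P" using elim(1) by (simp add: good_def)
      obtain H where H: "weak_gradient (\<phi> A) H" and [measurable]: "H \<in> borel_measurable borel"
        and XH: "AE x in lborel. X A x = H x"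
        using rep[OF elim(1)] by blast
      have eq: "AE x in lborel. f (shift x A) = H x"
        using elim(2) XH by eventually_elim simp
      have "(LINT x|lborel. (f (shift x A) \<bullet> v) * (bump_grad s r x \<bullet> w)) = (LINT x|lborel. (H x \<bullet> v) * (bump_grad s r x \<bullet> w))" for v w
      proof (rule integral_cong_AE)
        show "AE x in lborel. (f (shift x A) \<bullet> v) * (bump_grad s r x \<bullet> w) = (H x \<bullet> v) * (bump_grad s r x \<bullet> w)"
          using eq by eventually_elim simp
      qed measurable
      then show ?case using weak_gradient_curl_free[OF H s r] by simp
    qed
  qed
qed

lemma corrector_flux_divergence_free:
  fixes P :: "('d::finite) coeff measure"
  assumes law: "coeff_law P" and stat: "stationary_law P" and erg: "ergodic_law P" and p: "p \<ge> 2"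
    and cor: "corrector P p K \<xi> \<phi>"
    and \<beta>: "\<beta> \<in> borel_measurable P" "AE A in P. \<forall>x. A x = \<beta> (shift x A) *\<^sub>R mat 1"
  shows "ergodic_flow.divergence_free P shift
    (\<lambda>A. \<beta> A *\<^sub>R ((1 + rpow (norm (\<xi> + wgrad (\<phi> A) 0)) (p - 2)) *\<^sub>R (\<xi> + wgrad (\<phi> A) 0)))"
proof -
  interpret ergodic_flow P shift by (rule ergodic_flow_shift[OF law stat erg])
  note grad = corrector_gradient[OF law stat erg p cor]
  define f where "f A = wgrad (\<phi> A) 0" for A
  define q where "q A = \<beta> A *\<^sub>R ((1 + rpow (norm (\<xi> + f A)) (p - 2)) *\<^sub>R (\<xi> + f A))" for A
  have [measurable]: "f \<in> borel_measurable P" using grad(1) by (simp add: f_def[abs_def])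
  note [measurable] = \<beta>(1)
  have rpow_m [measurable]: "(\<lambda>t. rpow t (p - 2)) \<in> borel_measurable borel" by (simp add: rpow_def)
  have X_joint: "(\<lambda>(A, x). wgrad (\<phi> A) x) \<in> borel_measurable (P \<Otimes>\<^sub>M lborel)"
    using cor by (auto simp: corrector_def stationary_field_def random_field_def)
  have qm [measurable]: "q \<in> borel_measurable P" unfolding q_def[abs_def] by measurable
  have eqn: "AE A in P. \<forall>\<eta>. test_fun \<eta> \<longrightarrow> (LINT x|lborel. flux p A x (\<xi> + wgrad (\<phi> A) x) \<bullet> grad \<eta> x) = 0"
    using cor by (simp add: corrector_def)
  show ?thesis
    unfolding divergence_free_def f_def[symmetric] q_def[symmetric]
  proof (intro allI impI)
    fix s r :: real assume s: "s > 0" and r: "r > 0"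
    show "AE A in P. (LINT x|lborel. q (shift x A) \<bullet> bump_grad s r x) = 0"
      using \<beta>(2) grad(4) eqn AE_space
    proof eventually_elim
      case (elim A)
      have A [measurable]: "A \<in> space P" by (rule elim)
      have [measurable]: "wgrad (\<phi> A) \<in> borel_measurable borel"
        using measurable_Pair2[OF X_joint A] by simp
      have Amult: "A x *v \<zeta> = \<beta> (shift x A) *\<^sub>R \<zeta>" for x \<zeta>
        using elim(1) by (metis matrix_vector_mul_lid scaleR_matrix_vector_assoc)
      have fl: "flux p A x \<zeta> = \<beta> (shift x A) *\<^sub>R ((1 + rpow (norm \<zeta>) (p - 2)) *\<^sub>R \<zeta>)" for x \<zeta>
        unfolding flux_def by (rule Amult)
      have "(LINT x|lborel. q (shift x A) \<bullet> bump_grad s r x)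
        = (LINT x|lborel. flux p A x (\<xi> + wgrad (\<phi> A) x) \<bullet> grad (bump s r) x)"
      proof (rule integral_cong_AE)
        show "(\<lambda>x. flux p A x (\<xi> + wgrad (\<phi> A) x) \<bullet> grad (bump s r) x) \<in> borel_measurable lborel"
          unfolding fl grad_bump by measurable
        show "AE x in lborel. q (shift x A) \<bullet> bump_grad s r x = flux p A x (\<xi> + wgrad (\<phi> A) x) \<bullet> grad (bump s r) x"
          using elim(2) by eventually_elim (simp add: fl q_def grad_bump f_def)
      qed measurable
      also have "\<dots> = 0" using elim(3) test_fun_bump[OF s r] by blast
      finally show ?case .
    qed
  qed
qed

text \<open>The law of a scalar field determines the law of the matrix field: composition with \<open>R\<close> preserves
  the joint distribution of \<open>b\<close>, and \<open>A\<close> is almost surely a measurable image \<open>C (b A)\<close> of it.\<close>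

lemma rotation_preserves_law:
  fixes P :: "('d::finite) coeff measure"
  assumes law: "coeff_law P" and R: "linear R"
    and b: "\<And>x. (\<lambda>A. b A x) \<in> borel_measurable P"
    and scal: "AE A in P. \<forall>x. A x = b A x *\<^sub>R mat 1"
    and iso: "joint_law P (\<lambda>A x. b A (R x)) = joint_law P b"
  shows "(\<lambda>A x. A (R x)) \<in> P \<rightarrow>\<^sub>M P" and "distr P P (\<lambda>A x. A (R x)) = P"
proof -
  let ?U = "\<lambda>(A :: 'd coeff) x. A (R x)"
  note ev = measurable_evaluation[OF law]
  show U: "?U \<in> P \<rightarrow>\<^sub>M P"
  proof (rule measurable_into_coeff[OF law])
    show "smooth (\<lambda>x. A (R x))" if "A \<in> space P" for A
      using that smooth_affine_pullback[OF _ R, of A 0] by (simp add: space_coeff_law[OF law])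
  qed (rule ev)
  define C where "C c x = c x *\<^sub>R (mat 1 :: real^'d^'d)" for c :: "real^'d \<Rightarrow> real" and x
  let ?PR = "\<Pi>\<^sub>M x\<in>(UNIV :: (real^'d) set). (borel :: real measure)"
  let ?PMat = "\<Pi>\<^sub>M x\<in>(UNIV :: (real^'d) set). (borel :: (real^'d^'d) measure)"
  have C: "C \<in> ?PR \<rightarrow>\<^sub>M ?PMat"
  proof -
    have "(\<lambda>c x. c x *\<^sub>R (mat 1 :: real^'d^'d)) \<in> ?PR \<rightarrow>\<^sub>M ?PMat"
    proof (rule measurable_PiM_single')
      show "(\<lambda>c. c x *\<^sub>R (mat 1 :: real^'d^'d)) \<in> borel_measurable ?PR" for x
        by (intro borel_measurable_scaleR measurable_component_singleton borel_measurable_const) simp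
    qed auto
    then show ?thesis by (simp add: C_def[abs_def])
  qed
  have bm: "(\<lambda>A x. b A (S x)) \<in> P \<rightarrow>\<^sub>M ?PR" for S :: "real^'d \<Rightarrow> real^'d"
    by (rule measurable_PiM_single') (auto intro: b)
  show "distr P P ?U = P"
  proof (rule measure_eqI)
    fix E assume "E \<in> sets (distr P P ?U)"
    then have E: "E \<in> sets P" by simp
    then obtain E0 where E0: "E0 \<in> sets ?PMat" "E = {A. smooth A} \<inter> E0"
      using law by (auto simp: coeff_law_def coeff_space_def sets_restrict_space)
    have meas: "(\<lambda>A. C (\<lambda>x. b A (S x))) -` E0 \<inter> space P \<in> sets P" for S :: "real^'d \<Rightarrow> real^'d"
      by (rule measurable_sets[OF measurable_compose[OF bm C] E0(1)])
    have inv: "emeasure P ((\<lambda>A. C (\<lambda>x. b A (S x))) -` E0 \<inter> space P)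
      = emeasure (joint_law P (\<lambda>A x. b A (S x))) (C -` E0 \<inter> space ?PR)" for S :: "real^'d \<Rightarrow> real^'d"
      unfolding joint_law_def
      by (subst emeasure_distr[OF bm measurable_sets[OF C E0(1)]])
        (auto intro!: arg_cong[where f = "emeasure P"] simp: space_PiM)
    have "emeasure (distr P P ?U) E = emeasure P (?U -` E \<inter> space P)"
      by (rule emeasure_distr[OF U E])
    also have "\<dots> = emeasure P ((\<lambda>A. C (\<lambda>x. b A (R x))) -` E0 \<inter> space P)"
    proof (rule emeasure_eq_AE)
      show "AE A in P. (A \<in> ?U -` E \<inter> space P) = (A \<in> (\<lambda>A. C (\<lambda>x. b A (R x))) -` E0 \<inter> space P)"
        using scal AE_space
      proof eventually_elim
        case (elim A)
        have "?U A \<in> space P" by (rule measurable_space[OF U elim(2)])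
        moreover have "?U A = C (\<lambda>x. b A (R x))" using elim(1) by (simp add: C_def fun_eq_iff)
        ultimately show ?case using elim(2) by (auto simp: E0(2) space_coeff_law[OF law])
      qed
    qed (use U E meas in \<open>auto intro: measurable_sets\<close>)
    also have "\<dots> = emeasure P ((\<lambda>A. C (\<lambda>x. b A x)) -` E0 \<inter> space P)"
      using inv[of R] inv[of "\<lambda>x. x"] iso by simp
    also have "\<dots> = emeasure P E"
    proof (rule emeasure_eq_AE)
      show "AE A in P. (A \<in> (\<lambda>A. C (\<lambda>x. b A x)) -` E0 \<inter> space P) = (A \<in> E)"
        using scal AE_space
      proof eventually_elim
        case (elim A)
        have "A = C (b A)" using elim(1) by (simp add: C_def fun_eq_iff)
        then show ?case using elim(2) by (auto simp: E0(2) space_coeff_law[OF law])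
      qed
    qed (use E meas[of "\<lambda>x. x"] in auto)
    finally show "emeasure (distr P P ?U) E = emeasure P E" .
  qed simp
qed

context scalar_medium
begin

text \<open>If \<open>S\<close> is a rotation and \<open>U\<close> rotates the medium, \<open>S (f \<xi> (U A))\<close> is a competitor for the direction
  \<open>S \<xi>\<close> with the energy of \<open>f \<xi>\<close>: it is the gradient of the corrector of the rotated medium, rotated
  back.\<close>

lemma rotated_competitor:
  fixes S S' :: "'v \<Rightarrow> 'v" and U :: "'w \<Rightarrow> 'w"
  assumes S: "linear S" and inv: "\<And>x. S (S' x) = x" "\<And>x. S' (S x) = x"
    and isom: "\<And>x y. S x \<bullet> S y = x \<bullet> y"
    and U [measurable]: "U \<in> M \<rightarrow>\<^sub>M M" and U_distr: "distr M M U = M"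
    and UT: "\<And>x A. A \<in> space M \<Longrightarrow> U (T x A) = T (S' x) (U A)"
    and \<beta>U: "\<And>A. A \<in> space M \<Longrightarrow> \<beta> (U A) = \<beta> A"
  shows "\<exists>g. competitor g \<and> energy (S \<xi>) g = min_energy \<xi>"
proof -
  define g where "g A = S (f \<xi> (U A))" for A
  have norm: "norm (S x) = norm x" for x using isom[of x x] by (simp add: norm_eq_sqrt_inner)
  have adj: "S x \<bullet> y = x \<bullet> S' y" for x y using isom[of x "S' y"] inv by simp
  have bl: "bounded_linear S" using S by (simp add: linear_conv_bounded_linear)
  have [measurable]: "S \<in> borel_measurable borel"
    by (intro borel_measurable_continuous_onI linear_continuous_on bl)
  have iU: "(LINT A|M. h (U A)) = (LINT A|M. h A)" if "h \<in> borel_measurable M"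
    for h :: "'w \<Rightarrow> 'c::{banach, second_countable_topology}"
    using integral_distr[OF U that] by (simp add: U_distr)
  have intU: "integrable M (\<lambda>A. h (U A))" if "integrable M h"
    for h :: "'w \<Rightarrow> 'c::{banach, second_countable_topology}"
    using integrable_distr[OF U, of h] that by (simp add: U_distr)
  have gm: "g \<in> borel_measurable M" unfolding g_def[abs_def] by measurable
  have gp: "integrable M (\<lambda>A. norm (g A) powr p)" unfolding g_def norm by (rule intU[OF f_powr])
  have fi: "integrable M (f \<xi>)" by (rule integrable_norm_powr_imp_integrable[OF f_measurable exponent_bounds(2) f_powr])
  have "(LINT A|M. g A) = S (LINT A|M. f \<xi> (U A))"
    unfolding g_def by (rule integral_bounded_linear[OF bl intU[OF fi]])
  also have "(LINT A|M. f \<xi> (U A)) = 0" using iU[OF f_measurable[of \<xi>]] f_mean by simp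
  finally have g0: "(LINT A|M. g A) = 0" using linear_0[OF S] by simp
  have "curl_free g"
    unfolding curl_free_def
  proof (intro allI impI)
    fix s r :: real assume s: "s > 0" and r: "r > 0"
    have "AE A in distr M M U. \<forall>v w. (LINT x|lborel. (f \<xi> (T x A) \<bullet> v) * (bump_grad s r x \<bullet> w)) =
      (LINT x|lborel. (f \<xi> (T x A) \<bullet> w) * (bump_grad s r x \<bullet> v))"
      unfolding U_distr using f_curl s r by (simp add: curl_free_def)
    from AE_distrD[OF U this]
    show "AE A in M. \<forall>v w. (LINT x|lborel. (g (T x A) \<bullet> v) * (bump_grad s r x \<bullet> w)) =
      (LINT x|lborel. (g (T x A) \<bullet> w) * (bump_grad s r x \<bullet> v))"
      using AE_space
    proof eventually_elim
      case (elim A)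
      have [measurable]: "A \<in> space M" by (rule elim)
      note [measurable] = gm
      have D: "bump_grad s r (S y) = S (bump_grad s r y)" for y
        unfolding bump_grad_def isom linear_scale[OF S] ..
      have "(LINT x|lborel. (g (T x A) \<bullet> v) * (bump_grad s r x \<bullet> w))
        = (LINT y|lborel. (f \<xi> (T y (U A)) \<bullet> S' v) * (bump_grad s r y \<bullet> S' w))" for v w
      proof -
        have "(LINT x|lborel. (g (T x A) \<bullet> v) * (bump_grad s r x \<bullet> w))
          = (LINT x|distr lborel borel S. (g (T x A) \<bullet> v) * (bump_grad s r x \<bullet> w))"
          by (simp only: lborel_distr_isometry[OF S inv(1) norm])
        also have "\<dots> = (LINT y|lborel. (g (T (S y) A) \<bullet> v) * (bump_grad s r (S y) \<bullet> w))"
          by (rule integral_distr) measurable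
        also have "\<dots> = (LINT y|lborel. (f \<xi> (T y (U A)) \<bullet> S' v) * (bump_grad s r y \<bullet> S' w))"
          using elim(2) by (simp add: g_def UT inv adj D)
        finally show ?thesis .
      qed
      then show ?case using elim(1) by simp
    qed
  qed
  then have "competitor g" using gm gp g0 by (simp add: competitor_def)
  moreover have "energy (S \<xi>) g = min_energy \<xi>"
  proof -
    have [measurable]: "p_energy p \<in> borel_measurable borel" unfolding p_energy_def[abs_def] by measurable
    have "energy (S \<xi>) g = (LINT A|M. \<beta> (U A) * p_energy p (norm (\<xi> + f \<xi> (U A))))"
      unfolding energy_def
      by (intro Bochner_Integration.integral_cong) (auto simp: g_def \<beta>U linear_add[OF S, symmetric] norm)
    also have "\<dots> = min_energy \<xi>"
      unfolding min_energy_def energy_def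
      by (rule iU[of "\<lambda>A. \<beta> A * p_energy p (norm (\<xi> + f \<xi> A))"]) measurable
    finally show ?thesis .
  qed
  ultimately show ?thesis by blast
qed

text \<open>In one dimension there are no rotations, but the energy density is even.\<close>

lemma negated_competitor: "competitor (\<lambda>A. - f \<xi> A) \<and> energy (- \<xi>) (\<lambda>A. - f \<xi> A) = min_energy \<xi>"
proof -
  have "norm (- \<xi> - f \<xi> A) = norm (\<xi> + f \<xi> A)" for A
    by (metis norm_minus_cancel minus_add_distrib uminus_add_conv_diff add.commute)
  then have "energy (- \<xi>) (\<lambda>A. - f \<xi> A) = min_energy \<xi>"
    by (simp add: energy_def min_energy_def)
  moreover have "curl_free (\<lambda>A. - f \<xi> A)"
    using f_curl[of \<xi>] by (simp add: curl_free_def)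
  ultimately show ?thesis using f_powr f_mean by (simp add: competitor_def)
qed

end

section \<open>Monotonicity of the homogenized map\<close>

lemma same_norm_dimension_one:
  fixes \<xi> \<eta> :: "real^'d"
  assumes card: "CARD('d) = 1" and eq: "norm \<xi> = norm \<eta>"
  shows "\<eta> = \<xi> \<or> \<eta> = - \<xi>"
proof -
  obtain k :: 'd where k: "UNIV = {k}" using card card_1_singletonE by blast
  have all: "i = k" for i using k by auto
  have "norm z = \<bar>z $ k\<bar>" for z :: "real^'d" by (simp add: norm_vec_def L2_set_def k)
  then have "\<eta> $ k = \<xi> $ k \<or> \<eta> $ k = - (\<xi> $ k)" using eq by (auto simp: abs_eq_iff)
  then show ?thesis by (auto simp: vec_eq_iff) (metis all)+
qed

theorem theorem2p4:
  fixes P :: "('d::finite) coeff measure"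
    and p lam K :: real
    and b :: "'d coeff \<Rightarrow> real^'d \<Rightarrow> real"
    and \<Phi> :: "real^'d \<Rightarrow> 'd coeff \<Rightarrow> real^'d \<Rightarrow> real"
  assumes "p \<ge> 2" and "0 < lam" and "lam \<le> 1"
    and "coeff_law P"
    and "stationary_law P"
    and "ergodic_law P"
    and "uniformly_smooth_law P"
    and "elliptic_law lam P"
    and corrector: "\<And>\<xi>. corrector P p K \<xi> (\<Phi> \<xi>)"
    and "\<And>x. (\<lambda>A. b A x) \<in> borel_measurable P"
    and "AE A in P. \<forall>x. A x = b A x *\<^sub>R mat 1"
    and isotropic: "\<And>R. rotation_matrix R \<Longrightarrow> joint_law P (\<lambda>A x. b A (R *v x)) = joint_law P b"
  shows "\<exists>C>0. \<forall>\<xi>\<^sub>1 \<xi>\<^sub>2.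
     (homogenized_map P p \<Phi> \<xi>\<^sub>1 - homogenized_map P p \<Phi> \<xi>\<^sub>2) \<bullet> (\<xi>\<^sub>1 - \<xi>\<^sub>2)
       \<ge> 1 / C * ((norm (\<xi>\<^sub>1 - \<xi>\<^sub>2))\<^sup>2 + rpow (norm (\<xi>\<^sub>1 - \<xi>\<^sub>2)) p) \<and>
     (homogenized_map P p \<Phi> \<xi>\<^sub>1 - homogenized_map P p \<Phi> \<xi>\<^sub>2) \<bullet> (\<xi>\<^sub>1 - \<xi>\<^sub>2)
       \<ge> 1 / C * (rpow (norm \<xi>\<^sub>1) (p - 2) + rpow (norm \<xi>\<^sub>2) (p - 2)) * (norm (\<xi>\<^sub>1 - \<xi>\<^sub>2))\<^sup>2"
proof -
  note p = assms(1) and lam = assms(2) and law = assms(4) and stat = assms(5) and erg = assms(6)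
    and ell = assms(8) and bm = assms(10) and scal = assms(11)
  interpret flow: ergodic_flow P shift by (rule ergodic_flow_shift[OF law stat erg])
  note grad = corrector_gradient[OF law stat erg p corrector]
  \<comment> \<open>Any diagonal entry at the origin is the scalar coefficient there.\<close>
  obtain k :: 'd where True by simp
  define \<beta> where "\<beta> A = A 0 $ k $ k" for A :: "'d coeff"
  define f where "f \<xi> A = wgrad (\<Phi> \<xi> A) 0" for \<xi> A
  have \<beta>m: "\<beta> \<in> borel_measurable P"
  proof -
    have "(\<lambda>A. A 0 \<bullet> axis k (axis k 1)) \<in> borel_measurable P"
      using measurable_evaluation[OF law, of 0] by measurable
    then show ?thesis by (simp add: \<beta>_def[abs_def] inner_axis)
  qed
  have scal': "AE A in P. \<forall>x. A x = \<beta> (shift x A) *\<^sub>R mat 1"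
    using scal
  proof eventually_elim
    case (elim A)
    show ?case
    proof
      fix x
      have "A x $ k $ k = (b A x *\<^sub>R (mat 1 :: real^'d^'d)) $ k $ k" using elim by simp
      also have "\<dots> = b A x" by (simp add: mat_def)
      finally show "A x = \<beta> (shift x A) *\<^sub>R mat 1" using elim by (simp add: \<beta>_def shift_def)
    qed
  qed
  have mult0: "AE A in P. \<forall>\<zeta>. A 0 *v \<zeta> = \<beta> A *\<^sub>R \<zeta>"
    using scal'
  proof eventually_elim
    case (elim A)
    from elim[rule_format, of 0] have A0: "A 0 = \<beta> A *\<^sub>R mat 1" by (simp add: shift_def \<beta>_def)
    have "(\<beta> A *\<^sub>R mat 1) *v \<zeta> = \<beta> A *\<^sub>R \<zeta>" for \<zeta> :: "real^'d"
      by (metis matrix_vector_mul_lid scaleR_matrix_vector_assoc)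
    with A0 show ?case by simp
  qed
  have bounds: "AE A in P. lam \<le> \<beta> A \<and> \<beta> A \<le> 1"
    using ell[unfolded elliptic_law_def] mult0
  proof eventually_elim
    case (elim A)
    have "norm (axis k (1::real)) = 1" by simp
    with elim(1)[rule_format, of "axis k 1" 0] elim(2) show ?case
      by (simp add: power2_norm_eq_inner[symmetric] abs_le_iff)
  qed
  interpret scalar_medium P shift \<beta> p lam f
  proof unfold_locales
    show "flow.divergence_free (\<lambda>A. \<beta> A *\<^sub>R ((1 + rpow (norm (\<xi> + f \<xi> A)) (p - 2)) *\<^sub>R (\<xi> + f \<xi> A)))" for \<xi>
      unfolding f_def by (rule corrector_flux_divergence_free[OF law stat erg p corrector \<beta>m scal'])
  qed (use p lam \<beta>m bounds grad in \<open>simp_all add: f_def[abs_def]\<close>)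
  have hom: "homogenized_map P p \<Phi> \<xi> = mean_flux \<xi>" for \<xi>
    unfolding homogenized_map_def mean_flux_def
  proof (rule integral_cong_AE)
    have eq: "AE A in P. flux p A 0 (\<xi> + wgrad (\<Phi> \<xi> A) 0) = flux_at \<xi> A"
      using mult0 by eventually_elim (simp add: flux_def flux_at_def f_def)
    then show "AE A in P. flux p A 0 (\<xi> + wgrad (\<Phi> \<xi> A) 0) = flux_at \<xi> A" .
    have [measurable]: "(\<lambda>A. A 0 *v h A) \<in> borel_measurable P" if [measurable]: "h \<in> borel_measurable P"
      for h :: "'d coeff \<Rightarrow> real^'d"
    proof -
      have [measurable]: "(\<lambda>A. A 0) \<in> borel_measurable P" by (rule measurable_evaluation[OF law])
      have "(\<lambda>z :: (real^'d^'d) \<times> (real^'d). fst z *v snd z) \<in> borel_measurable borel"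
        unfolding matrix_vector_mult_def
        by (intro borel_measurable_continuous_onI continuous_on_vec_lambda continuous_intros)
      from measurable_compose[OF _ this, of "\<lambda>A. (A 0, h A)" P] show ?thesis by simp
    qed
    have [measurable]: "(\<lambda>A. wgrad (\<Phi> \<xi> A) 0) \<in> borel_measurable P" using f_measurable[of \<xi>] by (simp add: f_def[abs_def])
    show "(\<lambda>A. flux p A 0 (\<xi> + wgrad (\<Phi> \<xi> A) 0)) \<in> borel_measurable P"
      unfolding flux_def by measurable
  qed measurable
  have radial: "\<exists>g. competitor g \<and> energy \<eta> g = min_energy \<xi>" if eq: "norm \<xi> = norm \<eta>" for \<xi> \<eta>
  proof (cases "CARD('d) = 1")
    case True
    from same_norm_dimension_one[OF this eq] show ?thesis
    proof
      assume "\<eta> = \<xi>"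
      then show ?thesis using f_competitor[of \<xi>] by (auto simp: min_energy_def)
    next
      assume "\<eta> = - \<xi>"
      then show ?thesis using negated_competitor[of \<xi>] by blast
    qed
  next
    case False
    then have "CARD('d) \<ge> 2" using zero_less_card_finite[where 'a = 'd] by linarith
    from rotation_exists[OF this eq] obtain S where S: "orthogonal_transformation S" "det (matrix S) = 1" "S \<xi> = \<eta>" .
    have lin: "linear S" using S(1) by (rule orthogonal_transformation_linear)
    have orth: "orthogonal_matrix (matrix S)" using S(1) by (simp add: orthogonal_transformation_matrix)
    have Smat: "matrix S *v x = S x" for x using fun_cong[OF matrix_vector_mul(2)[OF lin], of x] by simp
    define S' where "S' x = transpose (matrix S) *v x" for x
    have inv: "S (S' x) = x" "S' (S x) = x" for x
      using orth by (simp_all add: S'_def Smat[symmetric] matrix_vector_mul_assoc orthogonal_matrix_def del: transpose_matrix_vector)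
    have iso: "joint_law P (\<lambda>A x. b A (S x)) = joint_law P b"
      using isotropic[of "matrix S"] orth S(2) by (simp add: rotation_matrix_def Smat)
    have "\<exists>g. competitor g \<and> energy (S \<xi>) g = min_energy \<xi>"
    proof (rule rotated_competitor[OF lin inv _ rotation_preserves_law[OF law lin bm scal iso]])
      show "S x \<bullet> S y = x \<bullet> y" for x y using S(1) by (simp add: orthogonal_transformation_def)
      show "(\<lambda>y. shift x A (S y)) = shift (S' x) (\<lambda>y. A (S y))" for x A
        by (simp add: shift_def fun_eq_iff linear_add[OF lin] inv)
      show "\<beta> (\<lambda>x. A (S x)) = \<beta> A" for A by (simp add: \<beta>_def linear_0[OF lin])
    qed
    with S(3) show ?thesis by simp
  qed
  \<comment> \<open>The factor \<open>2\<^sup>p\<close> comes from bounding a power of \<open>|\<xi>\<^sub>1 - \<xi>\<^sub>2|\<close> by powers of \<open>|\<xi>\<^sub>1|\<close> and \<open>|\<xi>\<^sub>2|\<close>.\<close>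
  define C where "C = 2 * 2 powr p / lam"
  have two: "2 powr p \<ge> 1" using p by (simp add: ge_one_powr_ge_zero)
  have C: "C > 0" "1 / C = lam / 2 / 2 powr p" using lam by (auto simp: C_def)
  show ?thesis
  proof (intro exI[of _ C] conjI C allI)
    fix \<xi>\<^sub>1 \<xi>\<^sub>2 :: "real^'d"
    define \<rho>\<^sub>1 where "\<rho>\<^sub>1 = rpow (norm \<xi>\<^sub>1) (p - 2)"
    define \<rho>\<^sub>2 where "\<rho>\<^sub>2 = rpow (norm \<xi>\<^sub>2) (p - 2)"
    define d where "d = norm (\<xi>\<^sub>1 - \<xi>\<^sub>2)"
    define L where "L = (homogenized_map P p \<Phi> \<xi>\<^sub>1 - homogenized_map P p \<Phi> \<xi>\<^sub>2) \<bullet> (\<xi>\<^sub>1 - \<xi>\<^sub>2)"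
    have \<rho>: "\<rho>\<^sub>1 \<ge> 0" "\<rho>\<^sub>2 \<ge> 0" by (simp_all add: \<rho>\<^sub>1_def \<rho>\<^sub>2_def rpow_nonneg)
    have h1: "L \<ge> lam / 2 * (2 + \<rho>\<^sub>1 + \<rho>\<^sub>2) * d\<^sup>2"
      using monotone_of_radial_energy[OF radial, of \<xi>\<^sub>1 \<xi>\<^sub>2] by (simp add: L_def hom \<rho>\<^sub>1_def \<rho>\<^sub>2_def d_def)
    have h2: "1 / C * Q \<le> lam / 2 * (2 + \<rho>\<^sub>1 + \<rho>\<^sub>2) * d\<^sup>2" if "Q \<le> 2 powr p * ((2 + \<rho>\<^sub>1 + \<rho>\<^sub>2) * d\<^sup>2)" for Q
    proof -
      have "1 / C * Q \<le> 1 / C * (2 powr p * ((2 + \<rho>\<^sub>1 + \<rho>\<^sub>2) * d\<^sup>2))"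
        using that C(1) by (intro mult_left_mono) auto
      also have "\<dots> = lam / 2 * (2 + \<rho>\<^sub>1 + \<rho>\<^sub>2) * d\<^sup>2" unfolding C(2) by simp
      finally show ?thesis .
    qed
    have L_ge: "L \<ge> 1 / C * Q" if "Q \<le> 2 powr p * ((2 + \<rho>\<^sub>1 + \<rho>\<^sub>2) * d\<^sup>2)" for Q
      by (rule order_trans[OF h2[OF that] h1])
    have "rpow d (p - 2) \<le> 2 powr p * (\<rho>\<^sub>1 + \<rho>\<^sub>2)"
    proof (cases "p = 2")
      case True
      then show ?thesis using two by (simp add: \<rho>\<^sub>1_def \<rho>\<^sub>2_def rpow_def)
    next
      case False
      have "d powr (p - 2) \<le> 2 powr (p - 2) * (norm \<xi>\<^sub>1 powr (p - 2) + norm \<xi>\<^sub>2 powr (p - 2))"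
        unfolding d_def using p by (intro norm_diff_powr_le) auto
      also have "\<dots> \<le> 2 powr p * (norm \<xi>\<^sub>1 powr (p - 2) + norm \<xi>\<^sub>2 powr (p - 2))"
        by (intro mult_right_mono powr_mono) auto
      finally show ?thesis using False by (simp add: \<rho>\<^sub>1_def \<rho>\<^sub>2_def rpow_def)
    qed
    then have "(1 + rpow d (p - 2)) * d\<^sup>2 \<le> (2 powr p * 2 + 2 powr p * (\<rho>\<^sub>1 + \<rho>\<^sub>2)) * d\<^sup>2"
      using two by (intro mult_right_mono add_mono) auto
    moreover have "d\<^sup>2 + rpow d p = (1 + rpow d (p - 2)) * d\<^sup>2"
      using rpow_times_square[of d p] p by (simp add: d_def rpow_def[of _ p] distrib_right)
    ultimately have "d\<^sup>2 + rpow d p \<le> 2 powr p * ((2 + \<rho>\<^sub>1 + \<rho>\<^sub>2) * d\<^sup>2)"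
      by (simp add: algebra_simps)
    from L_ge[OF this] show "1 / C * ((norm (\<xi>\<^sub>1 - \<xi>\<^sub>2))\<^sup>2 + rpow (norm (\<xi>\<^sub>1 - \<xi>\<^sub>2)) p)
      \<le> (homogenized_map P p \<Phi> \<xi>\<^sub>1 - homogenized_map P p \<Phi> \<xi>\<^sub>2) \<bullet> (\<xi>\<^sub>1 - \<xi>\<^sub>2)"
      by (simp add: d_def L_def)
    have "1 * ((\<rho>\<^sub>1 + \<rho>\<^sub>2) * d\<^sup>2) \<le> 2 powr p * ((2 + \<rho>\<^sub>1 + \<rho>\<^sub>2) * d\<^sup>2)"
      using two \<rho> by (intro mult_mono mult_right_mono) auto
    from L_ge[of "(\<rho>\<^sub>1 + \<rho>\<^sub>2) * d\<^sup>2"] this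
    show "1 / C * (rpow (norm \<xi>\<^sub>1) (p - 2) + rpow (norm \<xi>\<^sub>2) (p - 2)) * (norm (\<xi>\<^sub>1 - \<xi>\<^sub>2))\<^sup>2
      \<le> (homogenized_map P p \<Phi> \<xi>\<^sub>1 - homogenized_map P p \<Phi> \<xi>\<^sub>2) \<bullet> (\<xi>\<^sub>1 - \<xi>\<^sub>2)"
      by (simp add: d_def L_def \<rho>\<^sub>1_def \<rho>\<^sub>2_def mult.assoc)
  qed
qed

end
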